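(* Let $\mu$ be a Borel probability measure on $\mathrm{GL}_d(\mathbb{R})$ with finite first moment, let $G_{\mathcal{S}}$ be the closed subgroup generated by $\operatorname{supp}(\mu)$, and let $P$ be a closed $G_{\mathcal{S}}$-invariant subset of the projective space $\mathbb{P}(\mathbb{R}^d)$. Then each of the following properties is equivalent to uniform expansion of $\mu$ on $P$: (i) There exist $N\in\mathbb{N}$ and a constant $C_1>0$ such that for every $\mathbb{R}v\in P$ and every $n\ge N$ we have $$\frac1n\int\log\frac{\|gv\|}{\|v\|}\,d\mu^{*n}(g)\ge C_1>0.$$ (ii) There exist $N\in\mathbb{N}$ and a constant $C_2>0$ such that for every $\mathbb{R}v\in P$ we have $$\int\log\frac{\|gv\|}{\|v\|}\,d\mu^{*N}(g)\ge C_2>0.$$ (iii) For every $\mathbb{R}v\in P$, for $\mu^{\otimes\mathbb{N}}$-a.e. $b=(b_m)_{m\ge0}$, we have $$\lim_{n\to\infty}\tfrac1n\log\|b_{n-1}\cdots b_0v\|>0$$ (in particular the limit exists).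
   Context: $\|\cdot\|$ is a fixed norm on $\mathbb{R}^d$ and its operator norm; $\mathbb{R}v$ denotes the line spanned by a non-zero vector $v$; $\mu^{*n}$ is the $n$-th convolution power of $\mu$. Finite first moment: $\int\log\max(\|g\|,\|g^{-1}\|)\,d\mu(g)<\infty$. Uniform expansion of $\mu$ on $P$: for every $\mathbb{R}v\in P$, for $\mu^{\otimes\mathbb{N}}$-a.e. $b=(b_m)_{m\ge0}$, $\liminf_{n\to\infty}\frac1n\log\|b_{n-1}\cdots b_0v\|>0$. *)

theory Defs
  imports "HOL-Probability.Probability" "HOL-Algebra.Group"
begin

section \<open>Norms and operator norms\<close>

text \<open>The norm on \<open>\<real>\<^sup>d\<close> is arbitrary, so it is not the (Euclidean) type-class norm.\<close>

definition is_vector_norm :: "('a::real_vector \<Rightarrow> real) \<Rightarrow> bool" where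
  "is_vector_norm nrm \<longleftrightarrow>
     (\<forall>x. 0 \<le> nrm x) \<and>
     (\<forall>x. nrm x = 0 \<longleftrightarrow> x = 0) \<and>
     (\<forall>c x. nrm (c *\<^sub>R x) = \<bar>c\<bar> * nrm x) \<and>
     (\<forall>x y. nrm (x + y) \<le> nrm x + nrm y)"

text \<open>As in the library's \<open>onorm\<close>, the supremum includes \<open>x = 0\<close>, where the quotient is
  \<open>0 / 0 = 0\<close> and hence does not matter.\<close>

definition matrix_op_norm :: "(real^'d \<Rightarrow> real) \<Rightarrow> real^'d^'d \<Rightarrow> real" where
  "matrix_op_norm nrm A = (SUP x. nrm (A *v x) / nrm x)"

lemma matrix_op_norm_norm: "matrix_op_norm norm A = onorm ((*v) A)"
  by (simp add: matrix_op_norm_def onorm_def)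


section \<open>The general linear group\<close>

definition GL :: "(real^'d^'d) monoid" where
  "GL = \<lparr>carrier = {A. invertible A}, mult = (**), one = mat 1\<rparr>"

lemma GL_simps [simp]:
  "carrier GL = {A. invertible A}" "mult GL = (**)" "one GL = mat 1"
  by (simp_all add: GL_def)

lemma group_GL: "group (GL :: (real^'d^'d) monoid)"
proof (rule groupI)
  fix A :: "real^'d^'d" assume "A \<in> carrier GL"
  then show "\<exists>B\<in>carrier GL. B \<otimes>\<^bsub>GL\<^esub> A = \<one>\<^bsub>GL\<^esub>"
    by (auto simp: invertible_def)
next
  show "\<one>\<^bsub>GL\<^esub> \<in> carrier (GL :: (real^'d^'d) monoid)"
    by (auto simp: invertible_def intro: exI[of _ "mat 1"])
qed (auto simp: invertible_mult matrix_mul_assoc)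

definition GL_borel :: "(real^'d^'d) measure" where
  "GL_borel = restrict_space borel (carrier GL)"

definition measure_support :: "'a::topological_space measure \<Rightarrow> 'a set" where
  "measure_support M =
     {x \<in> space M. \<forall>U. open U \<and> x \<in> U \<longrightarrow> emeasure M (U \<inter> space M) > 0}"

text \<open>Closedness is relative to the topology of \<open>GL\<close>, not to the space of all matrices.\<close>

definition GL_closed_subgroup :: "(real^'d^'d) set \<Rightarrow> bool" where
  "GL_closed_subgroup H \<longleftrightarrow> subgroup H GL \<and> closedin (top_of_set (carrier GL)) H"

definition support_group :: "(real^'d^'d) measure \<Rightarrow> (real^'d^'d) set" where
  "support_group \<mu> = GL_closed_subgroup hull measure_support \<mu>"

lemma GL_closed_subgroup_support_group:
  fixes \<mu> :: "(real^'d^'d) measure"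
  assumes "space \<mu> = carrier GL"
  shows "GL_closed_subgroup (support_group \<mu>)"
proof -
  have *: "GL_closed_subgroup (carrier (GL :: (real^'d^'d) monoid))"
    using group.subgroup_self[OF group_GL] by (simp add: GL_closed_subgroup_def)
  let ?F = "{H. GL_closed_subgroup H \<and> measure_support \<mu> \<subseteq> H}"
  have ne: "?F \<noteq> {}"
    using * assms by (auto simp: measure_support_def)
  have "subgroup (\<Inter>?F) GL"
    by (rule group.subgroups_Inter[OF group_GL _ ne]) (simp add: GL_closed_subgroup_def)
  moreover have "closedin (top_of_set (carrier GL)) (\<Inter>?F)"
    by (rule closedin_Inter[OF ne]) (simp add: GL_closed_subgroup_def)
  ultimately show ?thesis
    by (simp add: GL_closed_subgroup_def support_group_def hull_def)
qed


section \<open>Projective space\<close>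

text \<open>Points are the lines \<open>span {v}\<close> with \<open>v \<noteq> 0\<close>; the topology is the quotient topology
  coming from the non-zero vectors (see \<open>quotient_map_projective\<close>).\<close>

definition projective_space :: "(real^'d) set set" where
  "projective_space = {span {v} | v. v \<noteq> 0}"

definition projective_topology :: "(real^'d) set topology" where
  "projective_topology = topology (\<lambda>U. U \<subseteq> projective_space \<and>
     openin (top_of_set (- {0})) {v \<in> - {0}. span {v} \<in> U})"

lemma openin_projective_topology:
  fixes U :: "(real^'d) set set"
  shows "openin projective_topology U \<longleftrightarrow> U \<subseteq> projective_space \<and>
     openin (top_of_set (- {0})) {v \<in> - {0}. span {v} \<in> U}"
proof -
  let ?L = "\<lambda>U :: (real^'d) set set. {v \<in> - {0}. span {v} \<in> U}"
  have "istopology (\<lambda>U. U \<subseteq> projective_space \<and> openin (top_of_set (- {0})) (?L U))"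
    unfolding istopology_def
  proof (intro conjI allI impI)
    fix S T :: "(real^'d) set set"
    assume a: "S \<subseteq> projective_space \<and> openin (top_of_set (- {0})) (?L S)"
      "T \<subseteq> projective_space \<and> openin (top_of_set (- {0})) (?L T)"
    then show "S \<inter> T \<subseteq> projective_space" by auto
    have "?L (S \<inter> T) = ?L S \<inter> ?L T" by auto
    then show "openin (top_of_set (- {0})) (?L (S \<inter> T))" using a by (simp add: openin_Int)
  next
    fix K :: "(real^'d) set set set"
    assume a: "\<forall>U\<in>K. U \<subseteq> projective_space \<and> openin (top_of_set (- {0})) (?L U)"
    then show "\<Union>K \<subseteq> projective_space" by auto
    have "?L (\<Union>K) = (\<Union>U\<in>K. ?L U)" by auto
    then show "openin (top_of_set (- {0})) (?L (\<Union>K))" using a by auto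
  qed
  then show ?thesis
    by (simp add: projective_topology_def topology_inverse')
qed

lemma topspace_projective_topology:
  "topspace projective_topology = (projective_space :: (real^'d) set set)"
proof (rule antisym)
  show "topspace projective_topology \<subseteq> (projective_space :: (real^'d) set set)"
    using openin_projective_topology openin_topspace by blast
  have "{v \<in> - {0 :: real^'d}. span {v} \<in> projective_space} = - {0}"
    by (auto simp: projective_space_def)
  then have "openin projective_topology (projective_space :: (real^'d) set set)"
    by (simp add: openin_projective_topology)
  then show "(projective_space :: (real^'d) set set) \<subseteq> topspace projective_topology"
    by (rule openin_subset)
qed

lemma quotient_map_projective:
  "quotient_map (top_of_set (- {0})) projective_topology (\<lambda>v :: real^'d. span {v})"
  unfolding quotient_map_def
proof (intro conjI allI impI)
  show "(\<lambda>v :: real^'d. span {v}) ` topspace (top_of_set (- {0})) = topspace projective_topology"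
    by (auto simp: topspace_projective_topology projective_space_def)
qed (auto simp: openin_projective_topology topspace_projective_topology)

definition projectively_invariant ::
    "(real^'d^'d) set \<Rightarrow> (real^'d) set set \<Rightarrow> bool" where
  "projectively_invariant H P \<longleftrightarrow> (\<forall>g\<in>H. \<forall>L\<in>P. (\<lambda>x. g *v x) ` L \<in> P)"


section \<open>Random matrix products\<close>

definition finite_first_moment ::
    "(real^'d \<Rightarrow> real) \<Rightarrow> (real^'d^'d) measure \<Rightarrow> bool" where
  "finite_first_moment nrm \<mu> \<longleftrightarrow>
     integrable \<mu> (\<lambda>g. ln (max (matrix_op_norm nrm g) (matrix_op_norm nrm (matrix_inv g))))"

primrec GL_conv_power :: "(real^'d^'d) measure \<Rightarrow> nat \<Rightarrow> (real^'d^'d) measure" where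
  "GL_conv_power \<mu> 0 = return GL_borel (mat 1)"
| "GL_conv_power \<mu> (Suc n) =
     distr (\<mu> \<Otimes>\<^sub>M GL_conv_power \<mu> n) GL_borel (\<lambda>(g, h). g ** h)"

text \<open>\<open>left_product b n\<close> is the product \<open>b\<^sub>n\<^sub>-\<^sub>1 \<cdots> b\<^sub>0\<close>.\<close>

primrec left_product :: "(nat \<Rightarrow> real^'d^'d) \<Rightarrow> nat \<Rightarrow> real^'d^'d" where
  "left_product b 0 = mat 1"
| "left_product b (Suc n) = b n ** left_product b n"

text \<open>The lower limit is taken in the extended reals.\<close>

definition uniformly_expanding ::
    "(real^'d \<Rightarrow> real) \<Rightarrow> (real^'d^'d) measure \<Rightarrow> (real^'d) set set \<Rightarrow> bool" where
  "uniformly_expanding nrm \<mu> P \<longleftrightarrow>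
     (\<forall>v. v \<noteq> 0 \<and> span {v} \<in> P \<longrightarrow>
        (AE b in (\<Pi>\<^sub>M m\<in>(UNIV :: nat set). \<mu>).
           liminf (\<lambda>n. ereal (1 / real n * ln (nrm (left_product b n *v v)))) > 0))"

end

theory Submission
  imports Defs
begin

text \<open>
  Write \<open>\<phi>\<^sub>n v\<close> for the expectation of \<open>ln (\<parallel>b\<^sub>n\<^sub>-\<^sub>1 \<cdots> b\<^sub>0 v\<parallel> / \<parallel>v\<parallel>)\<close>. Under uniform expansion, Fatou's lemma
  (the increments are dominated by i.i.d. integrable variables) gives for each line in \<open>P\<close> a time \<open>n\<close> with
  \<open>\<phi>\<^sub>n > 0\<close>; compactness of \<open>P\<close> makes these times bounded, and the cocycle identity
  \<open>\<phi>\<^sub>n\<^sub>+\<^sub>k v = \<phi>\<^sub>n v + E \<phi>\<^sub>k (b\<^sub>n\<^sub>-\<^sub>1 \<cdots> b\<^sub>0 v)\<close> then makes \<open>\<phi>\<^sub>n\<close> grow linearly, uniformly on \<open>P\<close>.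
  Conversely a uniform lower bound on \<open>\<phi>\<^sub>N\<close> becomes, after adding a bounded coboundary, a one-step drift bound,
  and truncation, exponential moments and the maximal ergodic inequality yield an almost sure linear lower bound.

  It remains to see that the limit in (iii) exists for every \<open>v \<noteq> 0\<close>. Modulo an invariant subspace \<open>W\<close>, let \<open>m\<close>
  be the optimal uniform drift bound. By compactness \<open>m\<close> is attained by a vector outside \<open>W\<close> whose growth rate is
  \<open>m\<close> along a subsequence of times. The vectors with this property form a larger invariant subspace \<open>W'\<close>, on which the
  operator norms modulo \<open>W\<close> grow at rate at most \<open>m\<close>. A vector with rate \<open>l\<close> modulo \<open>W'\<close> has rate \<open>max m l\<close>
  modulo \<open>W\<close> by variation of constants, and one concludes by induction on the codimension of \<open>W\<close>.
\<close>

section \<open>Linear growth rates\<close>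

text \<open>With only a first moment there are no large deviation estimates for the increments.
  Every unbounded quantity is therefore compared with sums of the i.i.d. variables
  \<open>L (b k)\<close>, whose linear growth follows from the maximal inequality. A drift bound
  controls the lower rate uniformly, but it says nothing about an upper rate, since different
  vectors may grow at different rates. The optimal \<open>m\<close> supplies both sides at one
  point: every vector outside \<open>W\<close> has lower rate at least \<open>m\<close>, and some
  vector has mean growth at most \<open>m\<close> at all times. Together they force convergence in
  mean, hence almost surely along a subsequence. A subsequence is enough: one of its times serves as
  block length in a subadditive estimate, which then covers all times. The operator norm bounds on
  \<open>W'\<close> are needed for products that start at an arbitrary time \<open>k\<close>,
  because variation of constants sums over all times at which the quotient orbit feeds into
  \<open>W'\<close>. The rate is \<open>max m l\<close> without any comparison of \<open>m\<close>
  and \<open>l\<close>: both are lower bounds, one by minimality and one because a larger subspace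
  gives shorter residuals.\<close>

definition growth_le :: "(nat \<Rightarrow> real) \<Rightarrow> real \<Rightarrow> bool" where
  "growth_le a c \<longleftrightarrow> (\<forall>e>0. \<exists>K. \<forall>n. a n \<le> (c + e) * real n + K)"

lemma growth_leD:
  assumes "growth_le a c" "c < d"
  shows "\<exists>K. \<forall>n. a n \<le> d * real n + K"
proof -
  have "d - c > 0" using assms by simp
  then obtain K where "\<forall>n. a n \<le> (c + (d - c)) * real n + K"
    using assms(1) unfolding growth_le_def by blast
  then show ?thesis by auto
qed

text \<open>Rates are tested only along \<open>1 / (j + 1)\<close>, so that countably many almost
  sure events can be intersected in \<open>AE_growth_leI\<close>.\<close>

lemma growth_le_countable:
  assumes "\<And>j::nat. \<exists>K. \<forall>n. a n \<le> (c + 1 / real (Suc j)) * real n + K"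
  shows "growth_le a c"
  unfolding growth_le_def
proof (intro allI impI)
  fix e :: real assume "e > 0"
  then obtain j where j: "1 / real (Suc j) < e"
    using nat_approx_posE by blast
  obtain K where K: "\<forall>n. a n \<le> (c + 1 / real (Suc j)) * real n + K" using assms by blast
  have "a n \<le> (c + e) * real n + K" for n
  proof -
    have "(c + 1 / real (Suc j)) * real n \<le> (c + e) * real n"
      using j by (intro mult_right_mono) auto
    then show ?thesis using K[rule_format, of n] by linarith
  qed
  then show "\<exists>K. \<forall>n. a n \<le> (c + e) * real n + K" by blast
qed

lemma AE_growth_leI:
  assumes "\<And>j::nat. AE b in M. \<exists>K. \<forall>n. a b n \<le> (c + 1 / real (Suc j)) * real n + K"
  shows "AE b in M. growth_le (a b) c"
proof -
  have "AE b in M. \<forall>j::nat. \<exists>K. \<forall>n. a b n \<le> (c + 1 / real (Suc j)) * real n + K"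
    using assms by (subst AE_all_countable) blast
  then show ?thesis by eventually_elim (rule growth_le_countable, blast)
qed

lemma growth_le_mono:
  assumes "growth_le a c" "\<And>n. b n \<le> a n + C"
  shows "growth_le b c"
  unfolding growth_le_def
proof (intro allI impI)
  fix e :: real assume "e > 0"
  then obtain K where K: "\<And>n. a n \<le> (c + e) * real n + K"
    using assms(1) unfolding growth_le_def by meson
  have "b n \<le> (c + e) * real n + (K + C)" for n
    using K[of n] assms(2)[of n] by simp
  then show "\<exists>K. \<forall>n. b n \<le> (c + e) * real n + K" by blast
qed

lemma growth_le_eventually:
  assumes "growth_le a c" "c < d"
  shows "\<forall>\<^sub>F n in sequentially. a n \<le> d * real n"
proof -
  obtain d' where d': "c < d'" "d' < d" using assms(2) dense by blast
  obtain K where K: "\<And>n. a n \<le> d' * real n + K" using growth_leD[OF assms(1) d'(1)] by blast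
  have "\<forall>\<^sub>F n in sequentially. K / (d - d') \<le> real n"
    using filterlim_real_sequentially by (simp add: filterlim_at_top)
  then show ?thesis
  proof eventually_elim
    case (elim n)
    then have "K \<le> (d - d') * real n" using d' by (simp add: field_simps)
    then show ?case using K[of n] by (simp add: algebra_simps)
  qed
qed

text \<open>The finitely many exceptional \<open>n\<close> are absorbed by the constant
  \<open>K\<close>. Together with \<open>growth_le_eventually\<close> this identifies
  \<open>growth_le a c\<close> with \<open>limsup (a n / n) <= c\<close>.\<close>

lemma growth_le_of_eventually:
  assumes "\<And>d. c < d \<Longrightarrow> \<forall>\<^sub>F n in sequentially. a n \<le> d * real n"
  shows "growth_le a c"
  unfolding growth_le_def
proof (intro allI impI)
  fix e :: real assume "e > 0"
  then have "\<forall>\<^sub>F n in sequentially. a n \<le> (c + e) * real n" by (intro assms) simp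
  then obtain N where N: "\<And>n. n \<ge> N \<Longrightarrow> a n \<le> (c + e) * real n"
    unfolding eventually_sequentially by blast
  define K where "K = (\<Sum>n<N. \<bar>a n - (c + e) * real n\<bar>)"
  have "a n \<le> (c + e) * real n + K" for n
  proof (cases "n < N")
    case True
    then have "\<bar>a n - (c + e) * real n\<bar> \<le> K"
      unfolding K_def by (intro member_le_sum) auto
    then show ?thesis by linarith
  next
    case False
    moreover have "K \<ge> 0" unfolding K_def by (intro sum_nonneg) auto
    ultimately show ?thesis using N[of n] by simp
  qed
  then show "\<exists>K. \<forall>n. a n \<le> (c + e) * real n + K" by blast
qed

lemma growth_le_imp_tendsto:
  assumes "growth_le a c" "growth_le (\<lambda>n. - a n) (- c)"
  shows "(\<lambda>n. 1 / real n * a n) \<longlonglongrightarrow> c"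
proof (rule order_tendstoI)
  fix y assume "y < c"
  then obtain y' where y': "y < y'" "y' < c" using dense by blast
  have "\<forall>\<^sub>F n in sequentially. - a n \<le> (- y') * real n"
    using y' by (intro growth_le_eventually[OF assms(2)]) simp
  then show "\<forall>\<^sub>F n in sequentially. y < 1 / real n * a n"
    using eventually_gt_at_top[of 0]
  proof eventually_elim
    case (elim n)
    then have "y' \<le> 1 / real n * a n" by (simp add: field_simps)
    then show ?case using y' by simp
  qed
next
  fix y assume "c < y"
  then obtain y' where y': "c < y'" "y' < y" using dense by blast
  have "\<forall>\<^sub>F n in sequentially. a n \<le> y' * real n"
    using y' by (intro growth_le_eventually[OF assms(1)]) simp
  then show "\<forall>\<^sub>F n in sequentially. 1 / real n * a n < y"
    using eventually_gt_at_top[of 0]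
  proof eventually_elim
    case (elim n)
    then have "1 / real n * a n \<le> y'" by (simp add: field_simps)
    then show ?case using y' by simp
  qed
qed

lemma eventually_subseq_pos: "strict_mono (r :: nat \<Rightarrow> nat) \<Longrightarrow> \<forall>\<^sub>F k in sequentially. r k > 0"
  using eventually_gt_at_top[of 0] filterlim_subseq by (rule eventually_compose_filterlim)

section \<open>Birkhoff sums over the Bernoulli shift\<close>

definition seq_shift :: "nat \<Rightarrow> (nat \<Rightarrow> 'a) \<Rightarrow> nat \<Rightarrow> 'a" where
  "seq_shift k b = (\<lambda>i. b (i + k))"

lemma seq_shift_apply: "seq_shift k b i = b (i + k)"
  by (simp add: seq_shift_def)

lemma seq_shift_0 [simp]: "seq_shift 0 b = b"
  by (simp add: seq_shift_def)

lemma seq_shift_seq_shift [simp]: "seq_shift j (seq_shift k b) = seq_shift (j + k) b"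
  by (simp add: seq_shift_def add.assoc)

lemma seq_shift_comb_seq [simp]: "seq_shift n (comb_seq n b b') = b'"
  by (rule ext) (simp add: comb_seq_add seq_shift_def)

definition birkhoff_sum :: "((nat \<Rightarrow> 'a) \<Rightarrow> real) \<Rightarrow> nat \<Rightarrow> (nat \<Rightarrow> 'a) \<Rightarrow> real" where
  "birkhoff_sum f n b = (\<Sum>j<n. f (seq_shift j b))"

lemma birkhoff_sum_0 [simp]: "birkhoff_sum f 0 b = 0"
  by (simp add: birkhoff_sum_def)

lemma birkhoff_sum_Suc: "birkhoff_sum f (Suc n) b = birkhoff_sum f n b + f (seq_shift n b)"
  by (simp add: birkhoff_sum_def)

lemma birkhoff_sum_Suc_shift:
  "birkhoff_sum f (Suc n) b = f b + birkhoff_sum f n (seq_shift 1 b)"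
  unfolding birkhoff_sum_def by (subst sum.lessThan_Suc_shift) simp

text \<open>The maximum of \<open>birkhoff_sum f k b\<close> over \<open>k <= n\<close>, encoded by
  the recursion that Garsia's argument uses.\<close>

primrec max_birkhoff_sum :: "((nat \<Rightarrow> 'a) \<Rightarrow> real) \<Rightarrow> nat \<Rightarrow> (nat \<Rightarrow> 'a) \<Rightarrow> real" where
  "max_birkhoff_sum f 0 b = 0"
| "max_birkhoff_sum f (Suc n) b = max 0 (f b + max_birkhoff_sum f n (seq_shift 1 b))"

lemma max_birkhoff_sum_mono: "max_birkhoff_sum f n b \<le> max_birkhoff_sum f (Suc n) b"
proof (induction n arbitrary: b)
  case (Suc n)
  show ?case using Suc[of "seq_shift 1 b"] by simp
qed simp

lemma birkhoff_sum_le_max: "birkhoff_sum f n b \<le> max_birkhoff_sum f n b"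
proof (induction n arbitrary: b)
  case (Suc n)
  show ?case using Suc[of "seq_shift 1 b"] by (simp add: birkhoff_sum_Suc_shift)
qed simp

lemma max_birkhoff_sum_nonneg: "0 \<le> max_birkhoff_sum f n b"
  by (cases n) auto

lemma prob_space_sequence_space: "prob_space M \<Longrightarrow> sequence_space M"
  by (simp add: sequence_space_def product_prob_space_def product_prob_space_axioms_def
      product_sigma_finite_def prob_space_imp_sigma_finite)

context sequence_space
begin

lemma measurable_seq_shift [measurable]: "seq_shift k \<in> measurable S S"
  unfolding seq_shift_def by (intro measurable_abs_UNIV) measurable

lemma distr_seq_shift: "distr S S (seq_shift k) = S"
proof -
  have "distr S S (seq_shift k) = distr (PiM UNIV (\<lambda>i::nat. M)) (PiM UNIV (\<lambda>i. (\<lambda>i. M) (i + k))) (\<lambda>b. \<lambda>n\<in>UNIV. b (n + k))"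
    by (simp add: seq_shift_def[abs_def] restrict_UNIV)
  also have "\<dots> = S"
    by (subst distr_PiM_reindex) (auto simp: inj_on_def M.prob_space_axioms)
  finally show ?thesis .
qed

lemma seq_shift_in_space [simp]: "b \<in> space S \<Longrightarrow> seq_shift k b \<in> space S"
  by (auto simp: space_PiM seq_shift_apply)

lemma integrable_seq_shift:
  fixes f :: "_ \<Rightarrow> real"
  assumes "integrable S f" shows "integrable S (\<lambda>b. f (seq_shift k b))"
  using assms by (subst (asm) distr_seq_shift[of k, symmetric], subst (asm) integrable_distr_eq) auto

lemma integral_seq_shift:
  fixes f :: "_ \<Rightarrow> real"
  assumes [measurable]: "f \<in> borel_measurable S"
  shows "(\<integral>b. f (seq_shift k b) \<partial>S) = (\<integral>b. f b \<partial>S)"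
  by (subst (2) distr_seq_shift[of k, symmetric], subst integral_distr) auto

text \<open>Zero-one law by independence: a cylinder over coordinates below \<open>n\<close> sees
  only the first block, an invariant set only the rest. Hence restricting \<open>S\<close> to
  \<open>E\<close> gives the multiple \<open>emeasure S E\<close> of \<open>S\<close>, and
  evaluating both measures on \<open>E\<close> itself gives \<open>p = p * p\<close>.\<close>

lemma shift_invariant_0_1:
  assumes E [measurable]: "E \<in> sets S"
    and inv: "\<And>b. b \<in> space S \<Longrightarrow> seq_shift 1 b \<in> E \<longleftrightarrow> b \<in> E"
  shows "emeasure S E = 0 \<or> emeasure S E = 1"
proof -
  have inv': "seq_shift n b \<in> E \<longleftrightarrow> b \<in> E" if "b \<in> space S" for n b
  proof (induction n)
    case (Suc n)
    then show ?case using inv[of "seq_shift n b"] that by simp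
  qed simp
  have "density S (indicator E) = density S (\<lambda>_. emeasure S E)"
  proof (rule measure_eqI_PiM_infinite[where I=UNIV and M="\<lambda>_. M"])
    fix A and J :: "nat set"
    assume J: "finite J" "J \<subseteq> UNIV" and A: "\<And>i. i \<in> J \<Longrightarrow> A i \<in> sets M"
    let ?C = "prod_emb UNIV (\<lambda>_. M) J (Pi\<^sub>E J A)"
    have C [measurable]: "?C \<in> sets S" using J A by (intro sets_PiM_I) auto
    obtain n where n: "J \<subseteq> {..<n}" using J(1) finite_nat_iff_bounded by blast
    have mem: "comb_seq n w w' \<in> ?C \<longleftrightarrow> w \<in> ?C" if "w \<in> space S" "w' \<in> space S" for w w'
    proof -
      have "comb_seq n w w' \<in> space S"
        using that by (auto simp: space_PiM comb_seq_def PiE_iff)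
      then show ?thesis
        using that n by (auto simp: prod_emb_def space_PiM PiE_iff restrict_def comb_seq_less subset_eq extensional_def)
    qed
    \<comment> \<open>After splitting the sequence at \<open>n\<close>, the intersection becomes the
      rectangle \<open>?C \<times> E\<close>.\<close>
    have "emeasure S (E \<inter> ?C) = emeasure (distr (S \<Otimes>\<^sub>M S) S (\<lambda>(w, w'). comb_seq n w w')) (E \<inter> ?C)"
      by (simp add: PiM_comb_seq)
    also have "\<dots> = emeasure (S \<Otimes>\<^sub>M S) ((\<lambda>(w, w'). comb_seq n w w') -` (E \<inter> ?C) \<inter> space (S \<Otimes>\<^sub>M S))"
      by (rule emeasure_distr) auto
    also have "(\<lambda>(w, w'). comb_seq n w w') -` (E \<inter> ?C) \<inter> space (S \<Otimes>\<^sub>M S) = ?C \<times> E"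
    proof -
      have "comb_seq n w w' \<in> E \<longleftrightarrow> w' \<in> E" if "w \<in> space S" "w' \<in> space S" for w w'
      proof -
        have "comb_seq n w w' \<in> space S"
          using that by (auto simp: space_PiM comb_seq_def PiE_iff)
        from inv'[OF this, of n] show ?thesis by simp
      qed
      then show ?thesis
        using mem subsetD[OF sets.sets_into_space[OF E]] subsetD[OF sets.sets_into_space[OF C]]
        by (fastforce simp: space_pair_measure)
    qed
    also have "emeasure (S \<Otimes>\<^sub>M S) (?C \<times> E) = emeasure S ?C * emeasure S E"
      by (rule P.emeasure_pair_measure_Times) auto
    finally have "emeasure S (E \<inter> ?C) = emeasure S ?C * emeasure S E" .
    moreover have "emeasure (density S (indicator E)) ?C = emeasure S (E \<inter> ?C)"
      by (subst emeasure_density) (auto simp: indicator_inter_arith[symmetric])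
    moreover have "emeasure (density S (\<lambda>_. emeasure S E)) ?C = emeasure S ?C * emeasure S E"
      by (subst emeasure_density) (auto simp: nn_integral_cmult mult.commute)
    ultimately show "emeasure (density S (indicator E)) ?C = emeasure (density S (\<lambda>_. emeasure S E)) ?C"
      by simp
  next
    show "finite_measure (density S (indicator E))"
      by (rule finite_measureI) (simp add: emeasure_density)
  qed auto
  then have "emeasure (density S (indicator E)) E = emeasure (density S (\<lambda>_. emeasure S E)) E"
    by simp
  then have *: "emeasure S E = emeasure S E * emeasure S E"
    by (simp add: emeasure_density nn_integral_cmult flip: indicator_inter_arith)
  obtain p where p: "emeasure S E = ennreal p" "p \<ge> 0"
    using P.emeasure_eq_measure by (metis measure_nonneg)
  from * p have "p = p * p" by (simp flip: ennreal_mult)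
  then have "p = 0 \<or> p = 1" by simp
  then show ?thesis using p by auto
qed

lemma measurable_birkhoff_sum [measurable]:
  "f \<in> borel_measurable S \<Longrightarrow> birkhoff_sum f n \<in> borel_measurable S"
  unfolding birkhoff_sum_def
  by (intro borel_measurable_sum measurable_compose[OF measurable_seq_shift])

lemma integrable_max_birkhoff_sum:
  "integrable S f \<Longrightarrow> integrable S (max_birkhoff_sum f n)"
proof (induction n)
  case (Suc n)
  have "integrable S (\<lambda>b. max 0 (f b + max_birkhoff_sum f n (seq_shift 1 b)))"
    by (rule integrable_max[OF _ Bochner_Integration.integrable_add[OF Suc.prems
          integrable_seq_shift[OF Suc.IH[OF Suc.prems]]]]) simp
  then show ?case by (simp cong: integrable_cong)
next
  case 0
  have "max_birkhoff_sum f 0 = (\<lambda>_. 0)" by (rule ext) simp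
  then show ?case by simp
qed

text \<open>Garsia's argument: where the maximum \<open>M\<^sub>n\<^sub>+\<^sub>1\<close> is positive it equals \<open>f + M\<^sub>n \<circ> T\<close>, and \<open>M\<^sub>n \<le> M\<^sub>n\<^sub>+\<^sub>1\<close>.\<close>

lemma maximal_ergodic:
  assumes f: "integrable S f"
  shows "0 \<le> (\<integral>b. indicator {b \<in> space S. max_birkhoff_sum f (Suc n) b > 0} b * f b \<partial>S)"
proof -
  let ?E = "{b \<in> space S. max_birkhoff_sum f (Suc n) b > 0}"
  note i [measurable] = integrable_max_birkhoff_sum[OF f]
  have [measurable]: "\<And>n. max_birkhoff_sum f n \<in> borel_measurable S"
    using i by auto
  have i1: "integrable S (\<lambda>b. max_birkhoff_sum f n (seq_shift 1 b))"
    by (rule integrable_seq_shift[OF i])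
  have "(\<integral>b. max_birkhoff_sum f n (seq_shift 1 b) \<partial>S) = (\<integral>b. max_birkhoff_sum f n b \<partial>S)"
    by (intro integral_seq_shift) auto
  also have "\<dots> \<le> (\<integral>b. max_birkhoff_sum f (Suc n) b \<partial>S)"
    by (intro integral_mono i max_birkhoff_sum_mono)
  finally have "0 \<le> (\<integral>b. max_birkhoff_sum f (Suc n) b - max_birkhoff_sum f n (seq_shift 1 b) \<partial>S)"
    unfolding Bochner_Integration.integral_diff[OF i i1] by linarith
  also have "\<dots> \<le> (\<integral>b. indicator ?E b * f b \<partial>S)"
  proof (rule integral_mono_AE)
    show "integrable S (\<lambda>b. max_birkhoff_sum f (Suc n) b - max_birkhoff_sum f n (seq_shift 1 b))"
      by (intro Bochner_Integration.integrable_diff i i1)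
    show "integrable S (\<lambda>b. indicator ?E b * f b)"
      using integrable_mult_indicator[OF _ f, of ?E] by (simp del: max_birkhoff_sum.simps)
    show "AE b in S. max_birkhoff_sum f (Suc n) b - max_birkhoff_sum f n (seq_shift 1 b) \<le> indicator ?E b * f b"
    proof (rule AE_I2)
      fix b assume "b \<in> space S"
      then show "max_birkhoff_sum f (Suc n) b - max_birkhoff_sum f n (seq_shift 1 b) \<le> indicator ?E b * f b"
        using max_birkhoff_sum_nonneg[of f n "seq_shift 1 b"]
        by (auto simp: indicator_def max_def)
    qed
  qed
  finally show ?thesis .
qed

text \<open>The event of unbounded sums is shift invariant, hence has probability 0 or 1. If it were
  1, the sets where the maximum is positive would exhaust the space, and the maximal inequality
  would give a nonnegative integral in the limit.\<close>

lemma AE_birkhoff_sum_bounded: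
  assumes f: "integrable S f" and neg: "(\<integral>b. f b \<partial>S) < 0"
  shows "AE b in S. \<exists>K. \<forall>n. birkhoff_sum f n b \<le> K"
proof -
  have [measurable]: "f \<in> borel_measurable S" using f by auto
  define E where "E = {b \<in> space S. \<forall>k::nat. \<exists>n. birkhoff_sum f n b > real k}"
  have E [measurable]: "E \<in> sets S" unfolding E_def by measurable
  have E_eq: "b \<in> E \<longleftrightarrow> b \<in> space S \<and> (\<forall>K. \<exists>n. birkhoff_sum f n b > K)" for b
    unfolding E_def by (auto; meson reals_Archimedean2 less_trans)
  have "seq_shift 1 b \<in> E \<longleftrightarrow> b \<in> E" if b: "b \<in> space S" for b
  proof -
    have "(\<forall>K. \<exists>n. birkhoff_sum f n (seq_shift 1 b) > K) \<longleftrightarrow> (\<forall>K. \<exists>n. birkhoff_sum f n b > K)"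
    proof (intro iffI allI)
      fix K assume "\<forall>K. \<exists>n. birkhoff_sum f n (seq_shift 1 b) > K"
      then obtain n where "birkhoff_sum f n (seq_shift 1 b) > K - f b" by blast
      then show "\<exists>n. birkhoff_sum f n b > K"
        by (intro exI[of _ "Suc n"]) (simp add: birkhoff_sum_Suc_shift)
    next
      fix K assume "\<forall>K. \<exists>n. birkhoff_sum f n b > K"
      \<comment> \<open>The lower bound 0 excludes \<open>n = 0\<close>, so that a first summand can
        be split off.\<close>
      then obtain n where n: "birkhoff_sum f n b > max 0 (f b + K)" by blast
      then obtain m where "n = Suc m" by (cases n) auto
      then show "\<exists>n. birkhoff_sum f n (seq_shift 1 b) > K"
        using n by (intro exI[of _ m]) (auto simp: birkhoff_sum_Suc_shift)
    qed
    then show ?thesis using b by (simp add: E_eq)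
  qed
  then have "emeasure S E = 0 \<or> emeasure S E = 1"
    by (intro shift_invariant_0_1) auto
  moreover have "emeasure S E \<noteq> 1"
  proof
    assume "emeasure S E = 1"
    then have "AE b in S. b \<in> E"
      using P.AE_in_set_eq_1[of E] by (simp add: P.emeasure_eq_measure)
    then have pos: "AE b in S. \<exists>n. birkhoff_sum f n b > 0"
      by (rule AE_mp) (auto simp: E_eq)
    let ?F = "\<lambda>n. {b \<in> space S. max_birkhoff_sum f (Suc n) b > 0}"
    have [measurable]: "\<And>n. max_birkhoff_sum f n \<in> borel_measurable S"
      using integrable_max_birkhoff_sum[OF f] by auto
    have "(\<lambda>n. \<integral>b. indicator (?F n) b * f b \<partial>S) \<longlonglongrightarrow> (\<integral>b. f b \<partial>S)"
    proof (rule integral_dominated_convergence[where w="\<lambda>b. \<bar>f b\<bar>"])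
      show "AE b in S. (\<lambda>n. indicator (?F n) b * f b) \<longlonglongrightarrow> f b"
        using pos AE_space
      proof eventually_elim
        case (elim b)
        then obtain n where n: "birkhoff_sum f n b > 0" by blast
        have mono: "mono (\<lambda>n. max_birkhoff_sum f n b)"
          by (rule monoI, rule lift_Suc_mono_le[where f="\<lambda>n. max_birkhoff_sum f n b"])
            (rule max_birkhoff_sum_mono)
        have "indicator (?F k) b * f b = f b" if "k \<ge> n" for k
        proof -
          have "0 < max_birkhoff_sum f n b" using n birkhoff_sum_le_max[of f n b] by linarith
          also have "\<dots> \<le> max_birkhoff_sum f (Suc k) b" using monoD[OF mono, of n "Suc k"] that by linarith
          finally show ?thesis using elim by simp
        qed
        then show ?case
          by (intro tendsto_eventually) (auto simp: eventually_sequentially)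
      qed
    qed (use f in \<open>auto simp: indicator_def\<close>)
    then have "0 \<le> (\<integral>b. f b \<partial>S)"
      by (rule LIMSEQ_le_const) (use maximal_ergodic[OF f] in blast)
    then show False using neg by simp
  qed
  ultimately have "emeasure S E = 0" by simp
  then have "AE b in S. b \<notin> E" by (subst AE_iff_measurable[OF E]) (auto simp: E_eq)
  then show ?thesis
    using AE_space by eventually_elim (auto simp: E_eq not_less)
qed

text \<open>Subtracting slightly more than the mean makes the integral negative, so the centred sums
  are bounded. The version for \<open>- f\<close> is the other half of Birkhoff's theorem.\<close>

lemma AE_growth_birkhoff_sum:
  assumes f: "integrable S f"
  shows "AE b in S. growth_le (\<lambda>n. birkhoff_sum f n b) (\<integral>b. f b \<partial>S)"
proof (rule AE_growth_leI)
  fix j :: nat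
  let ?c = "\<integral>b. f b \<partial>S"
  let ?g = "\<lambda>b. f b - (?c + 1 / real (Suc j))"
  have "AE b in S. \<exists>K. \<forall>n. birkhoff_sum ?g n b \<le> K"
    using f by (intro AE_birkhoff_sum_bounded) (auto simp: P.prob_space)
  moreover have "birkhoff_sum ?g n b = birkhoff_sum f n b - (?c + 1 / real (Suc j)) * real n" for n b
    by (simp add: birkhoff_sum_def sum_subtractf algebra_simps)
  ultimately show "AE b in S. \<exists>K. \<forall>n. birkhoff_sum f n b \<le> (?c + 1 / real (Suc j)) * real n + K"
    by (simp only: diff_le_eq add.commute)
qed

lemma AE_growth_birkhoff_sum_minus:
  assumes f: "integrable S f"
  shows "AE b in S. growth_le (\<lambda>n. - birkhoff_sum f n b) (- (\<integral>b. f b \<partial>S))"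
proof -
  have "AE b in S. growth_le (\<lambda>n. birkhoff_sum (\<lambda>b. - f b) n b) (\<integral>b. - f b \<partial>S)"
    using f by (intro AE_growth_birkhoff_sum) simp
  then show ?thesis by (simp add: birkhoff_sum_def sum_negf)
qed

end

section \<open>Dominated families on the sequence space\<close>

context sequence_space
begin

lemma
  fixes F :: "'a \<Rightarrow> real"
  shows integral_coordinate: "F \<in> borel_measurable M \<Longrightarrow> (\<integral>b. F (b k) \<partial>S) = (\<integral>g. F g \<partial>M)"
    and integrable_coordinate: "integrable M F \<Longrightarrow> integrable S (\<lambda>b. F (b k))"
proof -
  have d: "distr S M (\<lambda>b. b k) = M" by (rule PiM_component) simp
  show "(\<integral>b. F (b k) \<partial>S) = (\<integral>g. F g \<partial>M)" if "F \<in> borel_measurable M"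
    using that by (subst (2) d[symmetric], subst integral_distr) auto
  show "integrable S (\<lambda>b. F (b k))" if "integrable M F"
    using that by (subst (asm) d[symmetric], subst (asm) integrable_distr_eq) auto
qed

text \<open>The strong law of large numbers, as Birkhoff's theorem for a function of coordinate
  0.\<close>

lemma AE_growth_sum:
  fixes L :: "'a \<Rightarrow> real"
  assumes L: "integrable M L"
  shows "AE b in S. growth_le (\<lambda>n. \<Sum>k<n. L (b k)) (\<integral>g. L g \<partial>M)"
    and "AE b in S. growth_le (\<lambda>n. - (\<Sum>k<n. L (b k))) (- (\<integral>g. L g \<partial>M))"
proof -
  have eq: "birkhoff_sum (\<lambda>b. L (b 0)) n b = (\<Sum>k<n. L (b k))" for n b
    by (simp add: birkhoff_sum_def seq_shift_apply)
  note i = integrable_coordinate[OF L, of 0] integral_coordinate[OF borel_measurable_integrable[OF L], of 0]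
  show "AE b in S. growth_le (\<lambda>n. \<Sum>k<n. L (b k)) (\<integral>g. L g \<partial>M)"
    using AE_growth_birkhoff_sum[OF i(1)] unfolding eq i(2) .
  show "AE b in S. growth_le (\<lambda>n. - (\<Sum>k<n. L (b k))) (- (\<integral>g. L g \<partial>M))"
    using AE_growth_birkhoff_sum_minus[OF i(1)] unfolding eq i(2) .
qed

lemma integrable_sum_coordinates:
  fixes L :: "'a \<Rightarrow> real"
  assumes L: "integrable M L"
  shows "integrable S (\<lambda>b. \<Sum>k<n. L (b k))"
    "(\<integral>b. (\<Sum>k<n. L (b k)) \<partial>S) = real n * (\<integral>g. L g \<partial>M)"
  using integrable_coordinate[OF L] integral_coordinate[OF borel_measurable_integrable[OF L]]
  by (auto simp: Bochner_Integration.integral_sum)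

lemma integrable_dominated:
  fixes L :: "'a \<Rightarrow> real" and f :: "(nat \<Rightarrow> 'a) \<Rightarrow> real"
  assumes "integrable M L" "f \<in> borel_measurable S"
    and bound: "\<And>b. b \<in> space S \<Longrightarrow> \<bar>f b\<bar> \<le> (\<Sum>k<n. L (b k))"
  shows "integrable S f"
  by (rule Bochner_Integration.integrable_bound[OF integrable_sum_coordinates(1)[OF assms(1), of n] assms(2)])
    (use bound in \<open>auto intro!: AE_I2 order_trans[OF _ abs_ge_self]\<close>)

text \<open>Fatou's lemma for a family that is dominated by the sums of an i.i.d. integrable sequence,
  which are uniformly integrable after division by \<open>n\<close>.\<close>

lemma eventually_integral_le:
  fixes L :: "'a \<Rightarrow> real" and f :: "nat \<Rightarrow> (nat \<Rightarrow> 'a) \<Rightarrow> real"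
  assumes L: "integrable M L"
    and f [measurable]: "\<And>n. f n \<in> borel_measurable S"
    and bound: "\<And>n b. b \<in> space S \<Longrightarrow> \<bar>f n b\<bar> \<le> (\<Sum>k<n. L (b k))"
    and r: "strict_mono (r :: nat \<Rightarrow> nat)"
    and lim: "AE b in S. \<forall>d>c. \<forall>\<^sub>F k in sequentially. f (r k) b \<le> d * real (r k)"
    and "c < d"
  shows "\<forall>\<^sub>F k in sequentially. (\<integral>b. f (r k) b \<partial>S) \<le> d * real (r k)"
proof -
  define l where "l = (\<integral>g. L g \<partial>M)"
  define A where "A n b = (\<Sum>k<n. L (b k))" for n and b :: "nat \<Rightarrow> 'a"
  have iA: "integrable S (A n)" "(\<integral>b. A n b \<partial>S) = real n * l" for n
    unfolding A_def l_def using integrable_sum_coordinates[OF L, of n] by auto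
  have [measurable]: "A n \<in> borel_measurable S" for n using iA by auto
  have if': "integrable S (f n)" for n
    by (rule integrable_dominated[OF L f bound])
  \<comment> \<open>Up to the positive part, \<open>g\<close> is \<open>f / r - c\<close> plus the
    mean-zero term \<open>l - A / r\<close>. As \<open>f <= A\<close>, it lies between 0 and
    \<open>max 0 (l - c)\<close>, so dominated convergence applies although \<open>f / r\<close>
    itself is unbounded.\<close>
  define g where "g k b = max 0 (l - c - (A (r k) b - f (r k) b) / real (r k))" for k b
  have [measurable]: "g k \<in> borel_measurable S" for k unfolding g_def by measurable
  have r_inf: "filterlim r at_top sequentially" by (rule filterlim_subseq[OF r])
  have "(\<lambda>k. \<integral>b. g k b \<partial>S) \<longlonglongrightarrow> (\<integral>b. 0 \<partial>S)"
  proof (rule integral_dominated_convergence[where w="\<lambda>_. max 0 (l - c)"])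
    show "AE b in S. (\<lambda>k. g k b) \<longlonglongrightarrow> 0"
      using lim AE_growth_sum(2)[OF L]
    proof eventually_elim
      case (elim b)
      show ?case
      proof (rule tendstoI)
        fix e :: real assume "e > 0"
        then have e: "e / 3 > 0" by simp
        have "\<forall>\<^sub>F n in sequentially. - A n b \<le> (- l + e / 3) * real n"
          using elim(2) e unfolding A_def l_def by (intro growth_le_eventually) auto
        then have "\<forall>\<^sub>F k in sequentially. - A (r k) b \<le> (- l + e / 3) * real (r k)"
          using r_inf by (rule eventually_compose_filterlim)
        moreover have "\<forall>\<^sub>F k in sequentially. f (r k) b \<le> (c + e / 3) * real (r k)"
          using elim(1) e by auto
        moreover note eventually_subseq_pos[OF r]
        ultimately show "\<forall>\<^sub>F k in sequentially. dist (g k b) 0 < e"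
        proof eventually_elim
          case (elim k)
          have "(l - c - 2 * e / 3) * real (r k) \<le> A (r k) b - f (r k) b"
            using elim by (simp add: algebra_simps)
          then have "l - c - 2 * e / 3 \<le> (A (r k) b - f (r k) b) / real (r k)"
            using elim(3) by (simp add: field_simps)
          then have "g k b \<le> 2 * e / 3"
            using \<open>e > 0\<close> unfolding g_def by (intro max.boundedI) linarith+
          moreover have "0 \<le> g k b" by (simp add: g_def)
          ultimately show ?case using \<open>e > 0\<close> by (simp add: dist_real_def)
        qed
      qed
    qed
    show "AE b in S. norm (g k b) \<le> max 0 (l - c)" for k
    proof (rule AE_I2)
      fix b assume "b \<in> space S"
      then have "0 \<le> (A (r k) b - f (r k) b) / real (r k)"
        using bound[of b "r k"] by (auto simp: A_def abs_le_iff)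
      then show "norm (g k b) \<le> max 0 (l - c)" unfolding g_def by auto
    qed
  qed auto
  then have "\<forall>\<^sub>F k in sequentially. (\<integral>b. g k b \<partial>S) < d - c"
    using \<open>c < d\<close> by (intro order_tendstoD) auto
  moreover note eventually_subseq_pos[OF r]
  ultimately show ?thesis
  proof eventually_elim
    case (elim k)
    have i: "integrable S (\<lambda>b. l - c - (A (r k) b - f (r k) b) / real (r k))"
      using iA if' by simp
    have "l - c - (real (r k) * l - (\<integral>b. f (r k) b \<partial>S)) / real (r k)
        = (\<integral>b. l - c - (A (r k) b - f (r k) b) / real (r k) \<partial>S)"
      using iA if' by (simp add: P.prob_space)
    also have "\<dots> \<le> (\<integral>b. g k b \<partial>S)"
      unfolding g_def using i by (intro integral_mono) auto
    also have "\<dots> < d - c" by (rule elim)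
    finally have "(\<integral>b. f (r k) b \<partial>S) / real (r k) < d" using elim(2) by (simp add: field_simps)
    then show ?case using elim(2) by (simp add: field_simps)
  qed
qed

text \<open>Fatou's lemma makes the negative part of \<open>f n - m * n\<close> of order
  \<open>o(n)\<close> in mean, while the mean of \<open>w = f n / n - m\<close> is at most 0. Since
  \<open>|w| = w + 2 * w^-\<close>, the quotients converge to \<open>m\<close> in L1, and L1
  convergence gives an almost surely convergent subsequence.\<close>

lemma ex_subseq_AE_tendsto:
  fixes L :: "'a \<Rightarrow> real" and f :: "nat \<Rightarrow> (nat \<Rightarrow> 'a) \<Rightarrow> real"
  assumes L: "integrable M L"
    and f [measurable]: "\<And>n. f n \<in> borel_measurable S"
    and bound: "\<And>n b. b \<in> space S \<Longrightarrow> \<bar>f n b\<bar> \<le> (\<Sum>k<n. L (b k))"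
    and lower: "AE b in S. growth_le (\<lambda>n. - f n b) (- m)"
    and mean: "\<And>n. n \<ge> 1 \<Longrightarrow> (\<integral>b. f n b \<partial>S) \<le> m * real n"
  shows "\<exists>r::nat\<Rightarrow>nat. strict_mono r \<and> (AE b in S. (\<lambda>k. f (r k) b / real (r k)) \<longlonglongrightarrow> m)"
proof -
  have if': "integrable S (f n)" for n
    by (rule integrable_dominated[OF L f bound])
  define h where "h n b = max 0 (m * real n - f n b)" for n b
  have ih: "integrable S (h n)" for n unfolding h_def using if' by auto
  have h_le: "\<forall>\<^sub>F n in sequentially. (\<integral>b. h n b \<partial>S) \<le> d * real n" if "d > 0" for d
  \<comment> \<open>The summand \<open>|m|\<close> in the dominator pays for \<open>m * n\<close> in
    \<open>h\<close>.\<close>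
  proof (rule eventually_integral_le[where L="\<lambda>g. L g + \<bar>m\<bar>" and r="\<lambda>n. n" and c=0])
    show "\<bar>h n b\<bar> \<le> (\<Sum>k<n. L (b k) + \<bar>m\<bar>)" if "b \<in> space S" for n b
    proof -
      have "m * real n \<le> real n * \<bar>m\<bar>"
        using abs_ge_self[of "m * real n"] by (simp add: abs_mult mult.commute)
      then show ?thesis using bound[OF that, of n] unfolding h_def by (simp add: sum.distrib)
    qed
    show "AE b in S. \<forall>d>0. \<forall>\<^sub>F k in sequentially. h k b \<le> d * real k"
      using lower
    proof eventually_elim
      case (elim b)
      show ?case
      proof (intro allI impI)
        fix d :: real assume "d > 0"
        then have "\<forall>\<^sub>F n in sequentially. - f n b \<le> (- m + d) * real n"
          by (intro growth_le_eventually[OF elim]) simp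
        then show "\<forall>\<^sub>F k in sequentially. h k b \<le> d * real k"
          by eventually_elim (use \<open>d > 0\<close> in \<open>auto simp: h_def algebra_simps\<close>)
      qed
    qed
  qed (use L ih that in \<open>auto simp: strict_mono_def\<close>)
  define w where "w n b = f n b / real n - m" for n b
  have iw: "integrable S (w n)" for n unfolding w_def using if' by auto
  have "(\<lambda>n. \<integral>b. norm (w n b) \<partial>S) \<longlonglongrightarrow> 0"
  proof (rule tendstoI)
    fix e :: real assume "e > 0"
    then have "e / 3 > 0" by simp
    from h_le[OF this] eventually_gt_at_top[of 0]
    show "\<forall>\<^sub>F n in sequentially. dist (\<integral>b. norm (w n b) \<partial>S) 0 < e"
    proof eventually_elim
      case (elim n)
      have "\<bar>w n b\<bar> = w n b + 2 * (h n b / real n)" for b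
        unfolding w_def h_def using elim(2) by (auto simp: field_simps max_def abs_if)
      then have "(\<integral>b. norm (w n b) \<partial>S) = (\<integral>b. w n b + 2 * (h n b / real n) \<partial>S)"
        by simp
      also have "\<dots> = (\<integral>b. w n b \<partial>S) + 2 * ((\<integral>b. h n b \<partial>S) / real n)"
        using iw ih by simp
      also have "(\<integral>b. w n b \<partial>S) = (\<integral>b. f n b \<partial>S) / real n - m"
        unfolding w_def using if' by (simp add: P.prob_space)
      also have "\<dots> \<le> 0" using mean[of n] elim(2) by (simp add: field_simps)
      also have "(\<integral>b. h n b \<partial>S) / real n \<le> e / 3" using elim by (simp add: field_simps)
      finally have "(\<integral>b. norm (w n b) \<partial>S) \<le> 2 * (e / 3)" by simp
      then show ?case using \<open>e > 0\<close> by (simp add: dist_real_def)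
    qed
  qed
  from tendsto_L1_AE_subseq[OF iw this] obtain r :: "nat \<Rightarrow> nat"
    where r: "strict_mono r" "AE b in S. (\<lambda>n. w (r n) b) \<longlonglongrightarrow> 0" by blast
  from r(2) have "AE b in S. (\<lambda>k. f (r k) b / real (r k)) \<longlonglongrightarrow> m"
    by eventually_elim (simp add: w_def LIM_zero_iff)
  with r(1) show ?thesis by blast
qed

lemma integral_comb_seq:
  fixes F :: "(nat \<Rightarrow> 'a) \<Rightarrow> real"
  assumes "integrable S F"
  shows "(\<integral>b. F b \<partial>S) = (\<integral>w. (\<integral>w'. F (comb_seq n w w') \<partial>S) \<partial>S)"
    and "integrable (S \<Otimes>\<^sub>M S) (\<lambda>(w, w'). F (comb_seq n w w'))"
proof -
  interpret SS: pair_prob_space S S ..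
  have [measurable]: "F \<in> borel_measurable S" using assms by auto
  have "integrable (distr (S \<Otimes>\<^sub>M S) S (\<lambda>(w, w'). comb_seq n w w')) F"
    using assms by (simp add: PiM_comb_seq)
  then show i: "integrable (S \<Otimes>\<^sub>M S) (\<lambda>(w, w'). F (comb_seq n w w'))"
    by (subst (asm) integrable_distr_eq) (auto simp: case_prod_unfold)
  have "(\<integral>b. F b \<partial>S) = (\<integral>b. F b \<partial>distr (S \<Otimes>\<^sub>M S) S (\<lambda>(w, w'). comb_seq n w w'))"
    by (simp add: PiM_comb_seq)
  also have "\<dots> = (\<integral>z. F (comb_seq n (fst z) (snd z)) \<partial>(S \<Otimes>\<^sub>M S))"
    by (subst integral_distr) (auto simp: case_prod_unfold)
  also have "\<dots> = (\<integral>w. (\<integral>w'. F (comb_seq n w w') \<partial>S) \<partial>S)"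
    using SS.integral_fst'[OF i] by (simp add: case_prod_unfold)
  finally show "(\<integral>b. F b \<partial>S) = (\<integral>w. (\<integral>w'. F (comb_seq n w w') \<partial>S) \<partial>S)" .
qed

end

section \<open>Random orbits with a dominated potential\<close>

primrec orbit :: "('a \<Rightarrow> 'x \<Rightarrow> 'x) \<Rightarrow> (nat \<Rightarrow> 'a) \<Rightarrow> 'x \<Rightarrow> nat \<Rightarrow> 'x" where
  "orbit act b x 0 = x"
| "orbit act b x (Suc n) = act (b n) (orbit act b x n)"

lemma orbit_cong: "(\<And>k. k < n \<Longrightarrow> b k = b' k) \<Longrightarrow> orbit act b x n = orbit act b' x n"
  by (induction n) auto

lemma orbit_add: "orbit act b x (n + k) = orbit act (seq_shift n b) (orbit act b x n) k"
  by (induction k) (auto simp: seq_shift_apply add.commute)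

lemma orbit_comb_seq: "orbit act (comb_seq n w w') x (n + k) = orbit act w' (orbit act w x n) k"
proof -
  have "orbit act (comb_seq n w w') x n = orbit act w x n"
    by (rule orbit_cong) (simp add: comb_seq_less)
  then show ?thesis by (simp add: orbit_add)
qed

lemma orbit_case_nat: "orbit act (case_nat g w) x (Suc k) = orbit act w (act g x) k"
  by (induction k) auto

text \<open>For \<open>x = - y < 0\<close> the factorisation
  \<open>(1 - y + y^2) * (1 + y) = 1 + y^3\<close> reduces the claim to
  \<open>1 + y <= exp y\<close>.\<close>

lemma exp_le_quadratic:
  fixes x :: real
  assumes "\<bar>x\<bar> \<le> 1"
  shows "exp x \<le> 1 + x + x\<^sup>2"
proof (cases "x \<ge> 0")
  case True then show ?thesis using assms exp_bound[of x] by simp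
next
  case False
  define y where "y = - x"
  have y: "0 < y" "y \<le> 1" using False assms by (auto simp: y_def)
  have "1 \<le> (1 - y + y\<^sup>2) * (1 + y)"
    using y by (simp add: algebra_simps power2_eq_square)
  also have "\<dots> \<le> (1 - y + y\<^sup>2) * exp y"
    using y by (intro mult_left_mono exp_ge_add_one_self) simp
  finally have "exp (- y) \<le> 1 - y + y\<^sup>2"
    by (simp add: exp_minus field_simps)
  then show ?thesis by (simp add: y_def)
qed

text \<open>The potential \<open>u\<close> stands for the logarithm of a norm: of the quotient norm
  outside \<open>W\<close>, and of \<open>nrm\<close> on the cone over \<open>P\<close>. The bound
  \<open>L g\<close> does not depend on \<open>x\<close>, so the increments along all orbits are
  dominated by the same i.i.d. sums. Two auxiliary instances replace \<open>u\<close> by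
  \<open>- u\<close> and by \<open>u\<close> plus a bounded function.\<close>

locale dominated_potential = sequence_space M for M :: "'a measure" +
  fixes X :: "'x measure" and act :: "'a \<Rightarrow> 'x \<Rightarrow> 'x" and u :: "'x \<Rightarrow> real" and L :: "'a \<Rightarrow> real"
  assumes measurable_act [measurable]: "(\<lambda>(g, x). act g x) \<in> measurable (M \<Otimes>\<^sub>M X) X"
    and measurable_potential [measurable]: "u \<in> borel_measurable X"
    and integrable_dominator: "integrable M L"
    and dominated: "g \<in> space M \<Longrightarrow> x \<in> space X \<Longrightarrow> \<bar>u (act g x) - u x\<bar> \<le> L g"
begin

definition drift :: "nat \<Rightarrow> 'x \<Rightarrow> real" where
  "drift n x = (\<integral>b. u (orbit act b x n) - u x \<partial>S)"

lemma act_in_space: "g \<in> space M \<Longrightarrow> x \<in> space X \<Longrightarrow> act g x \<in> space X"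
  using measurable_space[OF measurable_act, of "(g, x)"] by (simp add: space_pair_measure)

lemma seq_in_space: "b \<in> space S \<Longrightarrow> b k \<in> space M"
  by (auto simp: space_PiM)

lemma orbit_in_space: "b \<in> space S \<Longrightarrow> x \<in> space X \<Longrightarrow> orbit act b x n \<in> space X"
  by (induction n) (auto intro: act_in_space seq_in_space)

lemma measurable_orbit [measurable]:
  "(\<lambda>(b, x). orbit act b x n) \<in> measurable (S \<Otimes>\<^sub>M X) X"
proof (induction n)
  case (Suc n)
  have "(\<lambda>z. (fst z n, orbit act (fst z) (snd z) n)) \<in> measurable (S \<Otimes>\<^sub>M X) (M \<Otimes>\<^sub>M X)"
    using Suc by (intro measurable_Pair) (auto simp: case_prod_unfold)
  from measurable_compose[OF this measurable_act] show ?case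
    by (simp add: case_prod_unfold)
qed (simp add: case_prod_unfold)

lemma measurable_orbit' [measurable]:
  assumes "f \<in> measurable N S" "h \<in> measurable N X"
  shows "(\<lambda>y. orbit act (f y) (h y) n) \<in> measurable N X"
  using measurable_compose[OF measurable_Pair[OF assms] measurable_orbit] by simp

lemma orbit_dominated:
  assumes "b \<in> space S" "x \<in> space X"
  shows "\<bar>u (orbit act b x n) - u x\<bar> \<le> (\<Sum>k<n. L (b k))"
proof (induction n)
  case (Suc n)
  have "\<bar>u (orbit act b x (Suc n)) - u (orbit act b x n)\<bar> \<le> L (b n)"
    using assms by (auto intro!: dominated seq_in_space orbit_in_space)
  then show ?case using Suc by simp
qed simp

lemma measurable_increment: "x \<in> space X \<Longrightarrow> (\<lambda>b. u (orbit act b x n) - u x) \<in> borel_measurable S"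
  by measurable

lemma integrable_increment: "x \<in> space X \<Longrightarrow> integrable S (\<lambda>b. u (orbit act b x n) - u x)"
  by (rule integrable_dominated[OF integrable_dominator measurable_increment orbit_dominated])

lemma abs_drift_le:
  assumes x: "x \<in> space X"
  shows "\<bar>drift n x\<bar> \<le> real n * (\<integral>g. L g \<partial>M)"
proof -
  have "\<bar>drift n x\<bar> \<le> (\<integral>b. \<bar>u (orbit act b x n) - u x\<bar> \<partial>S)"
    unfolding drift_def by (rule integral_abs_bound)
  also have "\<dots> \<le> (\<integral>b. (\<Sum>k<n. L (b k)) \<partial>S)"
    using integrable_increment[OF x] integrable_sum_coordinates(1)[OF integrable_dominator] orbit_dominated[OF _ x]
    by (intro integral_mono) auto
  finally show ?thesis by (simp add: integrable_sum_coordinates(2)[OF integrable_dominator])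
qed

lemma measurable_drift [measurable]: "drift n \<in> borel_measurable X"
  unfolding drift_def by measurable

lemma drift_0 [simp]: "drift 0 x = 0"
  by (simp add: drift_def)

lemma integrable_drift_orbit:
  assumes x: "x \<in> space X"
  shows "integrable S (\<lambda>b. drift k (orbit act b x n))"
  by (rule P.integrable_const_bound[where B="real k * (\<integral>g. L g \<partial>M)"])
    (use x abs_drift_le in \<open>auto intro!: AE_I2 orbit_in_space\<close>)

text \<open>The coordinates from \<open>n\<close> on are independent of the first \<open>n\<close>,
  so given the first block the increment over the last \<open>k\<close> steps has mean
  \<open>drift k\<close> at the point reached.\<close>

lemma drift_add:
  assumes x: "x \<in> space X"
  shows "drift (n + k) x = drift n x + (\<integral>b. drift k (orbit act b x n) \<partial>S)"
proof -
  have "drift (n + k) x = (\<integral>w. (\<integral>w'. u (orbit act w' (orbit act w x n) k) - u x \<partial>S) \<partial>S)"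
    unfolding drift_def
    by (subst integral_comb_seq(1)[OF integrable_increment[OF x], of _ n]) (simp add: orbit_comb_seq)
  also have "\<dots> = (\<integral>w. (u (orbit act w x n) - u x) + drift k (orbit act w x n) \<partial>S)"
  proof (rule Bochner_Integration.integral_cong[OF refl])
    fix w assume w: "w \<in> space S"
    let ?y = "orbit act w x n"
    have "(\<integral>w'. u (orbit act w' ?y k) - u x \<partial>S)
        = (\<integral>w'. (u (orbit act w' ?y k) - u ?y) + (u ?y - u x) \<partial>S)" by simp
    also have "\<dots> = drift k ?y + (u ?y - u x)"
      unfolding drift_def using integrable_increment[OF orbit_in_space[OF w x], of n k]
      by (subst Bochner_Integration.integral_add) (auto simp: P.prob_space)
    finally show "(\<integral>w'. u (orbit act w' ?y k) - u x \<partial>S) = (u ?y - u x) + drift k ?y" by simp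
  qed
  also have "\<dots> = drift n x + (\<integral>b. drift k (orbit act b x n) \<partial>S)"
    unfolding drift_def[of n]
    by (intro Bochner_Integration.integral_add integrable_increment integrable_drift_orbit x)
  finally show ?thesis .
qed

lemma drift_1: "x \<in> space X \<Longrightarrow> drift 1 x = (\<integral>g. u (act g x) - u x \<partial>M)"
  unfolding drift_def using integral_coordinate[of "\<lambda>g. u (act g x) - u x" 0] by simp

lemma drift_Suc:
  assumes "x \<in> space X"
  shows "drift (Suc k) x = drift 1 x + (\<integral>g. drift k (act g x) \<partial>M)"
  using drift_add[of x 1 k] assms integral_coordinate[of "\<lambda>g. drift k (act g x)" 0] by simp

end

section \<open>Almost sure growth from drift bounds\<close>

lemma measurable_uncurried:
  assumes "(\<lambda>(g, x). F g x) \<in> measurable (A \<Otimes>\<^sub>M B) C" "f \<in> measurable N A" "h \<in> measurable N B"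
  shows "(\<lambda>y. F (f y) (h y)) \<in> measurable N C"
  using measurable_compose[OF measurable_Pair[OF assms(2,3)] assms(1)] by simp

context dominated_potential
begin

text \<open>The induction peels off the first matrix: the bound on the remaining \<open>n\<close>
  factors is uniform in the starting point, so it may be applied at \<open>act g x\<close>.\<close>

lemma exp_moment_le:
  assumes F: "(\<lambda>(g, x). F g x) \<in> borel_measurable (M \<Otimes>\<^sub>M X)"
    and "\<kappa> \<ge> 0"
    and one: "\<And>x. x \<in> space X \<Longrightarrow> (\<integral>\<^sup>+g. ennreal (exp (s * F g x)) \<partial>M) \<le> ennreal \<kappa>"
    and x: "x \<in> space X"
  shows "(\<integral>\<^sup>+b. ennreal (exp (s * (\<Sum>k<n. F (b k) (orbit act b x k)))) \<partial>S) \<le> ennreal (\<kappa> ^ n)"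
  using x
proof (induction n arbitrary: x)
  case 0
  then show ?case by (simp add: P.emeasure_space_1)
next
  case (Suc n)
  note [measurable] = Suc.prems measurable_uncurried[OF F]
  let ?G = "\<lambda>n b x. ennreal (exp (s * (\<Sum>k<n. F (b k) (orbit act b x k))))"
  have "(\<integral>\<^sup>+b. ?G (Suc n) b x \<partial>S) = (\<integral>\<^sup>+b. ?G (Suc n) b x \<partial>distr (M \<Otimes>\<^sub>M S) S (\<lambda>(g, w). case_nat g w))"
    by (simp add: PiM_iter)
  also have "\<dots> = (\<integral>\<^sup>+z. ?G (Suc n) (case_nat (fst z) (snd z)) x \<partial>(M \<Otimes>\<^sub>M S))"
    by (subst nn_integral_distr) (auto simp: case_prod_unfold)
  also have "\<dots> = (\<integral>\<^sup>+z. ennreal (exp (s * F (fst z) x)) * ?G n (snd z) (act (fst z) x) \<partial>(M \<Otimes>\<^sub>M S))"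
    by (simp add: sum.lessThan_Suc_shift orbit_case_nat distrib_left exp_add ennreal_mult
        del: orbit.simps(2) sum.lessThan_Suc)
  also have "\<dots> = (\<integral>\<^sup>+g. (\<integral>\<^sup>+w. ennreal (exp (s * F g x)) * ?G n w (act g x) \<partial>S) \<partial>M)"
    by (subst P.nn_integral_fst[symmetric]) auto
  also have "\<dots> \<le> (\<integral>\<^sup>+g. ennreal (exp (s * F g x)) * ennreal (\<kappa> ^ n) \<partial>M)"
  proof (rule nn_integral_mono)
    fix g assume g: "g \<in> space M"
    note [measurable] = act_in_space[OF g Suc.prems] g
    have "(\<integral>\<^sup>+w. ennreal (exp (s * F g x)) * ?G n w (act g x) \<partial>S)
        = ennreal (exp (s * F g x)) * (\<integral>\<^sup>+w. ?G n w (act g x) \<partial>S)"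
      by (rule nn_integral_cmult) measurable
    also have "\<dots> \<le> ennreal (exp (s * F g x)) * ennreal (\<kappa> ^ n)"
      using g Suc.prems by (intro mult_left_mono Suc.IH act_in_space) auto
    finally show "(\<integral>\<^sup>+w. ennreal (exp (s * F g x)) * ?G n w (act g x) \<partial>S)
      \<le> ennreal (exp (s * F g x)) * ennreal (\<kappa> ^ n)" .
  qed
  also have "\<dots> = (\<integral>\<^sup>+g. ennreal (exp (s * F g x)) \<partial>M) * ennreal (\<kappa> ^ n)"
    by (rule nn_integral_multc) measurable
  also have "\<dots> \<le> ennreal \<kappa> * ennreal (\<kappa> ^ n)"
    by (intro mult_right_mono one Suc.prems) auto
  finally show ?case using \<open>\<kappa> \<ge> 0\<close> by (simp add: ennreal_mult)
qed

text \<open>Azuma's bound, summed over \<open>n\<close>: the normalised exponential moments are summable almost surely.\<close>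

lemma AE_growth_bounded_increments:
  assumes F: "(\<lambda>(g, x). F g x) \<in> borel_measurable (M \<Otimes>\<^sub>M X)"
    and bdd: "\<And>g x. g \<in> space M \<Longrightarrow> x \<in> space X \<Longrightarrow> \<bar>F g x\<bar> \<le> R" and "R > 0"
    and mean: "\<And>x. x \<in> space X \<Longrightarrow> (\<integral>g. F g x \<partial>M) \<le> c"
    and x: "x \<in> space X" and "e > 0"
  shows "AE b in S. \<exists>K. \<forall>n. (\<Sum>k<n. F (b k) (orbit act b x k)) \<le> (c + e) * real n + K"
proof -
  note [measurable] = measurable_uncurried[OF F] x
  \<comment> \<open>The first bound on \<open>s\<close> keeps the exponents between -1 and 1 for the
    quadratic estimate of \<open>exp\<close>; the second makes the quadratic term
    \<open>s^2 * R^2\<close> at most \<open>s * e / 2\<close>.\<close>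
  define s where "s = min (1 / R) (e / (2 * R\<^sup>2))"
  have s: "s > 0" "s * R \<le> 1" "s * R\<^sup>2 \<le> e / 2"
  proof -
    show "s > 0" using \<open>R > 0\<close> \<open>e > 0\<close> by (simp add: s_def)
    have "s * R \<le> (1 / R) * R" using \<open>R > 0\<close> by (intro mult_right_mono) (auto simp: s_def)
    then show "s * R \<le> 1" using \<open>R > 0\<close> by simp
    have "s * R\<^sup>2 \<le> (e / (2 * R\<^sup>2)) * R\<^sup>2" by (intro mult_right_mono) (auto simp: s_def)
    then show "s * R\<^sup>2 \<le> e / 2" using \<open>R > 0\<close> by simp
  qed
  define \<kappa> where "\<kappa> = exp (s * (c + e / 2))"
  have one: "(\<integral>\<^sup>+g. ennreal (exp (s * F g x)) \<partial>M) \<le> ennreal \<kappa>" if x: "x \<in> space X" for x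
  proof -
    note [measurable] = x
    have iF: "integrable M (\<lambda>g. F g x)"
      by (rule M.integrable_const_bound[where B=R]) (use bdd x in auto)
    have "exp (s * F g x) \<le> 1 + s * F g x + s\<^sup>2 * R\<^sup>2" if g: "g \<in> space M" for g
    proof -
      have a: "\<bar>s * F g x\<bar> \<le> s * R" using bdd[OF g x] s(1) by (simp add: abs_mult)
      then have "(s * F g x)\<^sup>2 \<le> (s * R)\<^sup>2" using power_mono[OF a, of 2] by simp
      moreover have "exp (s * F g x) \<le> 1 + s * F g x + (s * F g x)\<^sup>2"
        using a s(2) by (intro exp_le_quadratic) simp
      ultimately show ?thesis by (simp add: power_mult_distrib)
    qed
    then have "(\<integral>\<^sup>+g. ennreal (exp (s * F g x)) \<partial>M) \<le> (\<integral>\<^sup>+g. ennreal (1 + s * F g x + s\<^sup>2 * R\<^sup>2) \<partial>M)"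
      by (intro nn_integral_mono ennreal_leI) auto
    also have "\<dots> = ennreal (\<integral>g. 1 + s * F g x + s\<^sup>2 * R\<^sup>2 \<partial>M)"
    proof (rule nn_integral_eq_integral)
      show "AE g in M. 0 \<le> 1 + s * F g x + s\<^sup>2 * R\<^sup>2"
      proof (rule AE_I2)
        fix g assume "g \<in> space M"
        then have "\<bar>s * F g x\<bar> \<le> s * R" using bdd[OF _ x] s(1) by (simp add: abs_mult)
        then have "0 \<le> 1 + s * F g x" using s(2) by linarith
        then show "0 \<le> 1 + s * F g x + s\<^sup>2 * R\<^sup>2" by (simp add: add_nonneg_nonneg)
      qed
    qed (use iF in auto)
    also have "(\<integral>g. 1 + s * F g x + s\<^sup>2 * R\<^sup>2 \<partial>M) = 1 + s * (\<integral>g. F g x \<partial>M) + s\<^sup>2 * R\<^sup>2"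
      using iF by (simp add: M.prob_space)
    also have "\<dots> \<le> 1 + s * (c + e / 2)"
    proof -
      have "s * (s * R\<^sup>2) \<le> s * (e / 2)" using s by (intro mult_left_mono) auto
      moreover have "s * (\<integral>g. F g x \<partial>M) \<le> s * c" using s mean[OF x] by (intro mult_left_mono) auto
      ultimately show ?thesis by (simp add: power2_eq_square algebra_simps)
    qed
    also have "\<dots> \<le> \<kappa>" unfolding \<kappa>_def by (rule exp_ge_add_one_self)
    finally show ?thesis by (simp add: ennreal_leI)
  qed
  define D where "D n b = (\<Sum>k<n. F (b k) (orbit act b x k))" for n b
  have [measurable]: "D n \<in> borel_measurable S" for n unfolding D_def by measurable
  \<comment> \<open>This uses the other half of \<open>e\<close>: dividing
    \<open>\<kappa> ^ n\<close> by \<open>exp (s * (c + e) * n)\<close> leaves a geometric sequence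
    with this ratio.\<close>
  define \<rho> where "\<rho> = exp (- (s * e / 2))"
  have \<rho>: "0 \<le> \<rho>" "\<rho> < 1" using s(1) \<open>e > 0\<close> by (auto simp: \<rho>_def)
  define Z where "Z n b = exp (s * D n b - s * (c + e) * real n)" for n b
  have [measurable]: "Z n \<in> borel_measurable S" for n unfolding Z_def by measurable
  have Z: "(\<integral>\<^sup>+b. ennreal (Z n b) \<partial>S) \<le> ennreal (\<rho> ^ n)" for n
  proof -
    have "(\<integral>\<^sup>+b. ennreal (Z n b) \<partial>S) = (\<integral>\<^sup>+b. ennreal (exp (s * D n b)) * ennreal (exp (- (s * (c + e) * real n))) \<partial>S)"
      by (simp add: Z_def exp_diff exp_minus divide_inverse ennreal_mult)
    also have "\<dots> = (\<integral>\<^sup>+b. ennreal (exp (s * D n b)) \<partial>S) * ennreal (exp (- (s * (c + e) * real n)))"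
      by (rule nn_integral_multc) measurable
    also have "\<dots> \<le> ennreal (\<kappa> ^ n) * ennreal (exp (- (s * (c + e) * real n)))"
      unfolding D_def by (intro mult_right_mono exp_moment_le one F x) (auto simp: \<kappa>_def)
    also have "\<dots> = ennreal (\<rho> ^ n)"
      unfolding \<kappa>_def \<rho>_def exp_of_nat_mult[symmetric]
      by (simp add: ennreal_mult[symmetric] exp_add[symmetric] algebra_simps)
    finally show ?thesis .
  qed
  have "(\<integral>\<^sup>+b. (\<Sum>n. ennreal (Z n b)) \<partial>S) = (\<Sum>n. \<integral>\<^sup>+b. ennreal (Z n b) \<partial>S)"
    by (rule nn_integral_suminf) measurable
  also have "\<dots> \<le> (\<Sum>n. ennreal (\<rho> ^ n))" by (intro suminf_le Z) auto
  also have "\<dots> = ennreal (\<Sum>n. \<rho> ^ n)"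
    using \<rho> by (intro suminf_ennreal2) (auto intro: summable_geometric)
  also have "\<dots> < \<infinity>" by simp
  finally have "(\<integral>\<^sup>+b. (\<Sum>n. ennreal (Z n b)) \<partial>S) \<noteq> \<infinity>" by simp
  then have "AE b in S. (\<Sum>n. ennreal (Z n b)) \<noteq> \<infinity>"
    by (rule nn_integral_noteq_infinite[rotated]) measurable
  then show ?thesis
  proof eventually_elim
    case (elim b)
    then obtain T where T: "(\<Sum>n. ennreal (Z n b)) = ennreal T" "T \<ge> 0"
      by (cases "\<Sum>n. ennreal (Z n b)") auto
    have le: "Z n b \<le> T" for n
    proof -
      have "ennreal (Z n b) \<le> (\<Sum>n. ennreal (Z n b))"
        using sum_le_suminf[of "\<lambda>n. ennreal (Z n b)" "{n}"] by simp
      then show ?thesis using T by simp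
    qed
    \<comment> \<open>\<open>Z 0 b = 1\<close>, so the logarithm of \<open>T\<close> is taken at a
      positive number.\<close>
    have "T \<ge> 1" using le[of 0] by (simp add: Z_def D_def)
    have "D n b \<le> (c + e) * real n + ln T / s" for n
    proof -
      have "s * D n b - s * (c + e) * real n \<le> ln T"
        using le[of n] \<open>T \<ge> 1\<close> unfolding Z_def by (subst ln_ge_iff) auto
      then show ?thesis using s(1) by (simp add: field_simps)
    qed
    then show ?case unfolding D_def by blast
  qed
qed

lemma ex_truncation_level:
  assumes "e > 0"
  shows "\<exists>R>0. (\<integral>g. max 0 (L g - R) \<partial>M) \<le> e"
proof -
  have "(\<lambda>n. \<integral>g. max 0 (L g - real n) \<partial>M) \<longlonglongrightarrow> (\<integral>g. 0 \<partial>M)"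
  proof (rule integral_dominated_convergence[where w="\<lambda>g. \<bar>L g\<bar>"])
    show "AE g in M. (\<lambda>n. max 0 (L g - real n)) \<longlonglongrightarrow> 0"
    proof (rule AE_I2, rule tendsto_eventually)
      fix g
      obtain N :: nat where "L g < real N" using reals_Archimedean2 by blast
      then show "\<forall>\<^sub>F n in sequentially. max 0 (L g - real n) = 0"
        unfolding eventually_sequentially by (intro exI[of _ N]) auto
    qed
  qed (use integrable_dominator in auto)
  then have "\<forall>\<^sub>F n in sequentially. (\<integral>g. max 0 (L g - real n) \<partial>M) < e"
    using assms by (intro order_tendstoD) auto
  then have "\<forall>\<^sub>F n in sequentially. n > 0 \<and> (\<integral>g. max 0 (L g - real n) \<partial>M) < e"
    using eventually_gt_at_top[of 0] by eventually_elim auto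
  then obtain n :: nat where "n > 0" "(\<integral>g. max 0 (L g - real n) \<partial>M) < e"
    unfolding eventually_sequentially by blast
  then show ?thesis by (intro exI[of _ "real n"]) auto
qed

lemma integrable_one_step:
  assumes x: "x \<in> space X"
  shows "integrable M (\<lambda>g. u (act g x) - u x)"
proof (rule Bochner_Integration.integrable_bound[OF integrable_dominator])
  show "AE g in M. norm (u (act g x) - u x) \<le> norm (L g)"
    using dominated[OF _ x] by (intro AE_I2) (auto intro: order_trans[OF _ abs_ge_self])
qed (use x in measurable)

text \<open>Truncating the increments at level \<open>R\<close> makes them bounded. What is lost at
  each step is at most \<open>max 0 (L g - R)\<close>, an i.i.d. sequence of small mean whose sums
  are controlled by the law of large numbers.\<close>

lemma AE_growth_orbit_one_step:
  assumes mean: "\<And>x. x \<in> space X \<Longrightarrow> (\<integral>g. u (act g x) - u x \<partial>M) \<le> c"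
    and x: "x \<in> space X"
  shows "AE b in S. growth_le (\<lambda>n. u (orbit act b x n) - u x) c"
proof (rule AE_growth_leI)
  fix j :: nat
  \<comment> \<open>There are four errors of size \<open>e\<close>: one in the mean of the truncated
    increments, one in their almost sure bound, two for the sums of the lost parts.\<close>
  define e where "e = 1 / (4 * real (Suc j))"
  have e: "e > 0" by (simp add: e_def)
  obtain R where R: "R > 0" "(\<integral>g. max 0 (L g - R) \<partial>M) \<le> e" using ex_truncation_level[OF e] by blast
  define F where "F g y = max (- R) (min R (u (act g y) - u y))" for g y
  have F: "(\<lambda>(g, y). F g y) \<in> borel_measurable (M \<Otimes>\<^sub>M X)"
    unfolding F_def by measurable
  note [measurable] = measurable_uncurried[OF F]
  have diff: "\<bar>u (act g y) - u y - F g y\<bar> \<le> max 0 (L g - R)" if "g \<in> space M" "y \<in> space X" for g y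
    using dominated[OF that] R(1) unfolding F_def by (auto simp: max_def min_def abs_if split: if_splits)
  have iL: "integrable M (\<lambda>g. max 0 (L g - R))" using integrable_dominator by auto
  have mF: "(\<integral>g. F g y \<partial>M) \<le> c + e" if y: "y \<in> space X" for y
  proof -
    note [measurable] = y
    have "(\<integral>g. F g y \<partial>M) \<le> (\<integral>g. (u (act g y) - u y) + max 0 (L g - R) \<partial>M)"
    proof (rule integral_mono)
      show "integrable M (\<lambda>g. F g y)"
        by (rule M.integrable_const_bound[where B=R]) (use R(1) in \<open>auto simp: F_def\<close>)
      show "F g y \<le> (u (act g y) - u y) + max 0 (L g - R)" if "g \<in> space M" for g
        using diff[OF that y] by linarith
    qed (use integrable_one_step[OF y] iL in auto)
    also have "\<dots> = (\<integral>g. u (act g y) - u y \<partial>M) + (\<integral>g. max 0 (L g - R) \<partial>M)"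
      using integrable_one_step[OF y] iL by (rule Bochner_Integration.integral_add)
    finally show ?thesis using mean[OF y] R(2) by linarith
  qed
  have "AE b in S. \<exists>K. \<forall>n. (\<Sum>k<n. F (b k) (orbit act b x k)) \<le> (c + e + e) * real n + K"
    by (rule AE_growth_bounded_increments[OF F _ R(1) mF x e]) (use R(1) in \<open>auto simp: F_def\<close>)
  moreover note AE_growth_sum(1)[OF iL]
  ultimately show "AE b in S. \<exists>K. \<forall>n. u (orbit act b x n) - u x \<le> (c + 1 / real (Suc j)) * real n + K"
    using AE_space
  proof eventually_elim
    case (elim b)
    then obtain K1 where K1: "\<And>n. (\<Sum>k<n. F (b k) (orbit act b x k)) \<le> (c + e + e) * real n + K1" by blast
    obtain K2 where K2: "\<And>n. (\<Sum>k<n. max 0 (L (b k) - R)) \<le> (2 * e) * real n + K2"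
      using growth_leD[OF elim(2), of "2 * e"] R(2) e by auto
    have "u (orbit act b x n) - u x \<le> (c + 1 / real (Suc j)) * real n + (K1 + K2)" for n
    proof -
      have "u (orbit act b x n) - u x \<le> (\<Sum>k<n. F (b k) (orbit act b x k)) + (\<Sum>k<n. max 0 (L (b k) - R))"
      proof (induction n)
        case (Suc n)
        have "u (act (b n) (orbit act b x n)) - u (orbit act b x n) - F (b n) (orbit act b x n) \<le> max 0 (L (b n) - R)"
          using diff[OF seq_in_space[OF elim(3)] orbit_in_space[OF elim(3) x], of n n] by linarith
        then show ?case using Suc unfolding sum.lessThan_Suc orbit.simps by linarith
      qed simp
      also have "\<dots> \<le> (c + 4 * e) * real n + (K1 + K2)"
        using K1[of n] K2[of n] by (simp add: algebra_simps)
      also have "4 * e = 1 / real (Suc j)" by (simp add: e_def del: of_nat_Suc)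
      finally show ?thesis .
    qed
    then show ?case by blast
  qed
qed

text \<open>Averaging the drifts gives a coboundary that turns an \<open>N\<close>-step drift bound into a one-step bound.\<close>

lemma AE_growth_orbit:
  assumes N: "N \<ge> 1" and mean: "\<And>x. x \<in> space X \<Longrightarrow> drift N x \<le> c * real N"
    and x: "x \<in> space X"
  shows "AE b in S. growth_le (\<lambda>n. u (orbit act b x n) - u x) c"
proof -
  define l where "l = (\<integral>g. L g \<partial>M)"
  \<comment> \<open>One step changes \<open>h\<close> in mean by
    \<open>drift N y / N - drift 1 y\<close>, because the differences
    \<open>drift (Suc k) y - drift k y\<close> telescope. Adding \<open>h\<close> to
    \<open>u\<close> thus replaces the one-step drift by \<open>drift N y / N\<close>.\<close>
  define h where "h y = (\<Sum>k<N. drift k y) / real N" for y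
  have [measurable]: "h \<in> borel_measurable X" unfolding h_def by measurable
  define B where "B = (\<Sum>k<N. real k * l) / real N"
  have h: "\<bar>h y\<bar> \<le> B" if y: "y \<in> space X" for y
  proof -
    have "\<bar>\<Sum>k<N. drift k y\<bar> \<le> (\<Sum>k<N. real k * l)"
      using abs_drift_le[OF y] unfolding l_def by (intro order_trans[OF sum_abs] sum_mono) auto
    then show ?thesis unfolding h_def B_def by (simp add: divide_right_mono)
  qed
  interpret corrected: dominated_potential M X act "\<lambda>y. u y + h y" "\<lambda>g. L g + 2 * B"
  proof
    show "integrable M (\<lambda>g. L g + 2 * B)" using integrable_dominator by simp
    show "\<bar>(u (act g y) + h (act g y)) - (u y + h y)\<bar> \<le> L g + 2 * B" if "g \<in> space M" "y \<in> space X" for g y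
      using dominated[OF that] h[OF that(2)] h[OF act_in_space[OF that]] by linarith
  qed measurable
  have "AE b in S. growth_le (\<lambda>n. (u (orbit act b x n) + h (orbit act b x n)) - (u x + h x)) c"
  proof (rule corrected.AE_growth_orbit_one_step[OF _ x])
    fix y assume y: "y \<in> space X"
    have id: "integrable M (\<lambda>g. drift k (act g y))" for k
      by (rule M.integrable_const_bound[where B="real k * (\<integral>g. L g \<partial>M)"])
        (use y abs_drift_le in \<open>auto intro!: AE_I2 act_in_space\<close>)
    have ih: "integrable M (\<lambda>g. h (act g y))" unfolding h_def using id by auto
    have "(\<integral>g. (u (act g y) + h (act g y)) - (u y + h y) \<partial>M)
        = (\<integral>g. (u (act g y) - u y) + (h (act g y) - h y) \<partial>M)"
      by (rule Bochner_Integration.integral_cong) auto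
    also have "\<dots> = (\<integral>g. u (act g y) - u y \<partial>M) + (\<integral>g. h (act g y) - h y \<partial>M)"
      using ih by (intro Bochner_Integration.integral_add integrable_one_step[OF y]) auto
    also have "\<dots> = drift 1 y + ((\<integral>g. h (act g y) \<partial>M) - h y)"
      using ih by (simp add: drift_1[OF y, simplified] M.prob_space)
    also have "(\<integral>g. h (act g y) \<partial>M) = (\<Sum>k<N. drift (Suc k) y - drift 1 y) / real N"
    proof -
      have "(\<integral>g. drift k (act g y) \<partial>M) = drift (Suc k) y - drift 1 y" for k
        using drift_Suc[OF y, of k] by linarith
      then show ?thesis
        unfolding h_def using id by (simp add: Bochner_Integration.integral_sum)
    qed
    also have "(\<Sum>k<N. drift (Suc k) y - drift 1 y) / real N - h y
        = ((\<Sum>k<N. drift (Suc k) y - drift k y) - real N * drift 1 y) / real N"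
      unfolding h_def by (simp add: sum_subtractf diff_divide_distrib)
    also have "(\<Sum>k<N. drift (Suc k) y - drift k y) = drift N y"
      using sum_lessThan_telescope[of "\<lambda>k. drift k y" N] by simp
    also have "drift 1 y + (drift N y - real N * drift 1 y) / real N = drift N y / real N"
      using N by (simp add: diff_divide_distrib)
    also have "\<dots> \<le> c" using mean[OF y] N by (simp add: divide_le_eq)
    finally show "(\<integral>g. (u (act g y) + h (act g y)) - (u y + h y) \<partial>M) \<le> c" .
  qed
  then show ?thesis
    using AE_space
  proof eventually_elim
    case (elim b)
    show ?case
    proof (rule growth_le_mono[OF elim(1), of _ "2 * B"])
      fix n
      show "u (orbit act b x n) - u x \<le> u (orbit act b x n) + h (orbit act b x n) - (u x + h x) + 2 * B"
        using h[OF x] h[OF orbit_in_space[OF elim(2) x], of n] by linarith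
    qed
  qed
qed

lemma AE_growth_orbit_lower:
  assumes N: "N \<ge> 1" and mean: "\<And>x. x \<in> space X \<Longrightarrow> c * real N \<le> drift N x"
    and x: "x \<in> space X"
  shows "AE b in S. growth_le (\<lambda>n. - (u (orbit act b x n) - u x)) (- c)"
proof -
  interpret neg: dominated_potential M X act "\<lambda>x. - u x" L
  proof
    show "\<bar>- u (act g y) - - u y\<bar> \<le> L g" if "g \<in> space M" "y \<in> space X" for g y
      using dominated[OF that] by linarith
  qed (use integrable_dominator in measurable)
  have d: "neg.drift n y = - drift n y" for n y
  proof -
    have "neg.drift n y = (\<integral>b. - (u (orbit act b y n) - u y) \<partial>S)"
      unfolding neg.drift_def by (rule Bochner_Integration.integral_cong) auto
    also have "\<dots> = - drift n y"
      unfolding drift_def by (rule Bochner_Integration.integral_minus)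
    finally show ?thesis .
  qed
  have "AE b in S. growth_le (\<lambda>n. - u (orbit act b x n) - - u x) (- c)"
    by (rule neg.AE_growth_orbit[OF N _ x]) (use mean in \<open>simp add: d\<close>)
  then show ?thesis by simp
qed

section \<open>Minimal drift and compactness\<close>

lemma ex_subseq_orbit_tendsto:
  assumes x: "x \<in> space X"
    and lower: "AE b in S. growth_le (\<lambda>n. - (u (orbit act b x n) - u x)) (- m)"
    and mean: "\<And>n. n \<ge> 1 \<Longrightarrow> drift n x \<le> m * real n"
  shows "\<exists>r::nat\<Rightarrow>nat. strict_mono r \<and>
    (AE b in S. (\<lambda>k. (u (orbit act b x (r k)) - u x) / real (r k)) \<longlonglongrightarrow> m)"
  by (rule ex_subseq_AE_tendsto[OF integrable_dominator measurable_increment[OF x] orbit_dominated[OF _ x] lower])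
    (use mean in \<open>auto simp: drift_def\<close>)

text \<open>If each point has a positive excess drift at some time, then by compactness these times are
  bounded, and concatenating them makes the linear lower bound uniform.\<close>

lemma uniform_drift:
  fixes K :: "'y::metric_space set"
  assumes K: "compact K" "\<And>n. continuous_on K (\<lambda>y. drift n (\<iota> y))"
    and \<iota>: "\<And>y. y \<in> K \<Longrightarrow> \<iota> y \<in> space X"
    and retract: "\<And>x. x \<in> space X \<Longrightarrow> \<exists>y\<in>K. \<forall>n. drift n (\<iota> y) = drift n x"
    and pos: "\<And>x. x \<in> space X \<Longrightarrow> \<exists>n\<ge>1. c * real n < drift n x"
  shows "\<exists>c'>c. \<exists>C. \<forall>n. \<forall>x\<in>space X. c' * real n - C \<le> drift n x"
proof -
  define l where "l = (\<integral>g. L g \<partial>M)"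
  \<comment> \<open>One index \<open>j\<close> bounds both the time and the reciprocal of the
    excess. A sequence of counterexamples would accumulate at a point of \<open>K\<close> that
    contradicts \<open>pos\<close>.\<close>
  have "\<exists>j::nat. \<forall>y\<in>K. \<exists>n\<in>{1..j}. (c + 1 / real (Suc j)) * real n \<le> drift n (\<iota> y)"
  proof (rule ccontr)
    assume "\<nexists>j::nat. \<forall>y\<in>K. \<exists>n\<in>{1..j}. (c + 1 / real (Suc j)) * real n \<le> drift n (\<iota> y)"
    then have "\<forall>j. \<exists>y\<in>K. \<forall>n\<in>{1..j}. drift n (\<iota> y) < (c + 1 / real (Suc j)) * real n"
      by (meson not_le)
    then obtain y where y: "\<And>j. y j \<in> K"
      "\<And>j n. n \<in> {1..j} \<Longrightarrow> drift n (\<iota> (y j)) < (c + 1 / real (Suc j)) * real n" by metis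
    obtain z r where z: "z \<in> K" "strict_mono (r :: nat \<Rightarrow> nat)" "(y \<circ> r) \<longlonglongrightarrow> z"
      using K(1) y(1) unfolding compact_def by blast
    obtain n where n: "n \<ge> 1" "c * real n < drift n (\<iota> z)" using pos[OF \<iota>[OF z(1)]] by blast
    have "(\<lambda>j. drift n (\<iota> ((y \<circ> r) j))) \<longlonglongrightarrow> drift n (\<iota> z)"
      by (rule continuous_on_tendsto_compose[OF K(2) z(3) z(1)]) (simp add: y(1))
    moreover have "(\<lambda>j. (c + 1 / real (Suc (r j))) * real n) \<longlonglongrightarrow> (c + 0) * real n"
    proof -
      have "(\<lambda>j. 1 / real (Suc (r j))) \<longlonglongrightarrow> 0"
        using LIMSEQ_subseq_LIMSEQ[OF LIMSEQ_inverse_real_of_nat z(2)] by (simp add: comp_def divide_inverse)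
      then show ?thesis by (intro tendsto_intros)
    qed
    moreover have "\<forall>\<^sub>F j in sequentially. drift n (\<iota> ((y \<circ> r) j)) \<le> (c + 1 / real (Suc (r j))) * real n"
      using eventually_ge_at_top[of n]
    proof eventually_elim
      case (elim j)
      then have "n \<le> r j" using seq_suble[OF z(2), of j] by simp
      then show ?case using y(2)[of n "r j"] n(1) by simp
    qed
    ultimately have "drift n (\<iota> z) \<le> (c + 0) * real n"
      by (intro tendsto_le[OF sequentially_bot])
    then show False using n(2) by simp
  qed
  then obtain j where j: "\<And>y. y \<in> K \<Longrightarrow> \<exists>n\<in>{1..j}. (c + 1 / real (Suc j)) * real n \<le> drift n (\<iota> y)" by blast
  define c' where "c' = c + 1 / real (Suc j)"
  \<comment> \<open>A point outside the image of \<open>K\<close> inherits the time from a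
    representative with the same drifts; in the applications the two span the same line, possibly
    modulo \<open>W\<close>.\<close>
  have step: "\<exists>n\<in>{1..j}. c' * real n \<le> drift n x" if "x \<in> space X" for x
    using j retract[OF that] unfolding c'_def by metis
  \<comment> \<open>\<open>C\<close> covers the times \<open>n < j\<close>, for which the crude
    bound \<open>- n * l <= drift n x\<close> suffices.\<close>
  define C where "C = real j * (\<bar>l\<bar> + \<bar>c'\<bar>)"
  have "\<forall>x\<in>space X. c' * real n - C \<le> drift n x" for n
  proof (induction n rule: less_induct)
    case (less n)
    show ?case
    proof
      fix x assume x: "x \<in> space X"
      show "c' * real n - C \<le> drift n x"
      proof (cases "n < j")
        case True
        have "c' * real n \<le> \<bar>c'\<bar> * real j" using True by (intro mult_mono) auto
        moreover have "real n * l \<le> real j * \<bar>l\<bar>"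
          using True by (intro order_trans[OF mult_left_mono[OF abs_ge_self] mult_right_mono]) auto
        moreover have "- (real n * l) \<le> drift n x" using abs_drift_le[OF x, of n] unfolding l_def by linarith
        ultimately show ?thesis unfolding C_def by (simp add: algebra_simps)
      next
        case False
        obtain k where k: "k \<in> {1..j}" "c' * real k \<le> drift k x" using step[OF x] by blast
        obtain i where i: "n = k + i" using k(1) False by (metis atLeastAtMost_iff le_Suc_ex le_trans not_less)
        have "i < n" using i k(1) by simp
        have "c' * real i - C = (\<integral>b. c' * real i - C \<partial>S)" by (simp add: P.prob_space)
        also have "\<dots> \<le> (\<integral>b. drift i (orbit act b x k) \<partial>S)"
          using less[OF \<open>i < n\<close>] orbit_in_space[OF _ x] integrable_drift_orbit[OF x]
          by (intro integral_mono) auto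
        finally show ?thesis
          using drift_add[OF x, of k i] k(2) unfolding i by (simp add: algebra_simps)
      qed
    qed
  qed
  moreover have "c' > c" by (simp add: c'_def)
  ultimately show ?thesis by blast
qed

text \<open>\<open>m\<close> is the supremum of the rates that some time \<open>N\<close> certifies
  for all points. If every point exceeded rate \<open>m\<close> at some time,
  \<open>uniform_drift\<close> would certify a rate above \<open>m\<close>. The mean bound at
  \<open>x\<close> and the almost sure lower bound are the two hypotheses of
  \<open>ex_subseq_orbit_tendsto\<close>.\<close>

lemma ex_minimal_growth:
  fixes K :: "'y::metric_space set"
  assumes K: "compact K" "\<And>n. continuous_on K (\<lambda>y. drift n (\<iota> y))"
    and \<iota>: "\<And>y. y \<in> K \<Longrightarrow> \<iota> y \<in> space X"
    and retract: "\<And>x. x \<in> space X \<Longrightarrow> \<exists>y\<in>K. \<forall>n. drift n (\<iota> y) = drift n x"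
    and ne: "space X \<noteq> {}"
  obtains m x where "x \<in> space X" "\<And>n. n \<ge> 1 \<Longrightarrow> drift n x \<le> m * real n"
    "\<And>y. y \<in> space X \<Longrightarrow> AE b in S. growth_le (\<lambda>n. - (u (orbit act b y n) - u y)) (- m)"
proof -
  define l where "l = (\<integral>g. L g \<partial>M)"
  define A where "A = {c. \<exists>N\<ge>1. \<forall>x\<in>space X. c * real N \<le> drift N x}"
  have "- l \<in> A"
    unfolding A_def
  proof (intro CollectI exI[of _ 1] conjI ballI)
    fix x assume "x \<in> space X"
    from abs_drift_le[OF this, of 1] show "- l * real 1 \<le> drift 1 x" unfolding l_def by simp
  qed simp
  have bdd: "bdd_above A"
  proof (rule bdd_aboveI)
    fix c assume "c \<in> A"
    then obtain N where N: "N \<ge> 1" "\<forall>x\<in>space X. c * real N \<le> drift N x" unfolding A_def by blast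
    obtain x where x: "x \<in> space X" using ne by blast
    have "c * real N \<le> l * real N"
      using N(2) x abs_drift_le[OF x, of N] unfolding l_def by (force simp: mult.commute)
    then show "c \<le> l" using N(1) by simp
  qed
  define m where "m = Sup A"
  have "\<exists>x\<in>space X. \<forall>n\<ge>1. drift n x \<le> m * real n"
  proof (rule ccontr)
    assume "\<not> (\<exists>x\<in>space X. \<forall>n\<ge>1. drift n x \<le> m * real n)"
    then have "\<exists>n\<ge>1. m * real n < drift n x" if "x \<in> space X" for x using that by (meson not_le)
    from uniform_drift[OF K \<iota> retract this]
    obtain c C where c: "c > m" "\<And>n x. x \<in> space X \<Longrightarrow> c * real n - C \<le> drift n x" by blast
    \<comment> \<open>The room between \<open>d\<close> and \<open>c\<close> absorbs the constant
      \<open>C\<close> at a large time \<open>N\<close>.\<close>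
    obtain d where d: "m < d" "d < c" using c(1) dense by blast
    obtain N :: nat where "max 1 (C / (c - d)) < real N" using reals_Archimedean2 by blast
    then have N: "N \<ge> 1" "C \<le> (c - d) * real N" using d by (auto simp: field_simps)
    have "d * real N \<le> drift N x" if "x \<in> space X" for x
      using c(2)[OF that, of N] N(2) by (simp add: algebra_simps)
    then have "d \<in> A" using N(1) unfolding A_def by blast
    then have "d \<le> m" unfolding m_def using bdd by (rule cSup_upper)
    then show False using d by simp
  qed
  then obtain x where x: "x \<in> space X" "\<And>n. n \<ge> 1 \<Longrightarrow> drift n x \<le> m * real n" by blast
  have "AE b in S. growth_le (\<lambda>n. - (u (orbit act b y n) - u y)) (- m)" if y: "y \<in> space X" for y
  proof (rule AE_growth_leI)
    fix j :: nat
    have "m - 1 / real (Suc j) < Sup A" by (simp add: m_def)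
    then obtain c where c: "c \<in> A" "m - 1 / real (Suc j) < c"
      using less_cSup_iff[OF _ bdd] \<open>- l \<in> A\<close> by blast
    then obtain N where N: "N \<ge> 1" "\<And>x. x \<in> space X \<Longrightarrow> c * real N \<le> drift N x" unfolding A_def by blast
    have "AE b in S. growth_le (\<lambda>n. - (u (orbit act b y n) - u y)) (- c)"
      by (rule AE_growth_orbit_lower[OF N(1) N(2) y])
    then show "AE b in S. \<exists>C. \<forall>n. - (u (orbit act b y n) - u y) \<le> (- m + 1 / real (Suc j)) * real n + C"
      by eventually_elim (rule growth_leD, use c in auto)
  qed
  with x show ?thesis using that by blast
qed

lemma continuous_on_drift:
  fixes K :: "'y::metric_space set"
  assumes \<iota>: "\<And>y. y \<in> K \<Longrightarrow> \<iota> y \<in> space X"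
    and cont: "\<And>b. b \<in> space S \<Longrightarrow> continuous_on K (\<lambda>y. u (orbit act b (\<iota> y) n) - u (\<iota> y))"
  shows "continuous_on K (\<lambda>y. drift n (\<iota> y))"
  unfolding continuous_on_sequentially
proof (intro allI ballI impI)
  fix y a assume a: "a \<in> K" and y: "(\<forall>k. y k \<in> K) \<and> y \<longlonglongrightarrow> a"
  show "((\<lambda>y. drift n (\<iota> y)) \<circ> y) \<longlonglongrightarrow> drift n (\<iota> a)"
    unfolding drift_def comp_def
  proof (rule integral_dominated_convergence[where w="\<lambda>b. \<Sum>k<n. L (b k)"])
    show "AE b in S. (\<lambda>i. u (orbit act b (\<iota> (y i)) n) - u (\<iota> (y i))) \<longlonglongrightarrow> u (orbit act b (\<iota> a) n) - u (\<iota> a)"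
      by (intro AE_I2 continuous_on_tendsto_compose[OF cont _ a]) (use y in auto)
    show "AE b in S. norm (u (orbit act b (\<iota> (y i)) n) - u (\<iota> (y i))) \<le> (\<Sum>k<n. L (b k))" for i
      using orbit_dominated \<iota> y by (intro AE_I2) auto
  qed (use integrable_sum_coordinates(1)[OF integrable_dominator] measurable_increment \<iota> y a in auto)
qed

end

section \<open>Residuals of orthogonal projections\<close>

lemma ex_orthogonal_residual:
  fixes W :: "'a::euclidean_space set"
  assumes "subspace W"
  shows "\<exists>Q. linear Q \<and> (\<forall>x. x - Q x \<in> W) \<and> (\<forall>x\<in>W. Q x = 0) \<and> (\<forall>x. norm (Q x) \<le> norm x)"
proof -
  obtain B where B: "B \<subseteq> W" "pairwise orthogonal B" "\<And>x. x \<in> B \<Longrightarrow> norm x = 1"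
    "independent B" "span B = W" using orthonormal_basis_subspace[OF assms] by metis
  have fin: "finite B" using B(4) by (rule independent_imp_finite)
  define p where "p x = (\<Sum>i\<in>B. (x \<bullet> i) *\<^sub>R i)" for x
  have pW: "p x \<in> W" for x
    unfolding p_def by (intro subspace_sum[OF assms] subspace_scale[OF assms]) (use B(1) in auto)
  have p_id: "p x = x" if "x \<in> W" for x
    unfolding p_def using that B fin by (intro orthonormal_basis_expand) auto
  have pB: "p x \<bullet> j = x \<bullet> j" if "j \<in> B" for x j
  proof -
    have "i \<bullet> j = (if i = j then 1 else 0)" if "i \<in> B" for i
      using B(2,3) that \<open>j \<in> B\<close> by (auto simp: pairwise_def orthogonal_def norm_eq_1)
    then have "p x \<bullet> j = (\<Sum>i\<in>B. if i = j then x \<bullet> i else 0)"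
      unfolding p_def inner_sum_left by (intro sum.cong) auto
    then show ?thesis using fin that by simp
  qed
  have "(x - p x) \<bullet> p x = 0" for x
  proof -
    have "(x - p x) \<bullet> p x = (\<Sum>j\<in>B. (x \<bullet> j) * ((x - p x) \<bullet> j))"
      by (simp add: p_def[of x] inner_sum_right del: inner_diff_left)
    also have "\<dots> = 0" by (intro sum.neutral) (simp add: inner_diff_left pB)
    finally show ?thesis .
  qed
  then have pyth: "(norm x)\<^sup>2 = (norm (x - p x))\<^sup>2 + (norm (p x))\<^sup>2" for x
    using norm_add_Pythagorean[of "x - p x" "p x"] unfolding orthogonal_def by (metis diff_add_cancel)
  have "norm (x - p x) \<le> norm x" for x
    by (rule power2_le_imp_le) (use pyth[of x] zero_le_power2[of "norm (p x)"] in linarith, simp)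
  moreover have "linear (\<lambda>x. x - p x)"
    unfolding p_def by (rule linearI) (auto simp: inner_add_left sum.distrib scaleR_add_left algebra_simps scaleR_sum_right)
  ultimately show ?thesis using pW p_id by (intro exI[of _ "\<lambda>x. x - p x"]) auto
qed

text \<open>The four properties make \<open>norm (residual W x)\<close> the quotient norm of the
  class of \<open>x\<close> modulo \<open>W\<close>: the residual depends only on the class, belongs
  to it, and is no longer than any other member. Representatives keep the quotients by all
  \<open>W\<close> inside one type.\<close>

definition residual :: "'a::euclidean_space set \<Rightarrow> 'a \<Rightarrow> 'a" where
  "residual W = (SOME Q. linear Q \<and> (\<forall>x. x - Q x \<in> W) \<and> (\<forall>x\<in>W. Q x = 0) \<and> (\<forall>x. norm (Q x) \<le> norm x))"

lemma
  assumes "subspace W"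
  shows linear_residual: "linear (residual W)"
    and diff_residual: "x - residual W x \<in> W"
    and residual_eq_0: "x \<in> W \<Longrightarrow> residual W x = 0"
    and norm_residual_le: "norm (residual W x) \<le> norm x"
  using someI_ex[OF ex_orthogonal_residual[OF assms]] unfolding residual_def[symmetric] by auto

lemma residual_eq_0_iff: "subspace W \<Longrightarrow> residual W x = 0 \<longleftrightarrow> x \<in> W"
  using diff_residual[of W x] residual_eq_0[of W x] by auto

lemma residual_cong:
  assumes "subspace W" "x - y \<in> W"
  shows "residual W x = residual W y"
  using residual_eq_0[OF assms] linear_diff[OF linear_residual[OF assms(1)], of x y] by simp

lemma residual_residual:
  assumes "subspace W" "subspace W'" "W \<subseteq> W'"
  shows "residual W' (residual W x) = residual W' x"
proof -
  have "residual W x - x \<in> W'"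
    using diff_residual[OF assms(1), of x] assms(2,3) subspace_neg[of W' "x - residual W x"] by auto
  then show ?thesis by (rule residual_cong[OF assms(2)])
qed

lemma norm_residual_mono:
  assumes "subspace W" "subspace W'" "W \<subseteq> W'"
  shows "norm (residual W' x) \<le> norm (residual W x)"
  using norm_residual_le[OF assms(2), of "residual W x"] residual_residual[OF assms] by simp

lemma residual_in:
  assumes "subspace W" "subspace W'" "W \<subseteq> W'" "x \<in> W'"
  shows "residual W x \<in> W'"
  using diff_residual[OF assms(1), of x] assms subspace_diff[of W' x "x - residual W x"] by auto

lemma continuous_on_residual: "subspace W \<Longrightarrow> continuous_on A (residual W)"
  by (rule linear_continuous_on) (simp add: linear_residual linear_conv_bounded_linear[symmetric])

lemma borel_measurable_residual [measurable]:
  "subspace W \<Longrightarrow> residual W \<in> borel_measurable borel"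
  by (intro borel_measurable_continuous_onI continuous_on_residual)

abbreviation qnorm :: "'a::euclidean_space set \<Rightarrow> 'a \<Rightarrow> real" where
  "qnorm W x \<equiv> norm (residual W x)"

section \<open>Random matrices acting on invariant subspaces\<close>

lemma continuous_on_matrix_vector_mult:
  fixes f :: "'z::topological_space \<Rightarrow> real^'n^'m"
  assumes "continuous_on A f" "continuous_on A h"
  shows "continuous_on A (\<lambda>z. f z *v h z)"
  unfolding matrix_vector_mult_def using assms by (auto intro!: continuous_intros)

lemma continuous_on_matrix_matrix_mult:
  fixes f :: "'z::topological_space \<Rightarrow> real^'n^'m" and h :: "'z \<Rightarrow> real^'k^'n"
  assumes "continuous_on A f" "continuous_on A h"
  shows "continuous_on A (\<lambda>z. f z ** h z)"
  unfolding matrix_matrix_mult_def using assms by (auto intro!: continuous_intros)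

lemma borel_measurable_matrix_vector_mult:
  fixes f :: "'z \<Rightarrow> real^'n^'m"
  assumes "f \<in> borel_measurable N" "h \<in> borel_measurable N"
  shows "(\<lambda>y. f y *v h y) \<in> borel_measurable N"
  by (rule borel_measurable_continuous_Pair[OF assms])
    (intro continuous_on_matrix_vector_mult continuous_intros)

lemma borel_measurable_matrix_matrix_mult:
  fixes f :: "'z \<Rightarrow> real^'n^'m" and h :: "'z \<Rightarrow> real^'k^'n"
  assumes "f \<in> borel_measurable N" "h \<in> borel_measurable N"
  shows "(\<lambda>y. f y ** h y) \<in> borel_measurable N"
  by (rule borel_measurable_continuous_Pair[OF assms])
    (intro continuous_on_matrix_matrix_mult continuous_intros)

lemma left_product_cong: "(\<And>k. k < n \<Longrightarrow> b k = b' k) \<Longrightarrow> left_product b n = left_product b' n"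
  by (induction n) auto

lemma left_product_add: "left_product b (n + k) = left_product (seq_shift n b) k ** left_product b n"
  by (induction k) (auto simp: seq_shift_apply add.commute matrix_mul_assoc)

lemma left_product_case_nat: "left_product (case_nat g b) (Suc n) = left_product b n ** g"
  by (induction n) (auto simp: matrix_mul_assoc)

text \<open>Matrices outside \<open>H\<close> act trivially, so that invariance and domination hold
  for every \<open>g\<close> and not merely almost every one, as \<open>dominated_potential\<close>
  demands. In the applications \<open>H\<close> has full measure, so almost surely the orbit is that
  of the matrix product.\<close>

definition restricted_act :: "(real^'d^'d) set \<Rightarrow> real^'d^'d \<Rightarrow> real^'d \<Rightarrow> real^'d" where
  "restricted_act H g x = (if g \<in> H then g *v x else x)"

lemma orbit_restricted_act:
  "(\<And>k. b k \<in> H) \<Longrightarrow> orbit (restricted_act H) b x n = left_product b n *v x"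
  by (induction n) (auto simp: restricted_act_def matrix_vector_mul_assoc)

lemma continuous_on_orbit_restricted_act: "continuous_on A (\<lambda>y. orbit (restricted_act H) b y n)"
proof (induction n)
  case (Suc n)
  then show ?case
    by (cases "b n \<in> H")
      (auto simp: restricted_act_def[of H "b n"] intro!: continuous_on_matrix_vector_mult continuous_intros)
qed simp

text \<open>The existence of the limit is proved for the Euclidean norm;
  \<open>random_matricesI\<close> hides the comparison with the given norm in
  \<open>L\<close>.\<close>

locale random_matrices = sequence_space \<mu> for \<mu> :: "(real^'d^'d) measure" +
  fixes L :: "real^'d^'d \<Rightarrow> real"
  assumes sets_eq: "sets \<mu> = sets GL_borel"
    and integrable_L: "integrable \<mu> L"
    and norm_le: "invertible g \<Longrightarrow> norm (g *v x) \<le> exp (L g) * norm x"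
    and norm_ge: "invertible g \<Longrightarrow> norm x \<le> exp (L g) * norm (g *v x)"
begin

lemma space_eq: "space \<mu> = {g. invertible g}"
  using sets_eq_imp_space_eq[OF sets_eq] by (simp add: GL_borel_def space_restrict_space)

lemma measurable_ident_borel [measurable]: "(\<lambda>g. g) \<in> borel_measurable \<mu>"
proof -
  have "(\<lambda>g. g) \<in> borel_measurable GL_borel"
    unfolding GL_borel_def by (intro measurable_restrict_space1) simp
  then show ?thesis by (simp cong: measurable_cong_sets add: measurable_cong_sets[OF sets_eq refl])
qed

lemma measurable_coordinate_borel [measurable]: "(\<lambda>b. b k) \<in> borel_measurable S"
  by (rule measurable_compose[OF _ measurable_ident_borel]) simp

lemma measurable_left_product [measurable]: "(\<lambda>b. left_product b n) \<in> borel_measurable S"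
proof (induction n)
  case (Suc n)
  then show ?case
    using borel_measurable_matrix_matrix_mult[OF measurable_coordinate_borel Suc] by simp
qed simp

lemma L_nonneg: assumes "invertible g" shows "0 \<le> L g"
proof -
  obtain x :: "real^'d" where x: "norm x = 1" using vector_choose_size[of 1] by auto
  have "1 \<le> exp (L g) * norm (g *v x)" using norm_ge[OF assms, of x] x by simp
  also have "\<dots> \<le> exp (L g) * (exp (L g) * 1)"
    using norm_le[OF assms, of x] x by (intro mult_left_mono) auto
  also have "\<dots> = exp (2 * L g)" by (simp flip: exp_add)
  finally show ?thesis by simp
qed

lemma AE_all_coordinates:
  assumes "AE g in \<mu>. P g"
  shows "AE b in S. \<forall>k. P (b k)"
  unfolding AE_all_countable using AE_component[OF _ assms] by auto

text \<open>\<open>L (b k)\<close> is the difference of two consecutive partial sums, which by the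
  law of large numbers are linear with the same slope up to a small error.\<close>

lemma AE_L_sublinear: "AE b in S. \<forall>e>0. \<exists>C. \<forall>k. L (b k) \<le> e * real k + C"
  using AE_growth_sum[OF integrable_L]
proof eventually_elim
  case (elim b)
  show ?case
  proof (intro allI impI)
    fix e :: real assume "e > 0"
    let ?l = "\<integral>g. L g \<partial>\<mu>"
    have "e / 2 > 0" using \<open>e > 0\<close> by simp
    then obtain C1 C2 where C: "\<And>n. (\<Sum>k<n. L (b k)) \<le> (?l + e / 2) * real n + C1"
      "\<And>n. - (\<Sum>k<n. L (b k)) \<le> (- ?l + e / 2) * real n + C2"
      using elim unfolding growth_le_def by meson
    have "L (b k) \<le> e * real k + (C1 + C2 + ?l + e / 2)" for k
      using C(1)[of "Suc k"] C(2)[of k] by (simp add: algebra_simps add_divide_distrib)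
    then show "\<exists>C. \<forall>k. L (b k) \<le> e * real k + C" by blast
  qed
qed

lemma dominated_potential_restricted:
  fixes q :: "real^'d \<Rightarrow> real"
  assumes D: "D \<in> sets borel" and H: "H \<in> sets \<mu>"
    and inv: "\<And>g x. g \<in> H \<Longrightarrow> x \<in> D \<Longrightarrow> g *v x \<in> D"
    and q: "q \<in> borel_measurable borel"
    and L': "integrable \<mu> L'" "\<And>g. g \<in> space \<mu> \<Longrightarrow> 0 \<le> L' g"
    and bound: "\<And>g x. g \<in> H \<Longrightarrow> x \<in> D \<Longrightarrow> \<bar>ln (q (g *v x)) - ln (q x)\<bar> \<le> L' g"
  shows "dominated_potential \<mu> (restrict_space borel D) (restricted_act H) (\<lambda>x. ln (q x)) L'"
proof
  note [measurable] = q
  let ?X = "restrict_space borel D"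
  have sp: "space ?X = D" using D by (simp add: space_restrict_space)
  have [measurable]: "(\<lambda>x. x) \<in> borel_measurable ?X" by (intro measurable_restrict_space1) simp
  show "(\<lambda>x. ln (q x)) \<in> borel_measurable ?X" by measurable
  show "integrable \<mu> L'" by fact
  show "\<bar>ln (q (restricted_act H g x)) - ln (q x)\<bar> \<le> L' g" if "g \<in> space \<mu>" "x \<in> space ?X" for g x
    using that bound L'(2) sp by (auto simp: restricted_act_def)
  have "(\<lambda>z. restricted_act H (fst z) (snd z)) \<in> measurable (\<mu> \<Otimes>\<^sub>M ?X) ?X"
  proof (rule measurable_restrict_space2)
    show "(\<lambda>z. restricted_act H (fst z) (snd z)) \<in> space (\<mu> \<Otimes>\<^sub>M ?X) \<rightarrow> D"
      using inv sp by (auto simp: space_pair_measure restricted_act_def)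
    have [measurable]: "Measurable.pred (\<mu> \<Otimes>\<^sub>M ?X) (\<lambda>z. fst z \<in> H)"
      using H by measurable
    have [measurable]: "(\<lambda>z. fst z *v snd z) \<in> borel_measurable (\<mu> \<Otimes>\<^sub>M ?X)"
      by (intro borel_measurable_matrix_vector_mult) measurable
    show "(\<lambda>z. restricted_act H (fst z) (snd z)) \<in> borel_measurable (\<mu> \<Otimes>\<^sub>M ?X)"
      unfolding restricted_act_def by measurable
  qed
  then show "(\<lambda>(g, x). restricted_act H g x) \<in> measurable (\<mu> \<Otimes>\<^sub>M ?X) ?X"
    by (simp add: case_prod_unfold)
qed

definition stable :: "(real^'d) set \<Rightarrow> bool" where
  "stable W \<longleftrightarrow> subspace W \<and> (AE g in \<mu>. \<forall>w\<in>W. g *v w \<in> W)"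

definition stabiliser :: "(real^'d) set \<Rightarrow> (real^'d^'d) set" where
  "stabiliser W = {g. invertible g \<and> (\<forall>w\<in>W. g *v w \<in> W)}"

lemma sets_stabiliser [measurable]:
  assumes "subspace W" shows "stabiliser W \<in> sets \<mu>"
proof -
  have "closed {g :: real^'d^'d. \<forall>w\<in>W. g *v w \<in> W}"
  proof -
    have "closed ((\<lambda>g :: real^'d^'d. g *v w) -` W)" for w
      by (intro closed_vimage closed_subspace assms continuous_on_matrix_vector_mult continuous_intros)
    moreover have "{g :: real^'d^'d. \<forall>w\<in>W. g *v w \<in> W} = (\<Inter>w\<in>W. (\<lambda>g. g *v w) -` W)" by auto
    ultimately show ?thesis by auto
  qed
  then have "{g :: real^'d^'d. \<forall>w\<in>W. g *v w \<in> W} \<in> sets borel" by (rule borel_closed)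
  then have "{g :: real^'d^'d. \<forall>w\<in>W. g *v w \<in> W} \<inter> space \<mu> \<in> sets \<mu>"
    using measurable_sets[OF measurable_ident_borel] by fastforce
  moreover have "stabiliser W = {g :: real^'d^'d. \<forall>w\<in>W. g *v w \<in> W} \<inter> space \<mu>"
    by (auto simp: stabiliser_def space_eq)
  ultimately show ?thesis by simp
qed

lemma AE_stabiliser: "stable W \<Longrightarrow> AE g in \<mu>. g \<in> stabiliser W"
  unfolding stable_def stabiliser_def using AE_space[of \<mu>] by (auto simp: space_eq elim: AE_mp)

lemma AE_seq_stabiliser: "stable W \<Longrightarrow> AE b in S. \<forall>k. b k \<in> stabiliser W"
  by (intro AE_all_coordinates AE_stabiliser)

lemma stabiliser_image:
  assumes "subspace W" "g \<in> stabiliser W"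
  shows "(*v) g ` W = W"
proof (rule subspace_dim_equal)
  have inj: "inj ((*v) g)" using assms(2) by (simp add: stabiliser_def invertible_left_inverse matrix_left_invertible_injective)
  show "subspace ((*v) g ` W)" using assms(1) by (intro linear_subspace_image) auto
  show "(*v) g ` W \<subseteq> W" using assms(2) by (auto simp: stabiliser_def)
  have "dim ((*v) g ` W) = dim W"
    using inj by (intro dim_image_eq) (auto intro: inj_on_subset)
  then show "dim W \<le> dim ((*v) g ` W)" by simp
qed fact

lemma stabiliser_in_iff:
  assumes "subspace W" "g \<in> stabiliser W"
  shows "g *v x \<in> W \<longleftrightarrow> x \<in> W"
proof
  assume "g *v x \<in> W"
  then obtain w where "w \<in> W" "g *v x = g *v w" using stabiliser_image[OF assms] by (metis imageE)
  moreover have "inj ((*v) g)" using assms(2) by (simp add: stabiliser_def invertible_left_inverse matrix_left_invertible_injective)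
  ultimately show "x \<in> W" by (auto dest: injD)
qed (use assms(2) in \<open>auto simp: stabiliser_def\<close>)

lemma stabiliser_residual:
  assumes "subspace W" "g \<in> stabiliser W"
  shows "residual W (g *v residual W x) = residual W (g *v x)"
proof (rule residual_cong[OF assms(1)])
  have "- (x - residual W x) \<in> W" using diff_residual[OF assms(1)] subspace_neg[OF assms(1)] by blast
  then have "g *v (residual W x - x) \<in> W" using assms(2) by (simp add: stabiliser_def)
  then show "g *v residual W x - g *v x \<in> W" by (simp add: matrix_vector_mult_diff_distrib)
qed

lemma norm_residual_act_le:
  assumes "subspace W" "g \<in> stabiliser W"
  shows "qnorm W (g *v x) \<le> exp (L g) * qnorm W x"
proof -
  have "qnorm W (g *v residual W x) \<le> norm (g *v residual W x)"
    by (rule norm_residual_le[OF assms(1)])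
  also have "\<dots> \<le> exp (L g) * qnorm W x"
    using assms(2) by (intro norm_le) (simp add: stabiliser_def)
  finally show ?thesis by (simp add: stabiliser_residual[OF assms])
qed

text \<open>As \<open>g\<close> maps \<open>W\<close> onto itself, the residual of the image of
  \<open>x\<close> is the image of some \<open>x - w\<close> with \<open>w\<close> in
  \<open>W\<close>, and \<open>norm_ge\<close> applies to \<open>x - w\<close>.\<close>

lemma norm_residual_act_ge:
  assumes "subspace W" "g \<in> stabiliser W"
  shows "qnorm W x \<le> exp (L g) * qnorm W (g *v x)"
proof -
  have g: "invertible g" using assms(2) by (simp add: stabiliser_def)
  have "g *v x - residual W (g *v x) \<in> W" by (rule diff_residual[OF assms(1)])
  then obtain w where w: "w \<in> W" "g *v x - residual W (g *v x) = g *v w"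
    using stabiliser_image[OF assms] by (metis imageE)
  then have *: "g *v (x - w) = residual W (g *v x)" by (simp add: matrix_vector_mult_diff_distrib algebra_simps)
  have "residual W x = residual W (x - w)" using w(1) by (intro residual_cong[OF assms(1)]) simp
  then have "qnorm W x \<le> norm (x - w)" using norm_residual_le[OF assms(1), of "x - w"] by simp
  also have "\<dots> \<le> exp (L g) * norm (g *v (x - w))" by (rule norm_ge[OF g])
  finally show ?thesis by (simp add: *)
qed

lemma stabiliser_left_product:
  assumes "subspace W" "\<And>k. b k \<in> stabiliser W"
  shows "left_product b n \<in> stabiliser W"
proof (induction n)
  case 0 show ?case by (auto simp: stabiliser_def invertible_def intro: exI[of _ "mat 1"])
next
  case (Suc n)
  then show ?case using assms(2)[of n]
    by (auto simp: stabiliser_def invertible_mult matrix_vector_mul_assoc[symmetric])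
qed

end

section \<open>Exponential scales and subadditive arrays\<close>

lemma eventually_exp_absorb:
  assumes r: "strict_mono (r :: nat \<Rightarrow> nat)" and "d' < d"
  shows "\<forall>\<^sub>F k in sequentially. C * exp (d' * real (r k)) \<le> exp (d * real (r k))"
proof -
  have "\<forall>\<^sub>F k in sequentially. ln (max 1 C) / (d - d') \<le> real (r k)"
    using filterlim_compose[OF filterlim_real_sequentially filterlim_subseq[OF r]]
    by (simp add: filterlim_at_top)
  then show ?thesis
  proof eventually_elim
    case (elim k)
    then have "ln (max 1 C) \<le> (d - d') * real (r k)" using \<open>d' < d\<close> by (simp add: field_simps)
    then have "exp (ln (max 1 C)) \<le> exp ((d - d') * real (r k))" by (simp only: exp_le_cancel_iff)
    moreover have "exp (ln (max 1 C)) = max 1 C" by (rule exp_ln) simp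
    ultimately have "max 1 C \<le> exp ((d - d') * real (r k))" by linarith
    then have "C * exp (d' * real (r k)) \<le> exp ((d - d') * real (r k)) * exp (d' * real (r k))"
      by (intro mult_right_mono) auto
    then show ?case by (simp add: algebra_simps flip: exp_add)
  qed
qed

text \<open>Both endpoints contribute an error proportional to their own time, hence the error is
  proportional to \<open>n\<close> and not to \<open>n - k\<close>.\<close>

lemma growth_le_difference:
  assumes "growth_le s c" "growth_le (\<lambda>n. - s n) (- c)" "e > 0"
  shows "\<exists>C. \<forall>k n. k \<le> n \<longrightarrow> s n - s k \<le> c * real (n - k) + e * real n + C"
proof -
  have "e / 2 > 0" using assms(3) by simp
  then obtain C1 C2 where C: "\<And>n. s n \<le> (c + e / 2) * real n + C1" "\<And>n. - s n \<le> (- c + e / 2) * real n + C2"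
    using assms unfolding growth_le_def by meson
  have "s n - s k \<le> c * real (n - k) + e * real n + (C1 + C2)" if "k \<le> n" for k n
  proof -
    have "e / 2 * real k \<le> e / 2 * real n" using that assms(3) by (intro mult_left_mono) auto
    then show ?thesis using C(1)[of n] C(2)[of k] that by (simp add: of_nat_diff algebra_simps)
  qed
  then show ?thesis by blast
qed

text \<open>For each offset \<open>l < p\<close> the interval from \<open>k\<close> to
  \<open>n\<close> can be cut into a head of length \<open>l\<close>, blocks of length
  \<open>p\<close> and a tail; summed over the offsets, every block from \<open>i\<close> to
  \<open>i + p\<close> occurs once. The proof obtains this sum by sliding a window of
  \<open>p\<close> starting points to the right, one step at a time.\<close>

lemma subadditive_averaging:
  fixes a :: "nat \<Rightarrow> nat \<Rightarrow> real"
  assumes sub: "\<And>k j n. k \<le> j \<Longrightarrow> j \<le> n \<Longrightarrow> a k n \<le> a k j + a j n"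
    and "k + p \<le> n"
  shows "real p * a k n \<le> (\<Sum>l<p. a k (k + l)) + (\<Sum>i=k..<n-p. a i (i + p)) + (\<Sum>l<p. a (n - p + l) n)"
proof -
  define v where "v k = (\<Sum>l<p. a (k + l) n)" for k
  have "v k \<le> (\<Sum>i=k..<n-p. a i (i + p)) + v (n - p)"
  proof -
    have "k \<le> n - p" using assms(2) by simp
    then show ?thesis
    proof (induction rule: inc_induct)
      case (step k)
      have "v k + a (k + p) n = v (Suc k) + a k n"
        unfolding v_def using sum.lessThan_Suc_shift[of "\<lambda>l. a (k + l) n" p] by simp
      moreover have "a k n \<le> a k (k + p) + a (k + p) n" using step.hyps by (intro sub) auto
      ultimately have "v k \<le> a k (k + p) + v (Suc k)" by linarith
      then show ?case using step by (simp add: sum.atLeast_Suc_lessThan)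
    qed simp
  qed
  moreover have "real p * a k n \<le> (\<Sum>l<p. a k (k + l)) + v k"
  proof -
    have "(\<Sum>l<p. a k n) \<le> (\<Sum>l<p. a k (k + l) + a (k + l) n)"
      using assms(2) by (intro sum_mono sub) auto
    then show ?thesis by (simp add: v_def sum.distrib)
  qed
  ultimately show ?thesis unfolding v_def by linarith
qed

text \<open>The blocks of \<open>subadditive_averaging\<close> add up to a telescoping sum of
  \<open>B\<close>, while \<open>A\<close> controls heads and tails, whose length is at most
  \<open>p\<close>. Of the \<open>4 * e\<close>, two come from heads and tails, one from
  \<open>B\<close> and one from \<open>m' <= m + e\<close>.\<close>

lemma subadditive_two_parameter_bound:
  fixes a :: "nat \<Rightarrow> nat \<Rightarrow> real"
  assumes sub: "\<And>k j n. k \<le> j \<Longrightarrow> j \<le> n \<Longrightarrow> a k n \<le> a k j + a j n"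
    and p: "p \<ge> 1"
    and A: "\<And>k n. k \<le> n \<Longrightarrow> a k n \<le> C0 + (A n - A k)" "growth_le A l" "growth_le (\<lambda>n. - A n) (- l)"
    and B: "\<And>i. a i (i + p) = real p * (B (Suc i) - B i)" "growth_le B m'" "growth_le (\<lambda>n. - B n) (- m')"
    and m: "m' \<le> m + e" and e: "e > 0"
  shows "\<exists>C. \<forall>k n. k \<le> n \<longrightarrow> a k n \<le> m * real (n - k) + 4 * e * real n + C"
proof -
  obtain CA where CA: "\<And>k n. k \<le> n \<Longrightarrow> A n - A k \<le> l * real (n - k) + e * real n + CA"
    using growth_le_difference[OF A(2,3) e] by blast
  obtain CB where CB: "\<And>k n. k \<le> n \<Longrightarrow> B n - B k \<le> m' * real (n - k) + e * real n + CB"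
    using growth_le_difference[OF B(2,3) e] by blast
  define C1 where "C1 = C0 + \<bar>l\<bar> * real p + CA"
  have short: "a k j \<le> C1 + e * real n" if "k \<le> j" "j \<le> n" "j - k \<le> p" for k j n
  proof -
    have "l * real (j - k) \<le> \<bar>l\<bar> * real p" using that(3) by (intro mult_mono) auto
    moreover have "e * real j \<le> e * real n" using that(2) e by (intro mult_left_mono) auto
    ultimately show ?thesis using A(1)[OF that(1)] CA[OF that(1)] unfolding C1_def by linarith
  qed
  define C where "C = 2 * \<bar>C1\<bar> + \<bar>CB\<bar> + 2 * \<bar>m\<bar> * real p"
  have "a k n \<le> m * real (n - k) + 4 * e * real n + C" if kn: "k \<le> n" for k n
  proof (cases "k + p \<le> n")
    case False
    have "- (\<bar>m\<bar> * real p) \<le> m * real (n - k)"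
    proof -
      have "\<bar>m * real (n - k)\<bar> \<le> \<bar>m\<bar> * real p" using False unfolding abs_mult by (intro mult_mono) auto
      then show ?thesis by linarith
    qed
    moreover have "a k n \<le> C1 + e * real n" using False kn by (intro short) auto
    moreover have "e * real n \<le> 4 * e * real n" using e by simp
    moreover have "\<bar>m\<bar> * real p \<ge> 0" by simp
    ultimately show ?thesis unfolding C_def by linarith
  next
    case True
    have "(\<Sum>l<p. a k (k + l)) \<le> (\<Sum>l<p. C1 + e * real n)"
      using True by (intro sum_mono short) auto
    moreover have "(\<Sum>l<p. a (n - p + l) n) \<le> (\<Sum>l<p. C1 + e * real n)"
      using True by (intro sum_mono short) auto
    moreover have "(\<Sum>i=k..<n-p. a i (i + p)) = real p * (B (n - p) - B k)"
      using True by (simp add: B(1) sum_distrib_left[symmetric] sum_Suc_diff')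
    ultimately have "real p * a k n \<le> real p * (2 * (C1 + e * real n) + (B (n - p) - B k))"
      using subadditive_averaging[of a, OF sub True] by (simp add: algebra_simps)
    then have i1: "a k n \<le> 2 * (C1 + e * real n) + (B (n - p) - B k)" using p by simp
    have i2: "B (n - p) - B k \<le> m' * real (n - p - k) + e * real (n - p) + CB"
      using True by (intro CB) auto
    have i3: "m' * real (n - p - k) \<le> (m + e) * real (n - p - k)"
      using m by (intro mult_right_mono) auto
    have i4: "(m + e) * real (n - p - k) \<le> m * real (n - k) + \<bar>m\<bar> * real p + e * real n - e * real p"
    proof -
      have "real (n - p - k) = real (n - k) - real p" using True by (simp add: of_nat_diff)
      then have "(m + e) * real (n - p - k)
          = m * real (n - k) + e * real (n - k) - m * real p - e * real p"
        by (simp only:) (simp add: algebra_simps)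
      moreover have "- (m * real p) \<le> \<bar>m\<bar> * real p"
        using abs_ge_minus_self[of "m * real p"] by (simp add: abs_mult)
      moreover have "e * real (n - k) \<le> e * real n" using e by (intro mult_left_mono) auto
      ultimately show ?thesis by linarith
    qed
    have i5: "e * real (n - p) \<le> e * real n" using e by (intro mult_left_mono) auto
    \<comment> \<open>Only linear arithmetic with absolute values remains once the products are
      generalised to variables.\<close>
    have key: "a' \<le> mk + 4 * y + (2 * \<bar>c1\<bar> + \<bar>cb\<bar> + 2 * M)"
      if "a' \<le> 2 * (c1 + y) + D" "D \<le> z + w + cb" "z \<le> z'" "z' \<le> mk + M + y - ep" "w \<le> y" "0 \<le> M" "0 \<le> ep"
      for a' c1 y D z w cb z' mk M ep :: real
      using that abs_ge_self[of c1] abs_ge_self[of cb] by argo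
    have "a k n \<le> m * real (n - k) + 4 * (e * real n) + (2 * \<bar>C1\<bar> + \<bar>CB\<bar> + 2 * (\<bar>m\<bar> * real p))"
      by (rule key[OF i1 i2 i3 i4 i5]) (use e in auto)
    then show ?thesis by (simp add: C_def mult.assoc)
  qed
  then show ?thesis by blast
qed

section \<open>Slow vectors modulo an invariant subspace\<close>

abbreviation rate :: "(real^'d \<Rightarrow> real) \<Rightarrow> (nat \<Rightarrow> real^'d^'d) \<Rightarrow> real^'d \<Rightarrow> nat \<Rightarrow> real" where
  "rate N b x n \<equiv> 1 / real n * ln (N (left_product b n *v x))"

abbreviation log_qnorm :: "(real^'d) set \<Rightarrow> (nat \<Rightarrow> real^'d^'d) \<Rightarrow> real^'d \<Rightarrow> nat \<Rightarrow> real" where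
  "log_qnorm W b x n \<equiv> ln (qnorm W (left_product b n *v x))"

text \<open>The multiplicative form stays meaningful when the quotient norm vanishes, that is, for
  orbits in \<open>W\<close>, where the value of \<open>ln\<close> at 0 carries no
  information.\<close>

abbreviation slow_path :: "(real^'d) set \<Rightarrow> real \<Rightarrow> (nat \<Rightarrow> nat) \<Rightarrow> (nat \<Rightarrow> real^'d^'d) \<Rightarrow> real^'d \<Rightarrow> bool" where
  "slow_path W m r b w \<equiv> \<forall>d>m. \<forall>\<^sub>F k in sequentially.
     qnorm W (left_product b (r k) *v w) \<le> exp (d * real (r k))"

text \<open>The product runs over the factors \<open>k, ..., n - 1\<close>. The error is measured at
  the final time \<open>n\<close>, which is harmless in variation of constants because all summands
  there have the same final time.\<close>

abbreviation fibre_bound :: "(real^'d) set \<Rightarrow> (real^'d) set \<Rightarrow> real \<Rightarrow> (nat \<Rightarrow> real^'d^'d) \<Rightarrow> real \<Rightarrow> bool" where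
  "fibre_bound W W' m b e \<equiv> \<exists>C. \<forall>k n. k \<le> n \<longrightarrow> (\<forall>w\<in>W'.
     qnorm W (left_product (seq_shift k b) (n - k) *v w)
       \<le> exp (m * real (n - k) + e * real n + C) * qnorm W w)"

lemma slow_pathI:
  assumes r: "strict_mono r"
    and le: "\<And>d. d > m \<Longrightarrow> \<forall>\<^sub>F k in sequentially. qnorm W (left_product b (r k) *v w) \<le> C * exp (d * real (r k))"
  shows "slow_path W m r b w"
proof (intro allI impI)
  fix d assume "d > m"
  then obtain d' where d': "m < d'" "d' < d" using dense by blast
  show "\<forall>\<^sub>F k in sequentially. qnorm W (left_product b (r k) *v w) \<le> exp (d * real (r k))"
    using le[OF d'(1)] eventually_exp_absorb[OF r d'(2), of C] by eventually_elim linarith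
qed

context random_matrices
begin

text \<open>The potential is the logarithm of the quotient norm on the complement of
  \<open>W\<close>. This complement is not compact, but the increments depend only on the line of
  \<open>x\<close> modulo \<open>W\<close>, and the set \<open>K\<close> below, the unit sphere of
  the quotient, meets all these lines.\<close>

lemma minimal_growth_quotient:
  assumes st: "stable W" and ne: "W \<noteq> UNIV"
  obtains m x and r :: "nat \<Rightarrow> nat" where "x \<notin> W" "strict_mono r"
    "\<And>y. y \<notin> W \<Longrightarrow> AE b in S. growth_le (\<lambda>n. - log_qnorm W b y n) (- m)"
    "AE b in S. slow_path W m r b x"
proof -
  have W: "subspace W" using st by (simp add: stable_def)
  define H where "H = stabiliser W"
  define q where "q x = qnorm W x" for x
  have q_pos: "q x > 0 \<longleftrightarrow> x \<notin> W" for x by (simp add: q_def residual_eq_0_iff[OF W])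
  have [measurable]: "residual W \<in> borel_measurable borel" by (rule borel_measurable_residual[OF W])
  have D: "- W \<in> sets borel" using closed_subspace[OF W] by auto
  have inv: "g *v x \<in> - W" if "g \<in> H" "x \<in> - W" for g x
    using stabiliser_in_iff[OF W, of g x] that by (simp add: H_def)
  interpret dp: dominated_potential \<mu> "restrict_space borel (- W)" "restricted_act H" "\<lambda>x. ln (q x)" L
  proof (rule dominated_potential_restricted[OF D _ inv _ integrable_L])
    show "H \<in> sets \<mu>" unfolding H_def using W by measurable
    show "q \<in> borel_measurable borel" unfolding q_def by measurable
    show "\<And>g. g \<in> space \<mu> \<Longrightarrow> 0 \<le> L g" using L_nonneg by (simp add: space_eq)
    fix g x assume g: "g \<in> H" and x: "x \<in> - W"
    have pos: "q x > 0" "q (g *v x) > 0" using x inv[OF g x] q_pos by auto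
    have "ln (q (g *v x)) \<le> ln (exp (L g) * q x)"
      using norm_residual_act_le[OF W, of g x] g pos by (intro ln_mono) (auto simp: q_def H_def)
    moreover have "ln (q x) \<le> ln (exp (L g) * q (g *v x))"
      using norm_residual_act_ge[OF W, of g x] g pos by (intro ln_mono) (auto simp: q_def H_def)
    ultimately show "\<bar>ln (q (g *v x)) - ln (q x)\<bar> \<le> L g" using pos by (simp add: ln_mult)
  qed
  have sp: "space (restrict_space borel (- W)) = - W" using D by (simp add: space_restrict_space)
  define K where "K = {y. norm y = 1 \<and> residual W y = y}"
  have "compact K"
  proof -
    have "closed {y. residual W y = y}"
      by (intro closed_Collect_eq continuous_on_residual[OF W] continuous_intros)
    moreover have "K = sphere 0 1 \<inter> {y. residual W y = y}" by (auto simp: K_def)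
    ultimately show ?thesis by (auto intro: compact_Int_closed)
  qed
  have K_notin: "y \<notin> W" if "y \<in> K" for y
    using that residual_eq_0[OF W, of y] by (auto simp: K_def)
  \<comment> \<open>Normalising \<open>x\<close> multiplies it by a scalar and moves it by an
    element of \<open>W\<close>; this relation persists along the orbit because \<open>H\<close>
    stabilises \<open>W\<close>.\<close>
  have orbit_scale: "c *\<^sub>R orbit (restricted_act H) b x n - orbit (restricted_act H) b y n \<in> W"
    if "c *\<^sub>R x - y \<in> W" for b x y c n
  proof (induction n)
    case (Suc n)
    let ?o = "\<lambda>x. orbit (restricted_act H) b x n"
    have "b n *v (c *\<^sub>R ?o x - ?o y) \<in> W" if "b n \<in> H"
      using that Suc by (auto simp: H_def stabiliser_def)
    then show ?case using Suc
      by (cases "b n \<in> H") (simp_all add: restricted_act_def[of H "b n"]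
          matrix_vector_mult_diff_distrib matrix_vector_mult_scaleR)
  qed (use that in simp)
  obtain m x where mx: "x \<in> - W" "\<And>n. n \<ge> 1 \<Longrightarrow> dp.drift n x \<le> m * real n"
    "\<And>y. y \<in> - W \<Longrightarrow> AE b in S. growth_le (\<lambda>n. - (ln (q (orbit (restricted_act H) b y n)) - ln (q y))) (- m)"
  proof (rule dp.ex_minimal_growth[where K=K and \<iota>="\<lambda>y. y", unfolded sp])
    show "compact K" by fact
    show K_sub: "\<And>y. y \<in> K \<Longrightarrow> y \<in> - W" using K_notin by simp
    show "continuous_on K (\<lambda>y. dp.drift n y)" for n
    proof (rule dp.continuous_on_drift)
      fix b assume b: "b \<in> space S"
      have "q (orbit (restricted_act H) b y n) \<noteq> 0" if "y \<in> K" for y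
        using dp.orbit_in_space[OF b, of y n] sp K_sub[OF that] q_pos[of "orbit (restricted_act H) b y n"] by auto
      moreover have "q y \<noteq> 0" if "y \<in> K" for y
        using K_sub[OF that] q_pos[of y] by auto
      moreover have "continuous_on K (\<lambda>y. residual W (orbit (restricted_act H) b y n))"
        by (rule continuous_on_compose2[OF continuous_on_residual[OF W] continuous_on_orbit_restricted_act]) auto
      ultimately show "continuous_on K (\<lambda>y. ln (q (orbit (restricted_act H) b y n)) - ln (q y))"
        unfolding q_def by (intro continuous_intros continuous_on_residual[OF W]) auto
    qed (use K_sub sp in auto)
    show "\<exists>y\<in>K. \<forall>n. dp.drift n y = dp.drift n x" if x: "x \<in> - W" for x
    proof -
      define c where "c = 1 / q x"
      have qx: "q x > 0" using x q_pos by simp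
      define y where "y = c *\<^sub>R residual W x"
      have "y \<in> K"
        using qx residual_residual[OF W W order_refl, of x]
        by (simp add: K_def y_def c_def linear_scale[OF linear_residual[OF W]] q_def)
      moreover have "dp.drift n y = dp.drift n x" for n
        unfolding dp.drift_def
      proof (rule Bochner_Integration.integral_cong[OF refl])
        fix b assume b: "b \<in> space S"
        let ?o = "\<lambda>x. orbit (restricted_act H) b x n"
        have "c *\<^sub>R x - y \<in> W"
          using subspace_scale[OF W diff_residual[OF W, of x], of c] by (simp add: y_def scaleR_diff_right)
        from residual_cong[OF W orbit_scale[OF this, of b n]]
        have "residual W (?o y) = c *\<^sub>R residual W (?o x)"
          by (simp add: linear_scale[OF linear_residual[OF W]])
        then have "q (?o y) = c * q (?o x)" using qx by (simp add: q_def c_def)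
        moreover have "q y = 1" using \<open>y \<in> K\<close> by (simp add: q_def K_def)
        moreover have "q (?o x) > 0" using dp.orbit_in_space[OF b, of x n] sp x q_pos by simp
        ultimately show "ln (q (?o y)) - ln (q y) = ln (q (?o x)) - ln (q x)"
          using qx by (simp add: c_def ln_div)
      qed
      ultimately show ?thesis by blast
    qed
    show "- W \<noteq> {}" using ne by auto
  qed blast
  obtain r :: "nat \<Rightarrow> nat" where r: "strict_mono r"
    "AE b in S. (\<lambda>k. (ln (q (orbit (restricted_act H) b x (r k))) - ln (q x)) / real (r k)) \<longlonglongrightarrow> m"
    using dp.ex_subseq_orbit_tendsto[unfolded sp, OF mx(1) mx(3)[OF mx(1)] mx(2)] by blast
  have ae: "AE b in S. \<forall>k. b k \<in> H" unfolding H_def by (rule AE_seq_stabiliser[OF st])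
  show ?thesis
  proof (rule that)
    show "x \<notin> W" "strict_mono r" using mx(1) r(1) by auto
  next
    fix y assume y: "y \<notin> W"
    from mx(3)[of y] y have "AE b in S. growth_le (\<lambda>n. - (ln (q (orbit (restricted_act H) b y n)) - ln (q y))) (- m)" by simp
    then show "AE b in S. growth_le (\<lambda>n. - log_qnorm W b y n) (- m)"
      using ae
    proof eventually_elim
      case (elim b)
      then have o: "orbit (restricted_act H) b y n = left_product b n *v y" for n
        by (intro orbit_restricted_act) auto
      show ?case
        by (rule growth_le_mono[OF elim(1), of _ "- ln (q y)"]) (simp add: o q_def)
    qed
  next
    show "AE b in S. slow_path W m r b x"
      using r(2) ae
    proof eventually_elim
      case (elim b)
      have o: "orbit (restricted_act H) b x n = left_product b n *v x" for n
        using elim(2) by (intro orbit_restricted_act) auto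
      show ?case
      \<comment> \<open>The factor \<open>q x\<close> undoes the subtraction of
        \<open>ln (q x)\<close> in the increments.\<close>
      proof (rule slow_pathI[OF r(1), where C="q x"])
        fix d assume "d > m"
        have "\<forall>\<^sub>F k in sequentially. (ln (q (left_product b (r k) *v x)) - ln (q x)) / real (r k) < d"
          using order_tendstoD(2)[OF elim(1) \<open>d > m\<close>] by (simp add: o)
        with eventually_subseq_pos[OF r(1)]
        show "\<forall>\<^sub>F k in sequentially. qnorm W (left_product b (r k) *v x) \<le> q x * exp (d * real (r k))"
        proof eventually_elim
          case (elim k)
          have "left_product b (r k) *v x \<notin> W"
            using stabiliser_in_iff[OF W stabiliser_left_product[OF W, of b "r k"], of x] \<open>\<forall>k. b k \<in> H\<close> mx(1)
            by (simp add: H_def)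
          then have pos: "q (left_product b (r k) *v x) > 0" "q x > 0" using q_pos mx(1) by auto
          have "ln (q (left_product b (r k) *v x)) \<le> ln (q x) + d * real (r k)"
            using elim by (simp add: field_simps)
          then have "exp (ln (q (left_product b (r k) *v x))) \<le> exp (ln (q x) + d * real (r k))" by simp
          also have "\<dots> = q x * exp (d * real (r k))" using pos by (simp add: exp_add)
          finally show ?case using pos by (simp add: q_def)
        qed
      qed
    qed
  qed
qed

definition slow :: "(real^'d) set \<Rightarrow> real \<Rightarrow> (nat \<Rightarrow> nat) \<Rightarrow> (real^'d) set" where
  "slow W m r = {w. AE b in S. slow_path W m r b w}"

lemma subspace_slow:
  assumes W: "subspace W" and r: "strict_mono r"
  shows "subspace (slow W m r)"
proof (rule subspaceI)
  note lin = linear_residual[OF W]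
  show "0 \<in> slow W m r" by (simp add: slow_def linear_0[OF lin])
  show "x + y \<in> slow W m r" if "x \<in> slow W m r" "y \<in> slow W m r" for x y
  proof -
    from that have "AE b in S. slow_path W m r b x" "AE b in S. slow_path W m r b y"
      by (auto simp: slow_def)
    then have "AE b in S. slow_path W m r b (x + y)"
    proof eventually_elim
      case (elim b)
      show ?case
      proof (rule slow_pathI[OF r, where C=2])
        fix d assume "d > m"
        with elim have "\<forall>\<^sub>F k in sequentially. qnorm W (left_product b (r k) *v x) \<le> exp (d * real (r k))"
          "\<forall>\<^sub>F k in sequentially. qnorm W (left_product b (r k) *v y) \<le> exp (d * real (r k))" by auto
        then show "\<forall>\<^sub>F k in sequentially. qnorm W (left_product b (r k) *v (x + y)) \<le> 2 * exp (d * real (r k))"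
        proof eventually_elim
          case (elim k)
          have "qnorm W (left_product b (r k) *v (x + y))
            \<le> qnorm W (left_product b (r k) *v x) + qnorm W (left_product b (r k) *v y)"
            by (simp add: matrix_vector_right_distrib linear_add[OF lin] norm_triangle_ineq)
          then show ?case using elim by linarith
        qed
      qed
    qed
    then show ?thesis by (simp add: slow_def)
  qed
  show "c *\<^sub>R x \<in> slow W m r" if "x \<in> slow W m r" for c x
  proof -
    from that have "AE b in S. slow_path W m r b x" by (simp add: slow_def)
    then have "AE b in S. slow_path W m r b (c *\<^sub>R x)"
    proof eventually_elim
      case (elim b)
      show ?case
      proof (rule slow_pathI[OF r, where C="\<bar>c\<bar>"])
        fix d assume "d > m"
        with elim have "\<forall>\<^sub>F k in sequentially. qnorm W (left_product b (r k) *v x) \<le> exp (d * real (r k))" by auto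
        then show "\<forall>\<^sub>F k in sequentially. qnorm W (left_product b (r k) *v (c *\<^sub>R x)) \<le> \<bar>c\<bar> * exp (d * real (r k))"
          by eventually_elim (simp add: matrix_vector_mult_scaleR linear_scale[OF lin] mult_left_mono)
      qed
    qed
    then show ?thesis by (simp add: slow_def)
  qed
qed

lemma slow_supset:
  assumes st: "stable W"
  shows "W \<subseteq> slow W m r"
proof
  fix w assume w: "w \<in> W"
  have W: "subspace W" using st by (simp add: stable_def)
  from AE_seq_stabiliser[OF st]
  have "AE b in S. slow_path W m r b w"
  proof eventually_elim
    case (elim b)
    have "left_product b n *v w \<in> W" for n
      using stabiliser_left_product[OF W, of b n] elim w by (auto simp: stabiliser_def)
    then show ?case by (simp add: residual_eq_0[OF W])
  qed
  then show "w \<in> slow W m r" by (simp add: slow_def)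
qed

text \<open>Prepending an independent matrix reproduces the law \<open>S\<close>, so almost sure
  properties pass to \<open>g\<close> followed by \<open>b\<close>.\<close>

lemma AE_case_nat:
  assumes "AE b in S. P b"
  shows "AE g in \<mu>. AE b in S. P (case_nat g b)"
proof -
  have "AE b in distr (\<mu> \<Otimes>\<^sub>M S) S (\<lambda>(g, b). case_nat g b). P b" using assms unfolding PiM_iter .
  then have "AE z in \<mu> \<Otimes>\<^sub>M S. P (case z of (g, b) \<Rightarrow> case_nat g b)" by (rule AE_distrD[rotated]) measurable
  interpret MS: pair_prob_space \<mu> S ..
  from MS.AE_pair[OF \<open>AE z in \<mu> \<Otimes>\<^sub>M S. P (case z of (g, b) \<Rightarrow> case_nat g b)\<close>]
  show ?thesis by simp
qed

text \<open>The orbit of \<open>g *v w\<close> under \<open>b\<close> is the orbit of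
  \<open>w\<close> under \<open>g\<close> followed by \<open>b\<close>, one step ahead, while
  slowness is known at the times \<open>r k\<close> only. The additional last factor costs
  \<open>exp (L (b n))\<close>, which is almost surely subexponential in \<open>r k\<close>.\<close>

lemma stable_slow:
  assumes st: "stable W" and r: "strict_mono r"
  shows "stable (slow W m r)"
proof -
  have W: "subspace W" using st by (simp add: stable_def)
  let ?V = "slow W m r"
  have V: "subspace ?V" by (rule subspace_slow[OF W r])
  have one: "AE g in \<mu>. g *v w \<in> ?V" if w: "w \<in> ?V" for w
  proof -
    have "AE b in S. (slow_path W m r b w)
      \<and> (\<forall>k. b k \<in> stabiliser W) \<and> (\<forall>e>0. \<exists>C. \<forall>k. L (b k) \<le> e * real k + C)"
      using w AE_seq_stabiliser[OF st] AE_L_sublinear by (auto simp: slow_def)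
    from AE_case_nat[OF this] show ?thesis
    proof eventually_elim
      case (elim g)
      then have "AE b in S. slow_path W m r b (g *v w)"
      proof eventually_elim
        case (elim b)
        then have stab: "\<forall>k. case_nat g b k \<in> stabiliser W" by blast
        show ?case
        proof (intro allI impI)
          fix d assume "d > m"
          then obtain d' where d': "m < d'" "d' < d" using dense by blast
          define e where "e = (d - d') / 2"
          have e: "e > 0" "d' + e < d" using d' by (auto simp: e_def field_simps)
          obtain C where C: "\<And>k. L (case_nat g b k) \<le> e * real k + C" using elim e by blast
          have "\<forall>\<^sub>F k in sequentially. qnorm W (left_product (case_nat g b) (r k) *v w) \<le> exp (d' * real (r k))"
            using elim d' by blast
          moreover note eventually_subseq_pos[OF r]
          moreover note eventually_exp_absorb[OF r e(2), of "exp C"]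
          ultimately show "\<forall>\<^sub>F k in sequentially. qnorm W (left_product b (r k) *v (g *v w)) \<le> exp (d * real (r k))"
          proof eventually_elim
            case (elim k)
            then obtain n where n: "r k = Suc n" by (cases "r k") auto
            have "case_nat g b (Suc n) \<in> stabiliser W" using stab by blast
            then have bn: "b n \<in> stabiliser W" "L (b n) \<le> e * real (r k) + C"
              using C[of "Suc n"] by (auto simp: n)
            have "qnorm W (left_product b (r k) *v (g *v w))
              \<le> exp (L (b n)) * qnorm W (left_product b n *v (g *v w))"
              using norm_residual_act_le[OF W bn(1), of "left_product b n *v (g *v w)"]
              by (simp add: n matrix_vector_mul_assoc matrix_mul_assoc)
            also have "left_product b n *v (g *v w) = left_product (case_nat g b) (r k) *v w"
              by (simp add: n left_product_case_nat matrix_vector_mul_assoc del: left_product.simps(2))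
            also have "exp (L (b n)) * qnorm W (left_product (case_nat g b) (r k) *v w)
              \<le> exp (e * real (r k) + C) * exp (d' * real (r k))"
              using elim(1) bn(2) by (intro mult_mono) auto
            also have "\<dots> = exp C * exp ((d' + e) * real (r k))"
              by (simp add: algebra_simps flip: exp_add)
            finally show ?case using elim(3) by linarith
          qed
        qed
      qed
      then show ?case by (simp add: slow_def)
    qed
  qed
  \<comment> \<open>The null set in \<open>one\<close> depends on \<open>w\<close>; a basis leaves
    finitely many of them.\<close>
  obtain B where B: "B \<subseteq> ?V" "independent B" "span B = ?V"
    using basis_exists[of ?V] V by (metis span_subspace)
  have "finite B" using B(2) by (rule independent_imp_finite)
  have "AE g in \<mu>. \<forall>w\<in>B. g *v w \<in> ?V"
    using B(1) one by (intro AE_finite_allI \<open>finite B\<close>) auto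
  then have "AE g in \<mu>. \<forall>w\<in>?V. g *v w \<in> ?V"
  proof eventually_elim
    case (elim g)
    have "subspace ((*v) g -` ?V)" by (rule linear_subspace_vimage) (auto intro: V)
    then have "span B \<subseteq> (*v) g -` ?V" using elim by (intro span_minimal) auto
    then show ?case using B(3) by auto
  qed
  then show ?thesis using V by (simp add: stable_def)
qed

end

section \<open>Uniform bounds on the slow subspace\<close>

lemma sum_lessThan_shift_eq:
  fixes f :: "nat \<Rightarrow> real"
  assumes "k \<le> n" shows "(\<Sum>i<n-k. f (i + k)) = (\<Sum>i<n. f i) - (\<Sum>i<k. f i)"
proof -
  have "(\<Sum>i<d. f (i + k)) = (\<Sum>i<k + d. f i) - (\<Sum>i<k. f i)" for d
    by (induction d) (auto simp: add.commute)
  from this[of "n - k"] show ?thesis using assms by simp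
qed

context random_matrices
begin

lemma norm_residual_left_product_le:
  assumes W: "subspace W" and b: "\<And>k. b k \<in> stabiliser W"
  shows "qnorm W (left_product b n *v x) \<le> exp (\<Sum>k<n. L (b k)) * qnorm W x"
proof (induction n)
  case (Suc n)
  have "qnorm W (left_product b (Suc n) *v x) \<le> exp (L (b n)) * qnorm W (left_product b n *v x)"
    using norm_residual_act_le[OF W b, of n "left_product b n *v x"] by (simp add: matrix_vector_mul_assoc)
  also have "\<dots> \<le> exp (L (b n)) * (exp (\<Sum>k<n. L (b k)) * qnorm W x)"
    by (intro mult_left_mono Suc) simp
  finally show ?case by (simp add: exp_add mult_ac)
qed simp

lemma norm_residual_left_product_ge:
  assumes W: "subspace W" and b: "\<And>k. b k \<in> stabiliser W"
  shows "qnorm W x \<le> exp (\<Sum>k<n. L (b k)) * qnorm W (left_product b n *v x)"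
proof (induction n)
  case (Suc n)
  have "qnorm W (left_product b n *v x) \<le> exp (L (b n)) * qnorm W (left_product b (Suc n) *v x)"
    using norm_residual_act_ge[OF W b, of "left_product b n *v x" n] by (simp add: matrix_vector_mul_assoc)
  then have "exp (\<Sum>k<n. L (b k)) * qnorm W (left_product b n *v x)
    \<le> exp (\<Sum>k<n. L (b k)) * (exp (L (b n)) * qnorm W (left_product b (Suc n) *v x))"
    by (intro mult_left_mono) auto
  from order_trans[OF Suc this] show ?case by (simp add: exp_add mult_ac)
qed simp

text \<open>A finite family generating \<open>W'\<close> modulo \<open>W\<close> is slow along
  \<open>r\<close>; by Fatou's lemma some \<open>p = r k\<close> has mean logarithmic norm at most
  \<open>(m + e) * p\<close>. With blocks of this fixed length,
  \<open>subadditive_two_parameter_bound\<close> controls the products between all pairs of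
  times.\<close>

lemma slow_uniform_bound_aux:
  assumes st: "stable W" "stable W'" and sub: "W \<subseteq> W'" "w0 \<in> W'" "w0 \<notin> W"
    and r: "strict_mono r" and slow: "W' \<subseteq> slow W m r" and e: "e > 0"
  shows "AE b in S. fibre_bound W W' m b (4 * e)"
proof -
  have W: "subspace W" and W': "subspace W'" using st by (auto simp: stable_def)
  note lin = linear_residual[OF W]
  have [measurable]: "residual W \<in> borel_measurable borel" by (rule borel_measurable_residual[OF W])
  \<comment> \<open>\<open>T\<close> sends the whole space into \<open>W'\<close> and fixes the
    residuals of vectors of \<open>W'\<close>, so the images of \<open>Basis\<close> generate
    \<open>W'\<close> modulo \<open>W\<close>.\<close>
  define T where "T x = residual W (x - residual W' x)" for x
  have linT: "linear T"
    unfolding T_def using linear_compose[OF linear_compose_sub[OF linear_id linear_residual[OF W']] lin]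
    by (simp add: comp_def)
  have T_in: "T x \<in> W'" for x
    unfolding T_def by (rule residual_in[OF W W' sub(1) diff_residual[OF W']])
  have T_residual: "T (residual W w) = residual W w" if "w \<in> W'" for w
    using residual_in[OF W W' sub(1) that] residual_residual[OF W W order_refl, of w]
    by (simp add: T_def residual_eq_0[OF W'])
  \<comment> \<open>\<open>N\<close> replaces the operator norm on \<open>W'\<close> modulo
    \<open>W\<close>: it bounds this norm, is submultiplicative, and is measurable as a finite
    sum.\<close>
  define N where "N A = (\<Sum>i\<in>Basis. qnorm W (A *v T i))" for A :: "real^'d^'d"
  have N_nonneg: "0 \<le> N A" for A unfolding N_def by (intro sum_nonneg) auto
  have N_bound: "qnorm W (A *v w) \<le> N A * qnorm W w"
    if A: "A \<in> stabiliser W" and w: "w \<in> W'" for A w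
  proof -
    define v where "v = residual W w"
    have "v = T (\<Sum>i\<in>Basis. (v \<bullet> i) *\<^sub>R i)"
      using T_residual[OF w] by (simp add: v_def euclidean_representation)
    also have "\<dots> = (\<Sum>i\<in>Basis. (v \<bullet> i) *\<^sub>R T i)"
      by (simp add: linear_sum[OF linT] linear_scale[OF linT])
    finally have v: "v = (\<Sum>i\<in>Basis. (v \<bullet> i) *\<^sub>R T i)" .
    have lA: "linear (\<lambda>x. residual W (A *v x))"
      using linear_compose[OF matrix_vector_mul_linear lin] by (simp add: comp_def)
    have "residual W (A *v w) = residual W (A *v v)" by (simp add: v_def stabiliser_residual[OF W A])
    also have "\<dots> = residual W (A *v (\<Sum>i\<in>Basis. (v \<bullet> i) *\<^sub>R T i))" using v by simp
    also have "\<dots> = (\<Sum>i\<in>Basis. (v \<bullet> i) *\<^sub>R residual W (A *v T i))"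
      by (simp only: linear_sum[OF lA] linear_scale[OF lA])
    finally have eq: "residual W (A *v w) = (\<Sum>i\<in>Basis. (v \<bullet> i) *\<^sub>R residual W (A *v T i))" .
    have "qnorm W (A *v w) \<le> (\<Sum>i\<in>Basis. norm ((v \<bullet> i) *\<^sub>R residual W (A *v T i)))"
      unfolding eq by (rule norm_sum)
    also have "\<dots> \<le> (\<Sum>i\<in>Basis. norm v * qnorm W (A *v T i))"
      by (intro sum_mono) (auto intro!: mult_right_mono Basis_le_norm)
    finally show ?thesis by (simp add: N_def v_def sum_distrib_left mult.commute)
  qed
  have N_mult: "N (A ** B) \<le> N A * N B" if A: "A \<in> stabiliser W" and B: "B \<in> stabiliser W'" for A B
  proof -
    have "N (A ** B) = (\<Sum>i\<in>Basis. qnorm W (A *v (B *v T i)))"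
      by (simp add: N_def matrix_vector_mul_assoc)
    also have "\<dots> \<le> (\<Sum>i\<in>Basis. N A * qnorm W (B *v T i))"
      using B T_in by (intro sum_mono N_bound[OF A]) (simp add: stabiliser_def)
    finally show ?thesis by (simp add: N_def sum_distrib_left)
  qed
  define c0 where "c0 = N (mat 1)"
  have N_upper: "N (left_product b n) \<le> exp (\<Sum>k<n. L (b k)) * c0" if "\<And>k. b k \<in> stabiliser W" for b n
    unfolding N_def c0_def sum_distrib_left
    using norm_residual_left_product_le[OF W that] by (intro sum_mono) simp
  \<comment> \<open>Here \<open>w0\<close> enters: since \<open>W'\<close> is strictly larger than
    \<open>W\<close>, \<open>N\<close> is positive and has a usable logarithm.\<close>
  have N_lower: "exp (- (\<Sum>k<n. L (b k))) \<le> N (left_product b n)" if b: "\<And>k. b k \<in> stabiliser W" for b n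
  proof -
    have pos: "qnorm W w0 > 0" using sub(3) by (simp add: residual_eq_0_iff[OF W])
    have "qnorm W w0 \<le> exp (\<Sum>k<n. L (b k)) * qnorm W (left_product b n *v w0)"
      by (rule norm_residual_left_product_ge[OF W b])
    also have "\<dots> \<le> exp (\<Sum>k<n. L (b k)) * (N (left_product b n) * qnorm W w0)"
      by (intro mult_left_mono N_bound stabiliser_left_product[OF W b] sub(2)) auto
    finally have "1 \<le> exp (\<Sum>k<n. L (b k)) * N (left_product b n)" using pos by (simp add: mult_ac)
    then show ?thesis by (simp add: exp_minus field_simps)
  qed
  have N_pos: "0 < N (left_product b n)" if "\<And>k. b k \<in> stabiliser W" for b n
    by (rule less_le_trans[OF exp_gt_zero N_lower[OF that]])
  have c0: "c0 > 0"
  proof -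
    have "mat 1 \<in> stabiliser W" by (auto simp: stabiliser_def invertible_def intro: exI[of _ "mat 1"])
    from N_pos[of "\<lambda>_. mat 1" 0, OF this] show ?thesis by (simp add: c0_def)
  qed
  \<comment> \<open>\<open>N (mat 1)\<close> need not be 1; \<open>C0\<close> is the resulting
    additive error in the bound for \<open>\<alpha>\<close>.\<close>
  define C0 where "C0 = \<bar>ln c0\<bar>"
  define \<alpha> where "\<alpha> n b = ln (N (left_product b n))" for n b
  have \<alpha>_upper: "\<alpha> n b \<le> C0 + (\<Sum>k<n. L (b k))" and \<alpha>_lower: "- (\<Sum>k<n. L (b k)) \<le> \<alpha> n b"
    if b: "\<And>k. b k \<in> stabiliser W" for b n
  proof -
    have "\<alpha> n b \<le> ln (exp (\<Sum>k<n. L (b k)) * c0)"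
      unfolding \<alpha>_def using N_upper[OF b] N_pos[OF b] by (intro ln_mono) auto
    then show "\<alpha> n b \<le> C0 + (\<Sum>k<n. L (b k))" using c0 by (simp add: ln_mult C0_def)
    show "- (\<Sum>k<n. L (b k)) \<le> \<alpha> n b"
      unfolding \<alpha>_def using N_lower[OF b] N_pos[OF b] by (subst ln_ge_iff) auto
  qed
  define \<Lambda> where "\<Lambda> n b = (\<Sum>k<n. L (b k) + C0)" for n and b :: "nat \<Rightarrow> real^'d^'d"
  \<comment> \<open>The bounds on \<open>\<alpha>\<close> are known only for sequences in the
    stabiliser, whereas \<open>eventually_integral_le\<close> asks for them everywhere. For
    \<open>n >= 1\<close> the clamping changes nothing almost surely.\<close>
  define f where "f n b = max (- \<Lambda> n b) (min (\<Lambda> n b) (\<alpha> n b))" for n b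
  have iLC: "integrable \<mu> (\<lambda>g. L g + C0)" using integrable_L by simp
  have i\<Lambda>: "integrable S (\<Lambda> n)" for n
    unfolding \<Lambda>_def by (rule integrable_sum_coordinates(1)[OF iLC])
  have [measurable]: "\<Lambda> n \<in> borel_measurable S" for n using i\<Lambda> by auto
  have [measurable]: "\<alpha> n \<in> borel_measurable S" for n
  proof -
    have [measurable]: "(\<lambda>b. left_product b n *v T i) \<in> borel_measurable S" for i
      by (intro borel_measurable_matrix_vector_mult) measurable
    show ?thesis unfolding \<alpha>_def N_def by measurable
  qed
  have mf [measurable]: "f n \<in> borel_measurable S" for n unfolding f_def by measurable
  have \<Lambda>_nonneg: "0 \<le> \<Lambda> n b" if "b \<in> space S" for n b
    unfolding \<Lambda>_def using that L_nonneg
    by (intro sum_nonneg) (auto simp: space_PiM space_eq C0_def PiE_iff intro!: add_nonneg_nonneg)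
  have f_bound: "\<bar>f n b\<bar> \<le> (\<Sum>k<n. L (b k) + C0)" if "b \<in> space S" for n b
    using \<Lambda>_nonneg[OF that, of n] unfolding f_def \<Lambda>_def[symmetric] by (auto simp: max_def min_def)
  \<comment> \<open>At \<open>n = 0\<close> the clamp forces the value 0, while
    \<open>\<alpha> 0 b = ln c0\<close>; from \<open>n = 1\<close> on the summands \<open>C0\<close>
    leave enough room.\<close>
  have f_eq: "f n b = \<alpha> n b" if b: "\<And>k. b k \<in> stabiliser W" and n: "n \<ge> 1" for b n
  proof -
    have "C0 \<le> real n * C0" using n mult_right_mono[of 1 "real n" C0] by (simp add: C0_def)
    moreover have "0 \<le> C0" by (simp add: C0_def)
    ultimately show ?thesis
      using \<alpha>_upper[of b n, OF b] \<alpha>_lower[of b n, OF b] unfolding f_def \<Lambda>_def by (simp add: sum.distrib)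
  qed
  have aeW: "AE b in S. \<forall>k. b k \<in> stabiliser W" and aeW': "AE b in S. \<forall>k. b k \<in> stabiliser W'"
    using AE_seq_stabiliser st by auto
  have "\<forall>\<^sub>F k in sequentially. (\<integral>b. f (r k) b \<partial>S) \<le> (m + e) * real (r k)"
  proof (rule eventually_integral_le[OF iLC mf f_bound r, where c=m])
    have "AE b in S. \<forall>i\<in>Basis. slow_path W m r b (T i)"
      using T_in slow by (intro AE_finite_allI) (auto simp: slow_def)
    then show "AE b in S. \<forall>d>m. \<forall>\<^sub>F k in sequentially. f (r k) b \<le> d * real (r k)"
      using aeW
    proof eventually_elim
      case (elim b)
      note b = elim(2)[rule_format]
      show ?case
      proof (intro allI impI)
        fix d assume "d > m"
        then obtain d' where d': "m < d'" "d' < d" using dense by blast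
        have "\<forall>\<^sub>F k in sequentially. \<forall>i\<in>Basis. qnorm W (left_product b (r k) *v T i) \<le> exp (d' * real (r k))"
          using elim(1) d' by (intro eventually_ball_finite) auto
        moreover note eventually_subseq_pos[OF r]
        moreover note eventually_exp_absorb[OF r d'(2), of "real DIM(real^'d)"]
        ultimately show "\<forall>\<^sub>F k in sequentially. f (r k) b \<le> d * real (r k)"
        proof eventually_elim
          case (elim k)
          have "N (left_product b (r k)) \<le> (\<Sum>i\<in>(Basis :: (real^'d) set). exp (d' * real (r k)))"
            unfolding N_def using elim by (intro sum_mono) auto
          also have "\<dots> \<le> exp (d * real (r k))" using elim(3) by simp
          finally have "\<alpha> (r k) b \<le> ln (exp (d * real (r k)))"
            unfolding \<alpha>_def using N_pos[OF b] by (intro ln_mono) auto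
          then show ?case using f_eq[OF b, of "r k"] elim(2) by simp
        qed
      qed
    qed
  qed (use e in auto)
  moreover note eventually_subseq_pos[OF r]
  ultimately have "\<forall>\<^sub>F k in sequentially. (\<integral>b. f (r k) b \<partial>S) \<le> (m + e) * real (r k) \<and> r k > 0"
    by (rule eventually_conj)
  then obtain p where p: "p \<ge> 1" "(\<integral>b. f p b \<partial>S) \<le> (m + e) * real p"
    unfolding eventually_sequentially by (metis One_nat_def Suc_leI order_refl)
  define F where "F b = f p b / real p" for b
  have ifp: "integrable S (f p)"
    by (rule integrable_dominated[OF iLC mf f_bound])
  have iF: "integrable S F" unfolding F_def using ifp by simp
  have mF: "(\<integral>b. F b \<partial>S) \<le> m + e" unfolding F_def using p by (simp add: field_simps)
  show ?thesis
    using aeW aeW' AE_growth_sum[OF integrable_L] AE_growth_birkhoff_sum[OF iF] AE_growth_birkhoff_sum_minus[OF iF]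
  proof eventually_elim
    case (elim b)
    have sW: "seq_shift k b i \<in> stabiliser W" and sW': "seq_shift k b i \<in> stabiliser W'" for k i
      using elim(1,2) by (auto simp: seq_shift_apply)
    define a where "a k n = \<alpha> (n - k) (seq_shift k b)" for k n
    have "\<exists>C. \<forall>k n. k \<le> n \<longrightarrow> a k n \<le> m * real (n - k) + 4 * e * real n + C"
    proof (rule subadditive_two_parameter_bound[where p=p and ?C0.0=C0 and A="\<lambda>n. \<Sum>k<n. L (b k)"
          and B="\<lambda>n. birkhoff_sum F n b" and m'="\<integral>b. F b \<partial>S"])
      fix k j n :: nat assume kj: "k \<le> j" and jn: "j \<le> n"
      have "left_product (seq_shift k b) (n - k)
        = left_product (seq_shift j b) (n - j) ** left_product (seq_shift k b) (j - k)"
        using left_product_add[of "seq_shift k b" "j - k" "n - j"] kj jn by simp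
      then have "N (left_product (seq_shift k b) (n - k))
        \<le> N (left_product (seq_shift j b) (n - j)) * N (left_product (seq_shift k b) (j - k))"
        using N_mult[OF stabiliser_left_product[OF W sW] stabiliser_left_product[OF W' sW']] by simp
      then have "a k n \<le> ln (N (left_product (seq_shift j b) (n - j)) * N (left_product (seq_shift k b) (j - k)))"
        unfolding a_def \<alpha>_def using N_pos[OF sW] by (intro ln_mono) auto
      then show "a k n \<le> a k j + a j n"
        using N_pos[of "seq_shift j b" "n - j", OF sW] N_pos[of "seq_shift k b" "j - k", OF sW] by (simp add: ln_mult a_def \<alpha>_def)
    next
      fix k n :: nat assume "k \<le> n"
      from sum_lessThan_shift_eq[OF this, of "\<lambda>i. L (b i)"]
      show "a k n \<le> C0 + ((\<Sum>k<n. L (b k)) - (\<Sum>i<k. L (b i)))"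
        using \<alpha>_upper[of "seq_shift k b" "n - k", OF sW] by (simp add: a_def seq_shift_apply)
    next
      fix i
      show "a i (i + p) = real p * (birkhoff_sum F (Suc i) b - birkhoff_sum F i b)"
        using f_eq[of "seq_shift i b" p, OF sW p(1)] p(1) by (simp add: a_def birkhoff_sum_Suc F_def)
    qed (use p e elim mF in auto)
    then obtain C where C: "\<And>k n. k \<le> n \<Longrightarrow> a k n \<le> m * real (n - k) + 4 * e * real n + C" by blast
    have "qnorm W (left_product (seq_shift k b) (n - k) *v w)
      \<le> exp (m * real (n - k) + 4 * e * real n + C) * qnorm W w" if kn: "k \<le> n" and w: "w \<in> W'" for k n w
    proof -
      have "qnorm W (left_product (seq_shift k b) (n - k) *v w)
        \<le> N (left_product (seq_shift k b) (n - k)) * qnorm W w"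
        by (rule N_bound[OF stabiliser_left_product[OF W sW] w])
      also have "N (left_product (seq_shift k b) (n - k)) = exp (a k n)"
        using N_pos[OF sW] by (simp add: a_def \<alpha>_def)
      also have "exp (a k n) * qnorm W w \<le> exp (m * real (n - k) + 4 * e * real n + C) * qnorm W w"
        using C[OF kn] by (intro mult_right_mono) auto
      finally show ?thesis .
    qed
    then show ?case by blast
  qed
qed

lemma slow_uniform_bound:
  assumes st: "stable W" "stable W'" and sub: "W \<subseteq> W'" "w0 \<in> W'" "w0 \<notin> W"
    and r: "strict_mono r" and slow: "W' \<subseteq> slow W m r"
  shows "AE b in S. \<forall>e>0. fibre_bound W W' m b e"
proof -
  \<comment> \<open>The choice of \<open>e\<close> cancels the factor 4 of the previous lemma and
    makes the events countable in number.\<close>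
  have "AE b in S. \<forall>j::nat. fibre_bound W W' m b (4 * (1 / (4 * real (Suc j))))"
    unfolding AE_all_countable by (intro allI slow_uniform_bound_aux[OF st sub r slow]) simp
  then show ?thesis
  proof eventually_elim
    case (elim b)
    show ?case
    proof (intro allI impI)
      fix e :: real assume "e > 0"
      then obtain j where j: "1 / real (Suc j) < e" using nat_approx_posE by blast
      obtain C where C: "\<And>k n w. k \<le> n \<Longrightarrow> w \<in> W' \<Longrightarrow> qnorm W (left_product (seq_shift k b) (n - k) *v w)
        \<le> exp (m * real (n - k) + 4 * (1 / (4 * real (Suc j))) * real n + C) * qnorm W w"
        using elim by meson
      have "qnorm W (left_product (seq_shift k b) (n - k) *v w)
        \<le> exp (m * real (n - k) + e * real n + C) * qnorm W w" if "k \<le> n" "w \<in> W'" for k n w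
      proof -
        have eq: "4 * (1 / (4 * real (Suc j))) = 1 / real (Suc j)" by (simp del: of_nat_Suc)
        have "4 * (1 / (4 * real (Suc j))) * real n \<le> e * real n"
          unfolding eq using j by (intro mult_right_mono) auto
        then have "exp (m * real (n - k) + 4 * (1 / (4 * real (Suc j))) * real n + C) \<le> exp (m * real (n - k) + e * real n + C)"
          by simp
        then show ?thesis
          using C[OF that] by (meson mult_right_mono norm_ge_zero order_trans)
      qed
      then show "fibre_bound W W' m b e" by blast
    qed
  qed
qed

text \<open>Variation of constants: the component of the orbit in \<open>W'\<close> is driven by the quotient orbit modulo \<open>W'\<close>.\<close>

lemma growth_extension:
  assumes W: "subspace W" and W': "subspace W'" and sub: "W \<subseteq> W'"
    and b: "\<And>k. b k \<in> stabiliser W" "\<And>k. b k \<in> stabiliser W'"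
    and L: "\<And>e. e > 0 \<Longrightarrow> \<exists>C. \<forall>k. L (b k) \<le> e * real k + C"
    and fibre: "\<And>e. e > 0 \<Longrightarrow> fibre_bound W W' m b e"
    and base: "growth_le (log_qnorm W' b x) l"
    and x: "x \<notin> W'"
  shows "growth_le (log_qnorm W b x) (max m l)"
  unfolding growth_le_def
proof (intro allI impI)
  fix e0 :: real assume "e0 > 0"
  \<comment> \<open>The fibre bound, the base bound and \<open>L\<close> cost one \<open>e\<close>
    each; the fourth absorbs the number \<open>n\<close> of summands.\<close>
  define e where "e = e0 / 4"
  have e: "e > 0" using \<open>e0 > 0\<close> by (simp add: e_def)
  define M where "M = max m l"
  obtain C1 where C1: "\<And>k n w. k \<le> n \<Longrightarrow> w \<in> W' \<Longrightarrow> qnorm W (left_product (seq_shift k b) (n - k) *v w)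
      \<le> exp (m * real (n - k) + e * real n + C1) * qnorm W w" using fibre[OF e] by blast
  obtain C2 where C2: "\<And>n. log_qnorm W' b x n \<le> (l + e) * real n + C2"
    using base e unfolding growth_le_def by blast
  obtain C3 where C3: "\<And>k. L (b k) \<le> e * real k + C3" using L[OF e] by blast
  define y where "y n = left_product b n *v x" for n
  \<comment> \<open>\<open>w\<close> is the component of the orbit in \<open>W'\<close>, and
    \<open>d\<close> is the part that one step moves from the quotient component into
    \<open>W'\<close>.\<close>
  define w where "w n = y n - residual W' (y n)" for n
  define z where "z n = b n *v residual W' (y n)" for n
  define d where "d n = z n - residual W' (z n)" for n
  have y_notin: "y n \<notin> W'" for n
    unfolding y_def using stabiliser_in_iff[OF W' stabiliser_left_product[OF W' b(2)]] x by simp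
  have w_in: "w n \<in> W'" and d_in: "d n \<in> W'" for n
    unfolding w_def d_def by (rule diff_residual[OF W'])+
  have w_Suc: "w (Suc n) = b n *v w n + d n" for n
  proof -
    have y_Suc: "y (Suc n) = b n *v w n + z n"
      by (simp add: y_def w_def z_def matrix_vector_mul_assoc matrix_vector_mult_diff_distrib)
    have "b n *v w n \<in> W'" using b(2)[of n] w_in by (simp add: stabiliser_def)
    then have "residual W' (y (Suc n)) = residual W' (z n)"
      unfolding y_Suc by (intro residual_cong[OF W']) simp
    then show ?thesis by (simp add: w_def[of "Suc n"] y_Suc d_def)
  qed
  have Suc_left: "left_product (seq_shift k b) (Suc n - k) = b n ** left_product (seq_shift k b) (n - k)"
    if "k \<le> n" for k n
    using that by (simp add: Suc_diff_le seq_shift_apply)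
  have w_eq: "w n = left_product b n *v w 0 + (\<Sum>k<n. left_product (seq_shift (Suc k) b) (n - Suc k) *v d k)" for n
  proof (induction n)
    case (Suc n)
    have "b n *v (\<Sum>k<n. left_product (seq_shift (Suc k) b) (n - Suc k) *v d k)
        = (\<Sum>k<n. left_product (seq_shift (Suc k) b) (Suc n - Suc k) *v d k)"
      unfolding linear_sum[OF matrix_vector_mul_linear]
      by (intro sum.cong refl, subst Suc_left) (auto simp: matrix_vector_mul_assoc)
    then show ?case
      using Suc by (simp add: w_Suc matrix_vector_right_distrib matrix_vector_mul_assoc)
  qed simp
  note lin = linear_residual[OF W]
  have base_bound: "qnorm W' (y k) \<le> exp ((l + e) * real k + C2)" for k
  proof -
    have "qnorm W' (y k) > 0" using y_notin by (simp add: residual_eq_0_iff[OF W'])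
    moreover have "exp (ln (qnorm W' (y k))) \<le> exp ((l + e) * real k + C2)"
      using C2[of k] by (simp add: y_def)
    ultimately show ?thesis by simp
  qed
  have M: "m \<le> M" "l \<le> M" by (auto simp: M_def)
  have base_bound': "qnorm W' (y k) \<le> exp (M * real k + e * real n + C2)" if "k \<le> n" for k n
  proof -
    have "l * real k \<le> M * real k" "e * real k \<le> e * real n"
      using that M e by (auto intro!: mult_right_mono mult_left_mono)
    then have "(l + e) * real k + C2 \<le> M * real k + e * real n + C2" by (simp add: algebra_simps)
    then show ?thesis using base_bound[of k] by (meson exp_le_cancel_iff order_trans)
  qed
  have d_bound: "qnorm W (d k) \<le> 2 * exp (e * real n + C3) * exp (M * real k + e * real n + C2)"
    if kn: "k \<le> n" for k n
  proof -
    have "qnorm W (d k) \<le> norm (d k)" by (rule norm_residual_le[OF W])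
    also have "\<dots> \<le> norm (z k) + qnorm W' (z k)" unfolding d_def by (rule norm_triangle_ineq4)
    also have "\<dots> \<le> 2 * norm (z k)" using norm_residual_le[OF W', of "z k"] by simp
    also have "norm (z k) \<le> exp (L (b k)) * qnorm W' (y k)"
      unfolding z_def using b(1)[of k] by (intro norm_le) (simp add: stabiliser_def)
    also have "\<dots> \<le> exp (e * real n + C3) * exp (M * real k + e * real n + C2)"
    proof (intro mult_mono base_bound'[OF kn])
      have "e * real k \<le> e * real n" using kn e by (intro mult_left_mono) auto
      then show "exp (L (b k)) \<le> exp (e * real n + C3)" using C3[of k] by simp
    qed auto
    finally show ?thesis by simp
  qed
  define A where "A = exp C1 * qnorm W (w 0) + exp C2"
  \<comment> \<open>The term \<open>|M|\<close> compensates one step: the time spent before and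
    after the transfer at \<open>k\<close> adds up to
    \<open>k + (n - Suc k) = n - 1\<close>.\<close>
  define B where "B = 2 * exp (C1 + C2 + C3 + \<bar>M\<bar>)"
  have AB: "0 < A" "0 < B" by (auto simp: A_def B_def add_nonneg_pos)
  have fib: "qnorm W (left_product (seq_shift k b) (n - k) *v v)
      \<le> exp (M * real (n - k) + e * real n + C1) * qnorm W v" if "k \<le> n" "v \<in> W'" for k n v
  proof -
    have "m * real (n - k) \<le> M * real (n - k)" using M by (intro mult_right_mono) auto
    then have "exp (m * real (n - k) + e * real n + C1) \<le> exp (M * real (n - k) + e * real n + C1)" by simp
    then show ?thesis using C1[OF that] by (meson mult_right_mono norm_ge_zero order_trans)
  qed
  have main: "qnorm W (y n) \<le> (A + B * real n) * exp (M * real n + 3 * e * real n)" for n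
  proof -
    define U where "U = exp (M * real n + 3 * e * real n)"
    have en: "0 \<le> e * real n" using e by simp
    have t1: "qnorm W (left_product b n *v w 0) \<le> exp C1 * qnorm W (w 0) * U"
    proof -
      have "qnorm W (left_product b n *v w 0) \<le> exp (M * real n + e * real n + C1) * qnorm W (w 0)"
        using fib[of 0 n "w 0"] w_in by simp
      also have "\<dots> \<le> exp (C1 + (M * real n + 3 * e * real n)) * qnorm W (w 0)"
        using en by (intro mult_right_mono) auto
      finally show ?thesis by (simp add: U_def exp_add[of C1] mult_ac)
    qed
    have t2: "qnorm W (left_product (seq_shift (Suc k) b) (n - Suc k) *v d k) \<le> B * U" if k: "k < n" for k
    proof -
      have "qnorm W (left_product (seq_shift (Suc k) b) (n - Suc k) *v d k)
        \<le> exp (M * real (n - Suc k) + e * real n + C1) * (2 * exp (e * real n + C3) * exp (M * real k + e * real n + C2))"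
        using k by (intro order_trans[OF fib mult_left_mono] d_in d_bound) auto
      also have "\<dots> = 2 * exp ((C1 + C2 + C3 - M) + (M * real n + 3 * e * real n))"
        using k by (simp add: of_nat_diff algebra_simps flip: exp_add)
      also have "\<dots> \<le> 2 * exp ((C1 + C2 + C3 + \<bar>M\<bar>) + (M * real n + 3 * e * real n))"
        by simp
      finally show ?thesis unfolding B_def U_def exp_add[of "C1 + C2 + C3 + \<bar>M\<bar>"] by simp
    qed
    have t3: "qnorm W (residual W' (y n)) \<le> exp C2 * U"
    proof -
      have "qnorm W (residual W' (y n)) \<le> exp (M * real n + e * real n + C2)"
        using norm_residual_le[OF W, of "residual W' (y n)"] base_bound'[of n n] by simp
      also have "\<dots> \<le> exp (C2 + (M * real n + 3 * e * real n))" using en by simp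
      finally show ?thesis by (simp add: U_def exp_add[of C2])
    qed
    have "residual W (y n) = residual W (w n + residual W' (y n))" by (simp add: w_def)
    also have "w n + residual W' (y n) = left_product b n *v w 0
      + (\<Sum>k<n. left_product (seq_shift (Suc k) b) (n - Suc k) *v d k) + residual W' (y n)"
      by (rule arg_cong[OF w_eq, of "\<lambda>v. v + residual W' (y n)"])
    finally have eq: "residual W (y n) = residual W (left_product b n *v w 0)
      + (\<Sum>k<n. residual W (left_product (seq_shift (Suc k) b) (n - Suc k) *v d k)) + residual W (residual W' (y n))"
      by (simp only: linear_add[OF lin] linear_sum[OF lin])
    have "qnorm W (y n) \<le> qnorm W (left_product b n *v w 0)
      + norm (\<Sum>k<n. residual W (left_product (seq_shift (Suc k) b) (n - Suc k) *v d k)) + qnorm W (residual W' (y n))"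
      unfolding eq by (rule order_trans[OF norm_triangle_ineq add_right_mono[OF norm_triangle_ineq]])
    also have "\<dots> \<le> exp C1 * qnorm W (w 0) * U + (\<Sum>k<n. B * U) + exp C2 * U"
      using t2 by (intro add_mono t1 t3 sum_norm_le) auto
    finally have "qnorm W (y n) \<le> (A + B * real n) * U"
      by (simp add: A_def algebra_simps)
    then show ?thesis by (simp only: U_def)
  qed
  have "ln (qnorm W (y n)) \<le> (M + e0) * real n + ln (A + B / e)" for n
  proof -
    have "y n \<notin> W" using y_notin sub by blast
    then have pos: "qnorm W (y n) > 0" by (simp add: residual_eq_0_iff[OF W])
    have "e * real n \<le> exp (e * real n)" using exp_ge_add_one_self[of "e * real n"] by linarith
    then have "B * real n \<le> (B / e) * exp (e * real n)"
      using e AB by (simp add: field_simps)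
    moreover have "A \<le> A * exp (e * real n)" using AB e by simp
    ultimately have "A + B * real n \<le> (A + B / e) * exp (e * real n)" by (simp add: algebra_simps)
    then have "qnorm W (y n) \<le> (A + B / e) * exp (e * real n) * exp (M * real n + 3 * e * real n)"
      by (rule order_trans[OF main mult_right_mono]) simp
    also have "\<dots> = (A + B / e) * exp ((M + e0) * real n)"
      by (simp add: e_def algebra_simps flip: exp_add)
    finally have "ln (qnorm W (y n)) \<le> ln ((A + B / e) * exp ((M + e0) * real n))"
      using pos by (intro ln_mono) auto
    also have "\<dots> = ln (A + B / e) + (M + e0) * real n"
    proof -
      have "0 < A + B / e" using AB e by (intro add_pos_pos divide_pos_pos)
      then show ?thesis by (simp add: ln_mult)
    qed
    finally show ?thesis by simp
  qed
  then show "\<exists>K. \<forall>n. log_qnorm W b x n \<le> (max m l + e0) * real n + K"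
    unfolding y_def M_def by blast
qed

section \<open>Existence of growth rates\<close>

text \<open>General \<open>W\<close> serves the induction; the case used later is
  \<open>W = {0}\<close>. The rate stands inside the almost sure quantifier, so it may depend on
  \<open>b\<close>.\<close>

lemma AE_ex_growth_rate:
  assumes "stable W" "x \<notin> W"
  shows "AE b in S. \<exists>l. growth_le (log_qnorm W b x) l
    \<and> growth_le (\<lambda>n. - log_qnorm W b x n) (- l)"
  using assms
proof (induction "DIM(real^'d) - dim W" arbitrary: W rule: less_induct)
  case less
  note st = less.prems(1)
  have W: "subspace W" using st by (simp add: stable_def)
  have ne: "W \<noteq> UNIV" using less.prems(2) by blast
  have "\<exists>m w0 r. w0 \<notin> W \<and> strict_mono r
    \<and> (\<forall>y. y \<notin> W \<longrightarrow> (AE b in S. growth_le (\<lambda>n. - log_qnorm W b y n) (- m)))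
    \<and> (AE b in S. slow_path W m r b w0)"
    by (rule minimal_growth_quotient[OF st ne]) blast
  then obtain m w0 and r :: "nat \<Rightarrow> nat" where r: "w0 \<notin> W" "strict_mono r"
    "\<And>y. y \<notin> W \<Longrightarrow> AE b in S. growth_le (\<lambda>n. - log_qnorm W b y n) (- m)"
    "AE b in S. slow_path W m r b w0"
    by blast
  define W' where "W' = slow W m r"
  have st': "stable W'" unfolding W'_def by (rule stable_slow[OF st r(2)])
  have W': "subspace W'" using st' by (simp add: stable_def)
  have sub: "W \<subseteq> W'" unfolding W'_def by (rule slow_supset[OF st])
  have w0: "w0 \<in> W'" using r(4) by (simp add: W'_def slow_def)
  have bound: "AE b in S. \<forall>e>0. fibre_bound W W' m b e"
    by (rule slow_uniform_bound[OF st st' sub w0 r(1,2)]) (simp add: W'_def)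
  note aeW = AE_seq_stabiliser[OF st]
  show ?case
  proof (cases "x \<in> W'")
    case True
    show ?thesis
      using bound r(3)[OF less.prems(2)] aeW
    proof eventually_elim
      case (elim b)
      have "growth_le (log_qnorm W b x) m"
        unfolding growth_le_def
      proof (intro allI impI)
        fix e :: real assume "e > 0"
        then obtain C where C: "\<And>n. qnorm W (left_product b n *v x)
          \<le> exp (m * real n + e * real n + C) * qnorm W x"
          using elim(1) True by (metis diff_zero le0 seq_shift_0)
        have "log_qnorm W b x n \<le> (m + e) * real n + (C + ln (qnorm W x))" for n
        proof -
          have pos: "qnorm W x > 0" using less.prems(2) by (simp add: residual_eq_0_iff[OF W])
          have "left_product b n *v x \<notin> W"
            using stabiliser_in_iff[OF W stabiliser_left_product[OF W]] elim(3) less.prems(2) by blast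
          then have "qnorm W (left_product b n *v x) > 0" by (simp add: residual_eq_0_iff[OF W])
          then have "log_qnorm W b x n \<le> ln (exp (m * real n + e * real n + C) * qnorm W x)"
            using C[of n] by (intro ln_mono) auto
          also have "\<dots> = m * real n + e * real n + C + ln (qnorm W x)" using pos by (simp add: ln_mult)
          finally show ?thesis by (simp add: algebra_simps)
        qed
        then show "\<exists>K. \<forall>n. log_qnorm W b x n \<le> (m + e) * real n + K" by blast
      qed
      then show ?case using elim(2) by blast
    qed
  next
    case False
    have "dim W < dim W'"
    proof -
      have "W' \<noteq> W" using w0 r(1) by blast
      then show ?thesis using subspace_dim_equal[OF W W' sub] dim_subset[OF sub] by (metis le_neq_implies_less order_refl)
    qed
    moreover have "dim W' \<le> DIM(real^'d)" by (rule dim_subset_UNIV)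
    ultimately have "DIM(real^'d) - dim W' < DIM(real^'d) - dim W" by linarith
    from less.hyps[OF this st' False]
    show ?thesis
      using bound r(3)[OF less.prems(2)] aeW AE_seq_stabiliser[OF st'] AE_L_sublinear
    proof eventually_elim
      case (elim b)
      then obtain l where l: "growth_le (log_qnorm W' b x) l"
        "growth_le (\<lambda>n. - log_qnorm W' b x n) (- l)" by blast
      have up: "growth_le (log_qnorm W b x) (max m l)"
        by (rule growth_extension[OF W W' sub _ _ _ _ l(1) False]) (use elim in auto)
      have "growth_le (\<lambda>n. - log_qnorm W b x n) (- l)"
      proof (rule growth_le_mono[OF l(2), of _ 0])
        fix n
        have "left_product b n *v x \<notin> W'"
          using stabiliser_in_iff[OF W' stabiliser_left_product[OF W']] elim(5) False by blast
        then have "0 < qnorm W' (left_product b n *v x)" by (simp add: residual_eq_0_iff[OF W'])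
        then have "log_qnorm W' b x n \<le> log_qnorm W b x n"
          using norm_residual_mono[OF W W' sub] by (intro ln_mono) auto
        then show "- log_qnorm W b x n \<le> - log_qnorm W' b x n + 0" by simp
      qed
      then have "growth_le (\<lambda>n. - log_qnorm W b x n) (- max m l)"
        using elim(3) by (cases "m \<le> l") (simp_all add: max_def)
      with up show ?case by blast
    qed
  qed
qed

lemma AE_ex_limit:
  assumes "x \<noteq> 0"
  shows "AE b in S. \<exists>l. rate norm b x \<longlonglongrightarrow> l"
proof -
  have sub: "subspace {0 :: real^'d}" by (rule subspace_single_0)
  have res: "residual {0} y = y" for y :: "real^'d" using diff_residual[OF sub, of y] by simp
  have "stable {0}" using sub by (simp add: stable_def)
  from AE_ex_growth_rate[OF this, of x] assms
  have "AE b in S. \<exists>l. growth_le (\<lambda>n. ln (norm (left_product b n *v x))) l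
    \<and> growth_le (\<lambda>n. - ln (norm (left_product b n *v x))) (- l)" by (simp add: res)
  then show ?thesis
  proof eventually_elim
    case (elim b)
    then obtain l where "growth_le (\<lambda>n. ln (norm (left_product b n *v x))) l"
      "growth_le (\<lambda>n. - ln (norm (left_product b n *v x))) (- l)" by blast
    from growth_le_imp_tendsto[OF this] show ?case by blast
  qed
qed

end

section \<open>Vector norms, supports and the projective set\<close>

lemma
  assumes "is_vector_norm nrm"
  shows vector_norm_nonneg: "0 \<le> nrm x"
    and vector_norm_eq_0: "nrm x = 0 \<longleftrightarrow> x = 0"
    and vector_norm_scale: "nrm (c *\<^sub>R x) = \<bar>c\<bar> * nrm x"
    and vector_norm_triangle: "nrm (x + y) \<le> nrm x + nrm y"
  using assms by (auto simp: is_vector_norm_def)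

lemma vector_norm_pos: "is_vector_norm nrm \<Longrightarrow> x \<noteq> 0 \<Longrightarrow> 0 < nrm x"
  using vector_norm_nonneg[of nrm x] vector_norm_eq_0[of nrm x] by linarith

lemma vector_norm_equivalence:
  fixes nrm :: "'a::euclidean_space \<Rightarrow> real"
  assumes n: "is_vector_norm nrm"
  shows "\<exists>a\<ge>1. (\<forall>x. nrm x \<le> a * norm x) \<and> (\<forall>x. norm x \<le> a * nrm x)"
    and "continuous_on UNIV nrm"
proof -
  define c where "c = (\<Sum>i\<in>Basis. nrm (i :: 'a))"
  have c: "0 \<le> c" unfolding c_def by (intro sum_nonneg vector_norm_nonneg[OF n])
  have sum: "nrm (\<Sum>i\<in>A. f i) \<le> (\<Sum>i\<in>A. nrm (f i))" if "finite A" for A and f :: "'a \<Rightarrow> 'a"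
    using that
  proof induction
    case empty show ?case using vector_norm_eq_0[OF n, of 0] by simp
  next
    case (insert i A)
    then show ?case using vector_norm_triangle[OF n, of "f i" "\<Sum>i\<in>A. f i"] by simp
  qed
  have upper: "nrm x \<le> c * norm x" for x
  proof -
    have "nrm x = nrm (\<Sum>i\<in>Basis. (x \<bullet> i) *\<^sub>R i)" by (simp add: euclidean_representation)
    also have "\<dots> \<le> (\<Sum>i\<in>Basis. nrm ((x \<bullet> i) *\<^sub>R i))" by (rule sum) simp
    also have "\<dots> \<le> (\<Sum>i\<in>Basis. norm x * nrm i)"
      unfolding vector_norm_scale[OF n]
      by (intro sum_mono mult_right_mono vector_norm_nonneg[OF n]) (simp add: Basis_le_norm)
    finally show ?thesis by (simp add: c_def mult.commute flip: sum_distrib_left)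
  qed
  have diff: "nrm x - nrm y \<le> c * dist x y" for x y
    using vector_norm_triangle[OF n, of "x - y" y] upper[of "x - y"] by (simp add: dist_norm)
  have "c-lipschitz_on UNIV nrm"
  proof (rule lipschitz_onI)
    show "dist (nrm x) (nrm y) \<le> c * dist x y" for x y
      using diff[of x y] diff[of y x] by (simp add: dist_real_def dist_commute abs_le_iff)
  qed (rule c)
  then show cont: "continuous_on UNIV nrm" by (rule lipschitz_on_continuous_on)
  obtain e :: 'a where "norm e = 1" using vector_choose_size[of 1] by auto
  then have "sphere 0 1 \<noteq> ({} :: 'a set)" by (auto intro!: exI[of _ e])
  from continuous_attains_inf[OF compact_sphere this continuous_on_subset[OF cont subset_UNIV]]
  obtain z :: 'a where z: "norm z = 1" "\<And>y. norm y = 1 \<Longrightarrow> nrm z \<le> nrm y" by auto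
  have pos: "0 < nrm z" using z(1) by (intro vector_norm_pos[OF n]) auto
  have lower: "norm x \<le> (1 / nrm z) * nrm x" for x
  proof (cases "x = 0")
    case True then show ?thesis using vector_norm_eq_0[OF n, of x] by simp
  next
    case False
    have "nrm z \<le> nrm ((1 / norm x) *\<^sub>R x)" using False by (intro z(2)) simp
    also have "\<dots> = nrm x / norm x" by (simp add: vector_norm_scale[OF n])
    finally show ?thesis using False pos by (simp add: field_simps)
  qed
  define a where "a = max 1 (max c (1 / nrm z))"
  have a: "1 \<le> a" "c \<le> a" "1 / nrm z \<le> a" by (auto simp: a_def)
  have "nrm x \<le> a * norm x" for x
    using upper[of x] mult_right_mono[OF a(2), of "norm x"] by simp
  moreover have "norm x \<le> a * nrm x" for x
    using lower[of x] mult_right_mono[OF a(3) vector_norm_nonneg[OF n, of x]] by simp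
  ultimately show "\<exists>a\<ge>1. (\<forall>x. nrm x \<le> a * norm x) \<and> (\<forall>x. norm x \<le> a * nrm x)"
    using a(1) by blast
qed

lemma matrix_op_norm_bound:
  fixes A :: "real^'d^'d"
  assumes n: "is_vector_norm nrm"
  shows "nrm (A *v x) \<le> matrix_op_norm nrm A * nrm x"
proof (cases "x = 0")
  case True then show ?thesis using vector_norm_eq_0[OF n, of 0] by simp
next
  case False
  obtain a where a: "a \<ge> 1" "\<And>x. nrm x \<le> a * norm x" "\<And>x. norm x \<le> a * nrm x"
    using vector_norm_equivalence(1)[OF n] by blast
  have pos: "0 < nrm y" if "y \<noteq> 0" for y using that by (rule vector_norm_pos[OF n])
  \<comment> \<open>A supremum of reals is an upper bound only for a bounded range; comparison with
    the Euclidean operator norm bounds it.\<close>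
  have "bdd_above (range (\<lambda>x. nrm (A *v x) / nrm x))"
  proof (rule bdd_aboveI2)
    fix y
    show "nrm (A *v y) / nrm y \<le> a * (onorm ((*v) A) * a)"
    proof (cases "y = 0")
      case True then show ?thesis
        using a(1) onorm_pos_le[OF matrix_vector_mul_bounded_linear[of A]] vector_norm_eq_0[OF n, of 0] by simp
    next
      case False
      have "nrm (A *v y) \<le> a * norm (A *v y)" by (rule a)
      also have "\<dots> \<le> a * (onorm ((*v) A) * norm y)"
        using a(1) by (intro mult_left_mono onorm) auto
      also have "\<dots> \<le> a * (onorm ((*v) A) * (a * nrm y))"
        using a onorm_pos_le[OF matrix_vector_mul_bounded_linear[of A]] by (intro mult_left_mono) auto
      finally show ?thesis using pos[OF False] by (simp add: field_simps)
    qed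
  qed
  then have "nrm (A *v x) / nrm x \<le> matrix_op_norm nrm A"
    unfolding matrix_op_norm_def by (intro cSUP_upper) auto
  then show ?thesis using pos[OF False] by (simp add: field_simps)
qed

lemma matrix_inv_mult:
  fixes g :: "real^'d^'d"
  assumes "invertible g" shows "matrix_inv g *v (g *v x) = x"
proof -
  have "g ** matrix_inv g = mat 1 \<and> matrix_inv g ** g = mat 1"
    using assms unfolding invertible_def matrix_inv_def by (rule someI_ex)
  then show ?thesis by (simp add: matrix_vector_mul_assoc)
qed

lemma nrm_dominated:
  fixes g :: "real^'d^'d"
  assumes n: "is_vector_norm nrm" and g: "invertible g"
  defines "l \<equiv> ln (max (matrix_op_norm nrm g) (matrix_op_norm nrm (matrix_inv g)))"
  shows "nrm (g *v x) \<le> exp l * nrm x" "nrm x \<le> exp l * nrm (g *v x)"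
proof -
  let ?m = "max (matrix_op_norm nrm g) (matrix_op_norm nrm (matrix_inv g))"
  obtain e :: "real^'d" where e: "norm e = 1" using vector_choose_size[of 1] by auto
  then have "e \<noteq> 0" by auto
  then have "g *v e \<noteq> 0" using matrix_inv_mult[OF g, of e] by auto
  \<comment> \<open>Positivity of the operator norm, tested on one vector, is what makes
    \<open>exp\<close> cancel the logarithm in \<open>l\<close>.\<close>
  then have "0 < matrix_op_norm nrm g * nrm e"
    using vector_norm_pos[OF n, of "g *v e"] matrix_op_norm_bound[OF n, of g e] by linarith
  then have "0 < matrix_op_norm nrm g"
    using vector_norm_nonneg[OF n, of e] by (simp add: zero_less_mult_iff)
  then have l: "exp l = ?m" by (simp add: l_def)
  show "nrm (g *v x) \<le> exp l * nrm x"
    unfolding l by (rule order_trans[OF matrix_op_norm_bound[OF n] mult_right_mono])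
      (auto intro: vector_norm_nonneg[OF n])
  have "nrm x \<le> matrix_op_norm nrm (matrix_inv g) * nrm (g *v x)"
    using matrix_op_norm_bound[OF n, of "matrix_inv g" "g *v x"] by (simp add: matrix_inv_mult[OF g])
  also have "\<dots> \<le> exp l * nrm (g *v x)"
    unfolding l by (intro mult_right_mono vector_norm_nonneg[OF n]) simp
  finally show "nrm x \<le> exp l * nrm (g *v x)" .
qed

lemma random_matricesI:
  fixes \<mu> :: "(real^'d^'d) measure"
  assumes n: "is_vector_norm nrm" and "prob_space \<mu>" "sets \<mu> = sets GL_borel" "finite_first_moment nrm \<mu>"
  shows "\<exists>L. random_matrices \<mu> L \<and>
    (\<forall>g x. invertible g \<longrightarrow> x \<noteq> 0 \<longrightarrow> \<bar>ln (nrm (g *v x)) - ln (nrm x)\<bar> \<le> L g)"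
proof -
  define l where "l g = ln (max (matrix_op_norm nrm g) (matrix_op_norm nrm (matrix_inv g)))" for g :: "real^'d^'d"
  obtain a where a: "a \<ge> 1" "\<And>x. nrm x \<le> a * norm x" "\<And>x. norm x \<le> a * nrm x"
    using vector_norm_equivalence(1)[OF n] by blast
  \<comment> \<open>Passing from the Euclidean norm to \<open>nrm\<close> and back costs a factor
    \<open>a\<close> twice.\<close>
  define L where "L g = l g + 2 * ln a" for g
  have eL: "exp (L g) = a * (a * exp (l g))" for g
  proof -
    have "L g = ln a + (ln a + l g)" by (simp add: L_def)
    moreover have "exp (ln a) = a" using a(1) by (intro exp_ln) linarith
    ultimately show ?thesis by (simp only: exp_add)
  qed
  interpret M: prob_space \<mu> by fact
  have dom: "nrm (g *v x) \<le> exp (l g) * nrm x" "nrm x \<le> exp (l g) * nrm (g *v x)" if "invertible g" for g x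
    using nrm_dominated[OF n that] unfolding l_def by auto
  have "random_matrices \<mu> L"
  proof (intro random_matrices.intro random_matrices_axioms.intro prob_space_sequence_space)
    show "integrable \<mu> L"
      using assms(4) unfolding finite_first_moment_def L_def l_def by simp
    fix g :: "real^'d^'d" and x assume g: "invertible g"
    have "norm (g *v x) \<le> a * nrm (g *v x)" by (rule a)
    also have "\<dots> \<le> a * (exp (l g) * (a * norm x))"
      using a(1) order_trans[OF dom(1)[OF g, of x] mult_left_mono[OF a(2)[of x], of "exp (l g)"]]
      by (simp add: mult_left_mono)
    finally show "norm (g *v x) \<le> exp (L g) * norm x" by (simp add: eL mult_ac)
    have "norm x \<le> a * nrm x" by (rule a)
    also have "\<dots> \<le> a * (exp (l g) * (a * norm (g *v x)))"
      using a(1) order_trans[OF dom(2)[OF g, of x] mult_left_mono[OF a(2)[of "g *v x"], of "exp (l g)"]]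
      by (simp add: mult_left_mono)
    finally show "norm x \<le> exp (L g) * norm (g *v x)" by (simp add: eL mult_ac)
  qed fact+
  moreover have "\<bar>ln (nrm (g *v x)) - ln (nrm x)\<bar> \<le> L g" if g: "invertible g" and x: "x \<noteq> 0" for g x
  proof -
    have "g *v x \<noteq> 0" using matrix_inv_mult[OF g, of x] x by auto
    then have pos: "0 < nrm (g *v x)" "0 < nrm x" using x by (auto intro: vector_norm_pos[OF n])
    have "ln (nrm (g *v x)) \<le> ln (exp (l g) * nrm x)" using dom(1)[OF g] pos by (intro ln_mono) auto
    moreover have "ln (nrm x) \<le> ln (exp (l g) * nrm (g *v x))" using dom(2)[OF g] pos by (intro ln_mono) auto
    ultimately have "\<bar>ln (nrm (g *v x)) - ln (nrm x)\<bar> \<le> l g" using pos by (simp add: ln_mult)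
    moreover have "0 \<le> ln a" using a(1) by simp
    ultimately show ?thesis unfolding L_def by linarith
  qed
  ultimately show ?thesis by blast
qed

text \<open>The complement of the support is a union of null open sets; by the Lindelof property
  countably many of them suffice, so it is null.\<close>

lemma
  fixes M :: "'a::second_countable_topology measure"
  assumes s: "sets M = sets (restrict_space borel A)"
  shows sets_measure_support: "measure_support M \<in> sets M"
    and AE_measure_support: "AE x in M. x \<in> measure_support M"
proof -
  have sp: "space M = A" using sets_eq_imp_space_eq[OF s] by (simp add: space_restrict_space)
  define F where "F = {U. open U \<and> emeasure M (U \<inter> space M) = 0}"
  have op: "U \<inter> space M \<in> sets M" if "open U" for U
    unfolding s sp by (auto simp: sets_restrict_space intro!: image_eqI[of _ _ U] borel_open that)
  have eq: "measure_support M = space M - \<Union>F"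
    unfolding measure_support_def F_def by (auto simp: zero_less_iff_neq_zero)
  have "open (\<Union>F)" by (auto simp: F_def)
  from sets.Diff[OF sets.top op[OF this]] show "measure_support M \<in> sets M"
    unfolding eq by (simp add: Diff_Int)
  obtain F' where F': "F' \<subseteq> F" "countable F'" "\<Union>F' = \<Union>F"
    using Lindelof[of F] unfolding F_def by blast
  have "AE x in M. \<forall>U\<in>F'. x \<notin> U"
    unfolding AE_ball_countable[OF F'(2)]
  proof
    fix U assume "U \<in> F'"
    then have U: "open U" "emeasure M (U \<inter> space M) = 0" using F'(1) by (auto simp: F_def)
    show "AE x in M. x \<notin> U"
      by (rule AE_I[of _ _ "U \<inter> space M"]) (use U op in auto)
  qed
  then show "AE x in M. x \<in> measure_support M"
    using AE_space by eventually_elim (use F'(3) in \<open>auto simp: eq\<close>)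
qed

lemma measure_support_subset_support_group: "measure_support \<mu> \<subseteq> support_group \<mu>"
  unfolding support_group_def by (rule hull_subset)

text \<open>The cone over a nonempty \<open>P\<close> accumulates at the origin, so the apex is
  added; away from it closedness comes from the quotient topology.\<close>

lemma closedin_projective_imp_closed:
  assumes "closedin projective_topology P"
  shows "closed (insert 0 {v. v \<noteq> 0 \<and> span {v} \<in> P})"
proof -
  have "openin projective_topology (projective_space - P)"
    using assms by (simp add: closedin_def topspace_projective_topology)
  then have "openin (top_of_set (- {0})) {v \<in> - {0}. span {v} \<in> projective_space - P}"
    by (simp add: openin_projective_topology)
  then have "open {v \<in> - {0}. span {v} \<in> projective_space - P}"
    by (rule openin_open_trans) auto
  moreover have "{v \<in> - {0}. span {v} \<in> projective_space - P} = - insert 0 {v. v \<noteq> 0 \<and> span {v} \<in> P}"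
    by (auto simp: projective_space_def)
  ultimately show ?thesis by (simp add: closed_def)
qed

section \<open>Convolution powers and arbitrary norms\<close>

context random_matrices
begin

lemma measurable_left_product_GL [measurable]:
  "(\<lambda>b. left_product b n) \<in> measurable S GL_borel"
  unfolding GL_borel_def
proof (rule measurable_restrict_space2)
  have "invertible (left_product b n)" if "b \<in> space S" for b
    using that by (induction n) (auto simp: space_PiM space_eq invertible_mult PiE_iff,
      auto simp: invertible_def intro: exI[of _ "mat 1"])
  then show "(\<lambda>b. left_product b n) \<in> space S \<rightarrow> carrier GL" by auto
qed measurable

text \<open>A convolution step multiplies by an independent matrix from the left, and so does
  \<open>left_product\<close>, with the new matrix at coordinate \<open>n\<close>. The convolution
  lists the new factor first, whereas \<open>comb_seq\<close> appends it, so the two components are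
  swapped in between.\<close>

lemma GL_conv_power_eq: "GL_conv_power \<mu> n = distr S GL_borel (\<lambda>b. left_product b n)"
proof (induction n)
  case 0
  show ?case
  proof (rule measure_eqI)
    fix A assume A: "A \<in> sets (GL_conv_power \<mu> 0)"
    then have A': "A \<in> sets GL_borel" by simp
    have "(\<lambda>b. left_product b 0) -` A \<inter> space S = (if mat 1 \<in> A then space S else {})" by auto
    then show "emeasure (GL_conv_power \<mu> 0) A = emeasure (distr S GL_borel (\<lambda>b. left_product b 0)) A"
      using A' emeasure_distr[OF measurable_left_product_GL A', of 0] by (simp add: P.emeasure_space_1)
  qed simp
next
  case (Suc n)
  interpret SS: pair_prob_space S S ..
  have d: "distr S \<mu> (\<lambda>b. b 0) = \<mu>" by (rule PiM_component) simp
  have mult: "(\<lambda>(g, h). g ** h) \<in> measurable (\<mu> \<Otimes>\<^sub>M GL_borel) GL_borel"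
    unfolding GL_borel_def
  proof (rule measurable_restrict_space2)
    show "(\<lambda>(g, h). g ** h) \<in> space (\<mu> \<Otimes>\<^sub>M restrict_space borel (carrier GL)) \<rightarrow> carrier GL"
      by (auto simp: space_pair_measure space_eq space_restrict_space invertible_mult)
    have "(\<lambda>h. h) \<in> borel_measurable (restrict_space borel (carrier GL))"
      by (intro measurable_restrict_space1) simp
    then show "(\<lambda>(g, h). g ** h) \<in> borel_measurable (\<mu> \<Otimes>\<^sub>M restrict_space borel (carrier GL))"
      unfolding case_prod_unfold
      by (intro borel_measurable_matrix_matrix_mult measurable_compose[OF measurable_fst measurable_ident_borel]
          measurable_compose[OF measurable_snd])
  qed
  have pr: "sigma_finite_measure (distr S GL_borel (\<lambda>b. left_product b n))"
    by (intro prob_space_imp_sigma_finite P.prob_space_distr) measurable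
  have "GL_conv_power \<mu> (Suc n)
      = distr (distr S \<mu> (\<lambda>b. b 0) \<Otimes>\<^sub>M distr S GL_borel (\<lambda>b. left_product b n)) GL_borel (\<lambda>(g, h). g ** h)"
    by (simp add: d Suc)
  also have "distr S \<mu> (\<lambda>b. b 0) \<Otimes>\<^sub>M distr S GL_borel (\<lambda>b. left_product b n)
      = distr (S \<Otimes>\<^sub>M S) (\<mu> \<Otimes>\<^sub>M GL_borel) (\<lambda>(w', w). (w' 0, left_product w n))"
    using pr by (intro pair_measure_distr) measurable
  also have "distr \<dots> GL_borel (\<lambda>(g, h). g ** h)
      = distr (S \<Otimes>\<^sub>M S) GL_borel (\<lambda>z. fst z 0 ** left_product (snd z) n)"
    using mult by (subst distr_distr) (auto simp: case_prod_unfold comp_def)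
  also have "\<dots> = distr (distr (S \<Otimes>\<^sub>M S) (S \<Otimes>\<^sub>M S) (\<lambda>(x, y). (y, x))) GL_borel (\<lambda>z. fst z 0 ** left_product (snd z) n)"
    using SS.distr_pair_swap by simp
  also have "\<dots> = distr (S \<Otimes>\<^sub>M S) GL_borel (\<lambda>z. snd z 0 ** left_product (fst z) n)"
  proof (subst distr_distr)
    have "(\<lambda>z. (fst z 0, left_product (snd z) n)) \<in> measurable (S \<Otimes>\<^sub>M S) (\<mu> \<Otimes>\<^sub>M GL_borel)"
      by (intro measurable_Pair measurable_compose[OF measurable_snd measurable_left_product_GL]) measurable
    from measurable_compose[OF this mult]
    show "(\<lambda>z. fst z 0 ** left_product (snd z) n) \<in> measurable (S \<Otimes>\<^sub>M S) GL_borel" by simp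
  qed (auto simp: case_prod_unfold comp_def)
  also have "\<dots> = distr (S \<Otimes>\<^sub>M S) GL_borel ((\<lambda>b. left_product b (Suc n)) \<circ> (\<lambda>(w, w'). comb_seq n w w'))"
  proof -
    have "left_product (comb_seq n w w') (Suc n) = w' 0 ** left_product w n" for w w' :: "nat \<Rightarrow> real^'d^'d"
      using left_product_cong[of n "comb_seq n w w'" w] comb_seq_add[of n w w' 0] by (simp add: comb_seq_less)
    then show ?thesis by (simp add: case_prod_unfold comp_def del: left_product.simps(2))
  qed
  also have "\<dots> = distr (distr (S \<Otimes>\<^sub>M S) S (\<lambda>(w, w'). comb_seq n w w')) GL_borel (\<lambda>b. left_product b (Suc n))"
    by (rule distr_distr[symmetric]) measurable
  also have "\<dots> = distr S GL_borel (\<lambda>b. left_product b (Suc n))" by (simp add: PiM_comb_seq)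
  finally show ?case .
qed

text \<open>Equivalent norms change the logarithm by at most \<open>ln a\<close>, which disappears
  after division by \<open>n\<close>.\<close>

lemma AE_ex_limit_vector_norm:
  assumes n: "is_vector_norm nrm" and x: "x \<noteq> 0"
  shows "AE b in S. \<exists>l. rate nrm b x \<longlonglongrightarrow> l"
proof -
  obtain a where a: "a \<ge> 1" "\<And>x. nrm x \<le> a * norm x" "\<And>x. norm x \<le> a * nrm x"
    using vector_norm_equivalence(1)[OF n] by blast
  have "AE b in S. \<forall>k. invertible (b k)"
    by (rule AE_all_coordinates) (use AE_space[of \<mu>] in \<open>simp add: space_eq\<close>)
  then show ?thesis
    using AE_ex_limit[OF x]
  proof eventually_elim
    case (elim b)
    then obtain l where l: "rate norm b x \<longlonglongrightarrow> l" by blast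
    have ne: "left_product b n *v x \<noteq> 0" for n
    proof (induction n)
      case (Suc n)
      then show ?case
        using matrix_inv_mult[of "b n" "left_product b n *v x"] elim(1)
        by (auto simp flip: matrix_vector_mul_assoc)
    qed (use x in simp)
    have "(\<lambda>n. rate nrm b x n - rate norm b x n) \<longlonglongrightarrow> 0"
    proof (rule Lim_null_comparison)
      show "(\<lambda>n. ln a / real n) \<longlonglongrightarrow> 0" by (rule lim_const_over_n)
      have "norm (rate nrm b x n - rate norm b x n) \<le> ln a / real n" for n
      proof -
        let ?y = "left_product b n *v x"
        have pos: "0 < nrm ?y" "0 < norm ?y" using ne[of n] by (auto intro: vector_norm_pos[OF n])
        have "ln (nrm ?y) \<le> ln (a * norm ?y)" using pos a(2) by (intro ln_mono) auto
        moreover have "ln (norm ?y) \<le> ln (a * nrm ?y)" using pos a(3) by (intro ln_mono) auto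
        ultimately have le: "\<bar>ln (nrm ?y) - ln (norm ?y)\<bar> \<le> ln a" using pos a(1) by (simp add: ln_mult)
        have "norm (1 / real n * ln (nrm ?y) - 1 / real n * ln (norm ?y)) = \<bar>ln (nrm ?y) - ln (norm ?y)\<bar> / real n"
          by (simp add: diff_divide_distrib[symmetric])
        then show ?thesis using divide_right_mono[OF le, of "real n"] by simp
      qed
      then show "\<forall>\<^sub>F n in sequentially. norm (rate nrm b x n
        - rate norm b x n) \<le> ln a / real n" by simp
    qed
    from tendsto_add[OF this l] show ?case by auto
  qed
qed

end

section \<open>The action on the cone over \<open>P\<close>\<close>

locale expanding_action = random_matrices \<mu> L for \<mu> :: "(real^'d^'d) measure" and L +
  fixes nrm :: "real^'d \<Rightarrow> real" and P :: "(real^'d) set set"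
  assumes nrm: "is_vector_norm nrm"
    and nrm_bound: "invertible g \<Longrightarrow> x \<noteq> 0 \<Longrightarrow> \<bar>ln (nrm (g *v x)) - ln (nrm x)\<bar> \<le> L g"
    and closed_P: "closedin projective_topology P"
    and invariant_P: "projectively_invariant (support_group \<mu>) P"
begin

definition cone :: "(real^'d) set" where
  "cone = {v. v \<noteq> 0 \<and> span {v} \<in> P}"

definition supp :: "(real^'d^'d) set" where
  "supp = measure_support \<mu>"

text \<open>The support has full measure and lies in \<open>support_group \<mu>\<close>, so the
  invariance of \<open>P\<close> applies to every matrix that is not replaced by the
  identity.\<close>

abbreviation "act \<equiv> restricted_act supp"

lemma supp_invertible: "g \<in> supp \<Longrightarrow> invertible g"
  by (simp add: supp_def measure_support_def space_eq)

lemma supp_cone: "g \<in> supp \<Longrightarrow> v \<in> cone \<Longrightarrow> g *v v \<in> cone"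
proof -
  assume g: "g \<in> supp" and v: "v \<in> cone"
  have "g *v v \<noteq> 0" using matrix_inv_mult[OF supp_invertible[OF g], of v] v by (auto simp: cone_def)
  moreover have "(\<lambda>x. g *v x) ` span {v} \<in> P"
    using invariant_P g v measure_support_subset_support_group[of \<mu>]
    unfolding projectively_invariant_def cone_def supp_def by blast
  moreover have "(\<lambda>x. g *v x) ` span {v} = span {g *v v}"
    using linear_span_image[OF matrix_vector_mul_linear, of g "{v}"] by simp
  ultimately show ?thesis by (simp add: cone_def)
qed

lemma closed_cone: "closed (insert 0 cone)"
  unfolding cone_def by (rule closedin_projective_imp_closed[OF closed_P])

lemma borel_cone: "cone \<in> sets borel"
proof -
  have "insert 0 cone - {0} \<in> sets borel"
    by (rule sets.Diff[OF borel_closed[OF closed_cone] borel_closed]) simp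
  moreover have "insert 0 cone - {0} = cone" by (auto simp: cone_def)
  ultimately show ?thesis by simp
qed

lemma cone_scale: "v \<in> cone \<Longrightarrow> c \<noteq> 0 \<Longrightarrow> c *\<^sub>R v \<in> cone"
  using span_image_scale[of "{v}" "\<lambda>_. c"] by (simp add: cone_def)

sublocale dp: dominated_potential \<mu> "restrict_space borel cone" act "\<lambda>x. ln (nrm x)" L
proof (rule dominated_potential_restricted[OF borel_cone _ supp_cone _ integrable_L])
  show "supp \<in> sets \<mu>" unfolding supp_def
    by (rule sets_measure_support[where A="carrier GL"]) (simp add: sets_eq GL_borel_def)
  show "nrm \<in> borel_measurable borel"
    by (intro borel_measurable_continuous_onI vector_norm_equivalence(2)[OF nrm])
  show "\<And>g. g \<in> space \<mu> \<Longrightarrow> 0 \<le> L g" by (simp add: L_nonneg space_eq)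
  show "\<And>g x. g \<in> supp \<Longrightarrow> x \<in> cone \<Longrightarrow> \<bar>ln (nrm (g *v x)) - ln (nrm x)\<bar> \<le> L g"
    using supp_invertible by (intro nrm_bound) (auto simp: cone_def)
qed

lemma space_cone [simp]: "space (restrict_space borel cone) = cone"
  using borel_cone by (simp add: space_restrict_space)

lemma nrm_pos: "v \<in> cone \<Longrightarrow> 0 < nrm v"
  by (rule vector_norm_pos[OF nrm]) (simp add: cone_def)

lemma AE_supp: "AE b in S. \<forall>k. b k \<in> supp"
  unfolding supp_def
  by (rule AE_all_coordinates, rule AE_measure_support[where A="carrier GL"]) (simp add: sets_eq GL_borel_def)

lemma orbit_eq: "(\<And>k. b k \<in> supp) \<Longrightarrow> orbit act b v n = left_product b n *v v"
  by (rule orbit_restricted_act)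

lemma drift_eq:
  assumes v: "v \<in> cone"
  shows "(\<integral>g. ln (nrm (g *v v) / nrm v) \<partial>(GL_conv_power \<mu> n)) = dp.drift n v"
proof -
  have [measurable]: "nrm \<in> borel_measurable borel"
    by (intro borel_measurable_continuous_onI vector_norm_equivalence(2)[OF nrm])
  have "(\<lambda>g. g) \<in> borel_measurable GL_borel"
    unfolding GL_borel_def by (intro measurable_restrict_space1) simp
  then have [measurable]: "(\<lambda>g. g *v v) \<in> borel_measurable GL_borel"
    by (intro borel_measurable_matrix_vector_mult) simp_all
  have [measurable]: "(\<lambda>b. left_product b n *v v) \<in> borel_measurable S"
    by (intro borel_measurable_matrix_vector_mult) simp_all
  have "(\<integral>g. ln (nrm (g *v v) / nrm v) \<partial>(GL_conv_power \<mu> n))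
      = (\<integral>b. ln (nrm (left_product b n *v v) / nrm v) \<partial>S)"
    unfolding GL_conv_power_eq by (subst integral_distr) auto
  also have "\<dots> = dp.drift n v"
    unfolding dp.drift_def
  proof (rule integral_cong_AE)
    show "AE b in S. ln (nrm (left_product b n *v v) / nrm v) = ln (nrm (orbit act b v n)) - ln (nrm v)"
      using AE_supp AE_space
    proof eventually_elim
      case (elim b)
      have o: "orbit act b v n = left_product b n *v v" using elim(1) by (intro orbit_eq) blast
      have "orbit act b v n \<in> cone" using dp.orbit_in_space[OF elim(2), of v n] v by simp
      then show ?case using nrm_pos[OF v] nrm_pos[of "orbit act b v n"] by (simp add: o ln_div)
    qed
    show "(\<lambda>b. ln (nrm (orbit act b v n)) - ln (nrm v)) \<in> borel_measurable S"
      by (rule dp.measurable_increment) (simp add: v)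
  qed measurable
  finally show ?thesis .
qed

lemma orbit_scale: "orbit act b (c *\<^sub>R v) n = c *\<^sub>R orbit act b v n"
  by (induction n) (auto simp: restricted_act_def[of supp "b _"] matrix_vector_mult_scaleR)

lemma uniform_drift_cone:
  assumes "\<And>v. v \<in> cone \<Longrightarrow> \<exists>n\<ge>1. 0 < dp.drift n v"
  shows "\<exists>c>0. \<exists>C. \<forall>n. \<forall>v\<in>cone. c * real n - C \<le> dp.drift n v"
proof -
  define K where "K = insert 0 cone \<inter> sphere 0 1"
  have K: "v \<in> cone" "norm v = 1" if "v \<in> K" for v using that by (auto simp: K_def)
  have "\<exists>c>0. \<exists>C. \<forall>n. \<forall>v\<in>space (restrict_space borel cone). c * real n - C \<le> dp.drift n v"
  proof (rule dp.uniform_drift[where K=K and \<iota>="\<lambda>v. v"])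
    show "compact K" unfolding K_def using closed_cone by (intro closed_Int_compact) auto
    show "continuous_on K (dp.drift n)" for n
    proof (rule dp.continuous_on_drift)
      fix b assume b: "b \<in> space S"
      have nz: "nrm (orbit act b y n) \<noteq> 0" "nrm y \<noteq> 0" if "y \<in> K" for y
        using dp.orbit_in_space[OF b, of y n] K(1)[OF that] nrm_pos[of "orbit act b y n"] nrm_pos[of y] by auto
      have "continuous_on K (\<lambda>y. nrm (orbit act b y n))"
        by (rule continuous_on_compose2[OF vector_norm_equivalence(2)[OF nrm] continuous_on_orbit_restricted_act]) simp
      moreover have "continuous_on K nrm"
        by (rule continuous_on_subset[OF vector_norm_equivalence(2)[OF nrm]]) simp
      ultimately show "continuous_on K (\<lambda>y. ln (nrm (orbit act b y n)) - ln (nrm y))"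
        using nz by (intro continuous_intros) auto
    qed (use K in auto)
    show "\<exists>y\<in>K. \<forall>n. dp.drift n y = dp.drift n v" if "v \<in> space (restrict_space borel cone)" for v
    proof -
      have v: "v \<in> cone" using that by simp
      then have "v \<noteq> 0" by (simp add: cone_def)
      define c where "c = 1 / norm v"
      have c: "c > 0" using \<open>v \<noteq> 0\<close> by (simp add: c_def)
      have "c *\<^sub>R v \<in> K" using cone_scale[OF v, of c] \<open>v \<noteq> 0\<close> c by (simp add: K_def c_def)
      moreover have "dp.drift n (c *\<^sub>R v) = dp.drift n v" for n
        unfolding dp.drift_def
      proof (rule Bochner_Integration.integral_cong[OF refl])
        fix b assume b: "b \<in> space S"
        have "0 < nrm (orbit act b v n)" using dp.orbit_in_space[OF b, of v n] v by (intro nrm_pos) simp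
        then show "ln (nrm (orbit act b (c *\<^sub>R v) n)) - ln (nrm (c *\<^sub>R v)) = ln (nrm (orbit act b v n)) - ln (nrm v)"
          using c nrm_pos[OF v] by (simp add: orbit_scale vector_norm_scale[OF nrm] ln_mult)
      qed
      ultimately show ?thesis by blast
    qed
  qed (use assms K in auto)
  then show ?thesis by simp
qed

text \<open>Otherwise all drifts are at most 0, while expansion makes the lower rate nonnegative;
  \<open>ex_subseq_orbit_tendsto\<close> with \<open>m = 0\<close> then yields a subsequence of rate
  0, against the positive lower limit. The positive rate may depend on \<open>b\<close>, so 0 is
  taken as the common lower bound.\<close>

lemma expansion_imp_positive_drift:
  assumes v: "v \<in> cone"
    and exp: "AE b in S. liminf (\<lambda>n. ereal (rate nrm b v n)) > 0"
  shows "\<exists>n\<ge>1. 0 < dp.drift n v"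
proof (rule ccontr)
  assume "\<not> (\<exists>n\<ge>1. 0 < dp.drift n v)"
  then have neg: "dp.drift n v \<le> 0 * real n" if "n \<ge> 1" for n using that by (simp add: not_less)
  have ev: "AE b in S. \<exists>c>0. \<forall>\<^sub>F n in sequentially. c * real n < ln (nrm (orbit act b v n))"
    using exp AE_supp
  proof eventually_elim
    case (elim b)
    obtain c where c: "0 < c" "ereal c < liminf (\<lambda>n. ereal (rate nrm b v n))"
      using elim(1) ereal_dense2[of 0] by (auto simp: zero_ereal_def)
    have "\<forall>\<^sub>F n in sequentially. ereal c < ereal (rate nrm b v n)"
      by (rule less_LiminfD[OF c(2)])
    then have "\<forall>\<^sub>F n in sequentially. c * real n < ln (nrm (left_product b n *v v))"
      using eventually_gt_at_top[of 0]
      by eventually_elim (simp add: field_simps)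
    moreover have "orbit act b v n = left_product b n *v v" for n using elim(2) by (intro orbit_eq) blast
    ultimately show ?case using c(1) by auto
  qed
  have "AE b in S. growth_le (\<lambda>n. - (ln (nrm (orbit act b v n)) - ln (nrm v))) (- 0)"
    using ev
  proof eventually_elim
    case (elim b)
    then obtain c where c: "c > 0" "\<forall>\<^sub>F n in sequentially. c * real n < ln (nrm (orbit act b v n))" by blast
    have "growth_le (\<lambda>n. - ln (nrm (orbit act b v n))) 0"
    proof (rule growth_le_of_eventually)
      fix d :: real assume "0 < d"
      show "\<forall>\<^sub>F n in sequentially. - ln (nrm (orbit act b v n)) \<le> d * real n"
        using c(2)
      proof eventually_elim
        case (elim n)
        have "0 \<le> c * real n" "0 \<le> d * real n" using c(1) \<open>0 < d\<close> by auto
        then show ?case using elim by linarith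
      qed
    qed
    then have "growth_le (\<lambda>n. - (ln (nrm (orbit act b v n)) - ln (nrm v))) 0"
      by (rule growth_le_mono[where C="ln (nrm v)"]) simp
    then show ?case by simp
  qed
  from dp.ex_subseq_orbit_tendsto[OF _ this neg] v
  obtain r :: "nat \<Rightarrow> nat" where r: "strict_mono r"
    "AE b in S. (\<lambda>k. (ln (nrm (orbit act b v (r k))) - ln (nrm v)) / real (r k)) \<longlonglongrightarrow> 0" by auto
  have "AE b in S. False"
    using ev r(2)
  proof eventually_elim
    case (elim b)
    then obtain c where c: "c > 0" "\<forall>\<^sub>F n in sequentially. c * real n < ln (nrm (orbit act b v n))" by blast
    have rinf: "filterlim r at_top sequentially" by (rule filterlim_subseq[OF r(1)])
    have "(\<lambda>k. (ln (nrm (orbit act b v (r k))) - ln (nrm v)) / real (r k) + ln (nrm v) / real (r k)) \<longlonglongrightarrow> 0 + 0"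
      by (intro tendsto_add elim(2) filterlim_compose[OF lim_const_over_n rinf])
    then have "(\<lambda>k. ln (nrm (orbit act b v (r k))) / real (r k)) \<longlonglongrightarrow> 0"
      by (simp add: diff_divide_distrib)
    then have "\<forall>\<^sub>F k in sequentially. ln (nrm (orbit act b v (r k))) / real (r k) < c"
      using c(1) by (rule order_tendstoD)
    moreover have "\<forall>\<^sub>F k in sequentially. c * real (r k) < ln (nrm (orbit act b v (r k)))"
      using c(2) rinf by (rule eventually_compose_filterlim)
    moreover note eventually_subseq_pos[OF r(1)]
    ultimately have "\<forall>\<^sub>F k in sequentially. False"
      by eventually_elim (simp add: field_simps)
    then show ?case by simp
  qed
  then show False by simp
qed

text \<open>The drift bound gives a positive lower rate, and \<open>AE_ex_limit_vector_norm\<close>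
  gives the limit. Halving \<open>c'\<close> pays for the small error allowed in
  \<open>growth_le\<close>.\<close>

lemma positive_drift_imp_limit:
  assumes N: "N \<ge> 1" and "c > 0" and drift: "\<And>v. v \<in> cone \<Longrightarrow> c \<le> dp.drift N v" and v: "v \<in> cone"
  shows "AE b in S. \<exists>l>0. rate nrm b v \<longlonglongrightarrow> l"
proof -
  define c' where "c' = c / real N"
  have c': "c' > 0" using \<open>c > 0\<close> N by (simp add: c'_def)
  have "AE b in S. growth_le (\<lambda>n. - (ln (nrm (orbit act b v n)) - ln (nrm v))) (- c')"
    by (rule dp.AE_growth_orbit_lower[OF N]) (use drift N v in \<open>auto simp: c'_def\<close>)
  moreover have "AE b in S. \<exists>l. rate nrm b v \<longlonglongrightarrow> l"
    using v by (intro AE_ex_limit_vector_norm[OF nrm]) (simp add: cone_def)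
  ultimately show ?thesis
    using AE_supp
  proof eventually_elim
    case (elim b)
    obtain l where l: "rate nrm b v \<longlonglongrightarrow> l" using elim(2) by blast
    have o: "orbit act b v n = left_product b n *v v" for n using elim(3) by (intro orbit_eq) blast
    have "growth_le (\<lambda>n. - ln (nrm (left_product b n *v v))) (- c')"
      by (rule growth_le_mono[OF elim(1), of _ "- ln (nrm v)"]) (simp add: o)
    then have "\<forall>\<^sub>F n in sequentially. - ln (nrm (left_product b n *v v)) \<le> (- c' / 2) * real n"
      by (rule growth_le_eventually) (use c' in simp)
    then have "\<forall>\<^sub>F n in sequentially. c' / 2 \<le> rate nrm b v n"
      using eventually_gt_at_top[of 0] by eventually_elim (simp add: field_simps)
    then have "c' / 2 \<le> l" by (intro tendsto_lowerbound[OF l]) auto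
    then have "l > 0" using c' by linarith
    with l show ?case by blast
  qed
qed

end

section \<open>The equivalences, as a cycle from expansion through (i), (ii), (iii) and back\<close>

theorem proposition2p4:
  fixes nrm :: "real^'d \<Rightarrow> real"
    and \<mu> :: "(real^'d^'d) measure"
    and P :: "(real^'d) set set"
  assumes "is_vector_norm nrm"
    and "prob_space \<mu>"
    and "sets \<mu> = sets GL_borel"
    and "finite_first_moment nrm \<mu>"
    and "closedin projective_topology P"
    and "projectively_invariant (support_group \<mu>) P"
  shows "(uniformly_expanding nrm \<mu> P \<longleftrightarrow>
            (\<exists>N::nat. \<exists>C1>0. \<forall>v. v \<noteq> 0 \<and> span {v} \<in> P \<longrightarrow> (\<forall>n\<ge>N.
               1 / real n * (\<integral>g. ln (nrm (g *v v) / nrm v) \<partial>(GL_conv_power \<mu> n)) \<ge> C1)))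
       \<and> (uniformly_expanding nrm \<mu> P \<longleftrightarrow>
            (\<exists>N::nat. \<exists>C2>0. \<forall>v. v \<noteq> 0 \<and> span {v} \<in> P \<longrightarrow>
               (\<integral>g. ln (nrm (g *v v) / nrm v) \<partial>(GL_conv_power \<mu> N)) \<ge> C2))
       \<and> (uniformly_expanding nrm \<mu> P \<longleftrightarrow>
            (\<forall>v. v \<noteq> 0 \<and> span {v} \<in> P \<longrightarrow>
               (AE b in (\<Pi>\<^sub>M m\<in>(UNIV :: nat set). \<mu>).
                  \<exists>l>0. (\<lambda>n. 1 / real n * ln (nrm (left_product b n *v v))) \<longlonglongrightarrow> l)))"
    (is "(?UE \<longleftrightarrow> ?I) \<and> (?UE \<longleftrightarrow> ?II) \<and> (?UE \<longleftrightarrow> ?III)")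
proof -
  obtain L where L: "random_matrices \<mu> L"
    "\<And>g x. invertible g \<Longrightarrow> x \<noteq> 0 \<Longrightarrow> \<bar>ln (nrm (g *v x)) - ln (nrm x)\<bar> \<le> L g"
    using random_matricesI[OF assms(1-4)] by blast
  interpret expanding_action \<mu> L nrm P
    by (intro expanding_action.intro expanding_action_axioms.intro) (use L assms in auto)
  have mem_cone: "v \<noteq> 0 \<and> span {v} \<in> P \<longleftrightarrow> v \<in> cone" for v by (simp add: cone_def)
  have "?I" if UE: ?UE
  proof -
    have "\<exists>n\<ge>1. 0 < dp.drift n v" if "v \<in> cone" for v
      using UE that unfolding uniformly_expanding_def mem_cone by (intro expansion_imp_positive_drift) auto
    from uniform_drift_cone[OF this] obtain c C where c: "c > 0"
      "\<And>n v. v \<in> cone \<Longrightarrow> c * real n - C \<le> dp.drift n v" by blast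
    \<comment> \<open>From \<open>2 * C / c\<close> on, half of the linear term absorbs the
      constant; the 1 keeps the denominator positive.\<close>
    obtain N :: nat where N: "max 1 (2 * C / c) < real N" using reals_Archimedean2 by blast
    have "c / 2 \<le> 1 / real n * dp.drift n v" if v: "v \<in> cone" and n: "N \<le> n" for v n
    proof -
      have "2 * C / c \<le> real n" "0 < real n" using N n by auto
      then have "c / 2 * real n \<le> c * real n - C" using c(1) by (simp add: field_simps)
      also have "\<dots> \<le> dp.drift n v" by (rule c(2)[OF v])
      finally show ?thesis using \<open>0 < real n\<close> by (simp add: field_simps)
    qed
    then show ?thesis
      unfolding mem_cone using c(1) by (intro exI[of _ N] exI[of _ "c / 2"]) (simp add: drift_eq)
  qed
  moreover have ?II if I: ?I
  proof -
    obtain N C1 where N: "C1 > 0" "\<And>v n. v \<in> cone \<Longrightarrow> N \<le> n \<Longrightarrow> C1 \<le> 1 / real n * dp.drift n v"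
      using I unfolding mem_cone by (auto simp: drift_eq)
    \<comment> \<open>Taking \<open>max 1 N\<close> avoids \<open>n = 0\<close>, where
      \<open>1 / real n\<close> is 0.\<close>
    have "C1 \<le> dp.drift (max 1 N) v" if "v \<in> cone" for v
    proof -
      have "C1 \<le> 1 / real (max 1 N) * dp.drift (max 1 N) v" by (rule N(2)[OF that]) simp
      then have "C1 * real (max 1 N) \<le> dp.drift (max 1 N) v" by (simp add: field_simps)
      moreover have "C1 * 1 \<le> C1 * real (max 1 N)" using N(1) by (intro mult_left_mono) auto
      ultimately show ?thesis by linarith
    qed
    then show ?thesis
      unfolding mem_cone using N(1) by (intro exI[of _ "max 1 N"] exI[of _ C1]) (simp add: drift_eq)
  qed
  moreover have ?III if II: ?II
  proof -
    obtain N C2 where N: "C2 > 0" "\<And>v. v \<in> cone \<Longrightarrow> C2 \<le> dp.drift N v"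
      using II unfolding mem_cone by (auto simp: drift_eq)
    \<comment> \<open>As \<open>drift 0 v = 0\<close>, the value \<open>N = 0\<close> is possible
      only for an empty cone.\<close>
    have "N \<ge> 1" if "v \<in> cone" for v using N(1) N(2)[OF that] by (cases N) auto
    then show ?thesis
      unfolding mem_cone using positive_drift_imp_limit[OF _ N] by blast
  qed
  moreover have ?UE if III: ?III
    unfolding uniformly_expanding_def
  proof (intro allI impI)
    fix v :: "real^'d" assume "v \<noteq> 0 \<and> span {v} \<in> P"
    with III have "AE b in (\<Pi>\<^sub>M m\<in>(UNIV :: nat set). \<mu>).
      \<exists>l>0. rate nrm b v \<longlonglongrightarrow> l" by blast
    then show "AE b in (\<Pi>\<^sub>M m\<in>(UNIV :: nat set). \<mu>).
      liminf (\<lambda>n. ereal (rate nrm b v n)) > 0"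
    proof eventually_elim
      case (elim b)
      then obtain l where l: "l > 0" "rate nrm b v \<longlonglongrightarrow> l" by blast
      have "(\<lambda>n. ereal (rate nrm b v n)) \<longlonglongrightarrow> ereal l"
        using l(2) by (rule tendsto_ereal)
      then have "liminf (\<lambda>n. ereal (rate nrm b v n)) = ereal l"
        by (rule lim_imp_Liminf[OF sequentially_bot])
      then show ?case using l(1) by simp
    qed
  qed
  ultimately show ?thesis by blast
qed

end
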